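(* Let $\mathcal{H}=\bigoplus_{n\ge0}\mathcal{H}_n$ be a graded connected Hopf algebra over $\mathbb{R}$, with each $\mathcal{H}_n$ finite-dimensional, and with state space basis $\mathcal{B}=\amalg_n\mathcal{B}_n$. Let $a\ge2$ and $n\ge1$. Then, for each multiset $\{c_1,\dots,c_n\}$ in $\mathcal{B}_1$, the function $$\pi_{c_1,\dots,c_n}(x):=\frac{\eta(x)}{n!^2}\sum_{\sigma\in\mathfrak{S}_n}\xi^x_{c_{\sigma(1)},\dots,c_{\sigma(n)}}\qquad(x\in\mathcal{B}_n)$$ is a stationary distribution for the $a$th Hopf-power Markov chain on $\mathcal{B}_n$, and any stationary distribution of this chain can be uniquely written as a linear combination of these $\pi_{c_1,\dots,c_n}$. In particular: (i) if $\mathcal{B}_1=\{\bullet\}$, then $\pi_n(x):=\frac{\eta(x)}{n!}\xi^x_{\bullet,\dots,\bullet}$ is the unique stationary distribution of the chain on $\mathcal{B}_n$; (ii) if $\mathcal{H}$ is multigraded ($\mathcal{H}=\bigoplus_\nu\mathcal{H}_\nu$, $\mathcal{B}=\amalg_\nu\mathcal{B}_\nu$) and $\mathcal{B}_{(1,0,\dots,0)}=\{\bullet_1\}$, $\mathcal{B}_{(0,1,0,\dots,0)}=\{\bullet_2\}$ and so on, then for $|\nu|=n$, $$\pi_\nu(x):=\frac{\eta(x)}{n!^2}\sum_{\sigma\in\mathfrak{S}_n}\xi^x_{c_{\sigma(1)},\dots,c_{\sigma(n)}}\qquad(x\in\mathcal{B}_\nu),$$ with $c_1=\dots=c_{\nu_1}=\bullet_1$,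 $c_{\nu_1+1}=\dots=c_{\nu_1+\nu_2}=\bullet_2$, etc., is the unique stationary distribution of the chain on $\mathcal{B}_\nu$; and these are also necessary conditions: if the chain on $\mathcal{B}_n$ has a unique stationary distribution then $\mathcal{B}_1$ has exactly one element; and, in the multigraded case, if for every $\nu\ne0$ the chain on $\mathcal{B}_\nu$ has a unique stationary distribution, then each of $\mathcal{B}_{(1,0,\dots,0)},\mathcal{B}_{(0,1,0,\dots,0)},\dots$ has exactly one element.
   Context: A graded connected Hopf algebra over $\mathbb{R}$ is $\mathcal{H}=\bigoplus_{n\ge0}\mathcal{H}_n$ with $\mathcal{H}_0=\mathbb{R}\cdot1$, an associative unital product $\mathcal{H}_i\otimes\mathcal{H}_j\to\mathcal{H}_{i+j}$ and a coassociative coproduct $\Delta:\mathcal{H}_n\to\bigoplus_{j=0}^n\mathcal{H}_j\otimes\mathcal{H}_{n-j}$ with $\Delta(x)-1\otimes x-x\otimes1\in\bigoplus_{j=1}^{n-1}\mathcal{H}_j\otimes\mathcal{H}_{n-j}$ for $x\in\mathcal{H}_n$ ($n\ge1$), $\Delta(1)=1\otimes1$, and $\Delta(wz)=\Delta(w)\Delta(z)$. $\Psi^a:=m^{[a]}\Delta^{[a]}$ is the $a$-fold coproduct followed by the $a$-fold product. For a basis $\mathcal{B}=\amalg_n\mathcal{B}_n$ ($\mathcal{B}_n$ a basis of $\mathcal{H}_n$, $\mathcal{B}_0=\{1\}$), structure constants are defined by $z_1\cdots z_a=\sum_{y\in\mathcal{B}}\xi^y_{z_1,\dots,z_a}y$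 and $\Delta^{[a]}(x)=\sum_{z_1,\dots,z_a\in\mathcal{B}}\eta_x^{z_1,\dots,z_a}z_1\otimes\cdots\otimes z_a$. $\mathcal{B}$ is a state space basis if all $\xi^y_{w,z}\ge0$, all $\eta_x^{w,z}\ge0$ ($w,x,y,z\in\mathcal{B}$), and no $x\in\mathcal{B}$ with $\deg x>1$ satisfies $\Delta(x)=1\otimes x+x\otimes1$. The rescaling function is $\eta(x):=\sum_{c_1,\dots,c_n\in\mathcal{B}_1}\eta_x^{c_1,\dots,c_n}$ for $x\in\mathcal{B}_n$ (it is strictly positive on a state space basis). The $a$th Hopf-power Markov chain on $\mathcal{B}_n$ has transition matrix $\check K_{a,n}$ defined by $a^{-n}\Psi^a(x)=\sum_{y\in\mathcal{B}_n}\frac{\eta(x)}{\eta(y)}\check K_{a,n}(x,y)\,y$ for $x\in\mathcal{B}_n$. A stationary distribution is a probability distribution $\pi$ with $\sum_x\pi(x)\check K_{a,n}(x,y)=\pi(y)$ for all $y$. Multigraded means that $\mathcal{H}_n=\bigoplus_{|\nu|=n}\mathcal{H}_\nu$ over tuples $\nu$ of non-negative integers ($|\nu|$ the sum of the entries), product and coproduct respect the multidegree, and each $\mathcal{B}_\nu$ is a basis of $\mathcal{H}_\nu$; the chain on $\mathcal{B}_\nu$ is the restriction of the chain on $\mathcal{B}_{|\nu|}$ to $\mathcal{B}_\nu$. *)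

theory Defs
  imports "HOL-Analysis.Analysis" "HOL-Analysis.Finite_Function_Topology"
begin

(* The tensor algebra of a real vector space: the free vector space on lists of vectors
   modulo the subspace spanned by the multilinearity relations.  The k-th tensor power is
   the span of the classes of the lists of length k. *)

definition tensor_relators :: "('v::real_vector list \<Rightarrow>\<^sub>0 real) set" where
  "tensor_relators =
     {Poly_Mapping.single (us @ [x + y] @ ws) 1
        - Poly_Mapping.single (us @ [x] @ ws) 1
        - Poly_Mapping.single (us @ [y] @ ws) 1 | us x y ws. True} \<union>
     {Poly_Mapping.single (us @ [c *\<^sub>R x] @ ws) 1
        - c *\<^sub>R Poly_Mapping.single (us @ [x] @ ws) 1 | us c x ws. True}"

definition tensor_rel :: "('v::real_vector list \<Rightarrow>\<^sub>0 real) \<Rightarrow> ('v list \<Rightarrow>\<^sub>0 real) \<Rightarrow> bool" where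
  "tensor_rel f g \<longleftrightarrow> f - g \<in> span tensor_relators"

lemma equivp_tensor_rel: "equivp (tensor_rel :: ('v::real_vector list \<Rightarrow>\<^sub>0 real) \<Rightarrow> _)"
proof (rule equivpI)
  show "reflp (tensor_rel :: ('v list \<Rightarrow>\<^sub>0 real) \<Rightarrow> _)"
    by (auto simp: reflp_def tensor_rel_def span_zero)
  show "symp (tensor_rel :: ('v list \<Rightarrow>\<^sub>0 real) \<Rightarrow> _)"
  proof (rule sympI)
    fix f g :: "'v list \<Rightarrow>\<^sub>0 real" assume "tensor_rel f g"
    then have "- (f - g) \<in> span tensor_relators"
      unfolding tensor_rel_def by (rule span_neg)
    then show "tensor_rel g f" by (simp add: tensor_rel_def)
  qed
  show "transp (tensor_rel :: ('v list \<Rightarrow>\<^sub>0 real) \<Rightarrow> _)"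
  proof (rule transpI)
    fix f g h :: "'v list \<Rightarrow>\<^sub>0 real" assume "tensor_rel f g" "tensor_rel g h"
    then have "(f - g) + (g - h) \<in> span tensor_relators"
      unfolding tensor_rel_def by (rule span_add)
    then show "tensor_rel f h" by (simp add: tensor_rel_def)
  qed
qed

quotient_type (overloaded) 'v tensor = "'v::real_vector list \<Rightarrow>\<^sub>0 real" / tensor_rel
  by (rule equivp_tensor_rel)

instantiation tensor :: (real_vector) real_vector
begin

lift_definition zero_tensor :: "'a tensor" is "0" .

lift_definition plus_tensor :: "'a tensor \<Rightarrow> 'a tensor \<Rightarrow> 'a tensor" is "(+)"
  unfolding tensor_rel_def by (metis add_diff_add span_add)

lift_definition uminus_tensor :: "'a tensor \<Rightarrow> 'a tensor" is "uminus"
  unfolding tensor_rel_def by (metis minus_diff_minus span_neg)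

lift_definition minus_tensor :: "'a tensor \<Rightarrow> 'a tensor \<Rightarrow> 'a tensor" is "(-)"
proof -
  fix f f' g g' :: "'a list \<Rightarrow>\<^sub>0 real"
  assume "tensor_rel f f'" "tensor_rel g g'"
  then have "(f - f') - (g - g') \<in> span tensor_relators"
    unfolding tensor_rel_def by (rule span_diff)
  then show "tensor_rel (f - g) (f' - g')"
    by (simp add: tensor_rel_def algebra_simps)
qed

lift_definition scaleR_tensor :: "real \<Rightarrow> 'a tensor \<Rightarrow> 'a tensor" is "scaleR"
  unfolding tensor_rel_def by (metis scaleR_diff_right span_scale)

instance
  by standard
    (transfer; simp add: algebra_simps tensor_rel_def span_zero)+

end

lift_definition pure_tensor :: "'v::real_vector list \<Rightarrow> 'v tensor" is
  "\<lambda>vs. Poly_Mapping.single vs 1" .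

definition multilinear :: "('v::real_vector list \<Rightarrow> 'w::real_vector) \<Rightarrow> bool" where
  "multilinear g \<longleftrightarrow> (\<forall>us ws. linear (\<lambda>x. g (us @ [x] @ ws)))"

definition free_lift ::
    "('a \<Rightarrow> 'w::real_vector) \<Rightarrow> ('a \<Rightarrow>\<^sub>0 real) \<Rightarrow> 'w" where
  "free_lift g f = (\<Sum>v\<in>Poly_Mapping.keys f. Poly_Mapping.lookup f v *\<^sub>R g v)"

(* The linear map induced by g; only meaningful for multilinear g, where it does not
   depend on the chosen representative (see linear_tensor_lift, tensor_lift_pure). *)
definition tensor_lift ::
    "('v::real_vector list \<Rightarrow> 'w::real_vector) \<Rightarrow> 'v tensor \<Rightarrow> 'w" where
  "tensor_lift g t = free_lift g (rep_tensor t)"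

lemma lookup_scaleR: "Poly_Mapping.lookup (c *\<^sub>R f) v = c *\<^sub>R Poly_Mapping.lookup f v"
  for f :: "'a \<Rightarrow>\<^sub>0 'b::real_vector"
proof -
  have "{v. c *\<^sub>R Poly_Mapping.lookup f v \<noteq> 0} \<subseteq> Poly_Mapping.keys f"
    by (auto simp: in_keys_iff)
  then have "finite {v. c *\<^sub>R Poly_Mapping.lookup f v \<noteq> 0}"
    by (rule finite_subset) simp
  then show ?thesis by (simp add: scaleR_poly_mapping_def)
qed

lemma free_lift_superset:
  assumes "finite A" "Poly_Mapping.keys f \<subseteq> A"
  shows "free_lift g f = (\<Sum>v\<in>A. Poly_Mapping.lookup f v *\<^sub>R g v)"
  unfolding free_lift_def using assms
  by (intro sum.mono_neutral_left) (auto simp: in_keys_iff)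

lemma linear_free_lift: "linear (free_lift g)"
proof (rule linearI)
  fix f h :: "'a \<Rightarrow>\<^sub>0 real" and c :: real
  let ?A = "Poly_Mapping.keys f \<union> Poly_Mapping.keys h"
  have "Poly_Mapping.keys (f + h) \<subseteq> ?A" by (rule keys_add)
  then show "free_lift g (f + h) = free_lift g f + free_lift g h"
    by (simp add: free_lift_superset[of ?A] lookup_add scaleR_add_left sum.distrib)
  have "Poly_Mapping.keys (c *\<^sub>R f) \<subseteq> Poly_Mapping.keys f"
    by (auto simp: in_keys_iff lookup_scaleR)
  then show "free_lift g (c *\<^sub>R f) = c *\<^sub>R free_lift g f"
    by (simp add: free_lift_superset[of "Poly_Mapping.keys f"] lookup_scaleR scaleR_sum_right)
qed

lemma free_lift_single: "free_lift g (Poly_Mapping.single v 1) = g v"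
  by (simp add: free_lift_def)

lemma free_lift_relators:
  assumes "multilinear g" "f \<in> span tensor_relators"
  shows "free_lift g f = 0"
  using assms(2)
proof (induction rule: span_induct_alt)
  case base
  show ?case by (rule linear_0[OF linear_free_lift])
next
  case (step c x y)
  have lin: "linear (\<lambda>x. g (us @ [x] @ ws))" for us ws
    using assms(1) by (simp add: multilinear_def)
  from \<open>x \<in> tensor_relators\<close> have "free_lift g x = 0"
    unfolding tensor_relators_def
    by (auto simp: linear_diff[OF linear_free_lift] linear_scale[OF linear_free_lift]
        free_lift_single linear_add[OF lin, simplified] linear_scale[OF lin, simplified])
  with step show ?case
    by (simp add: linear_add[OF linear_free_lift] linear_scale[OF linear_free_lift])
qed

lemma tensor_lift_abs:
  assumes "multilinear g"
  shows "tensor_lift g (abs_tensor f) = free_lift g f"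
proof -
  have "tensor_rel (rep_tensor (abs_tensor f)) f"
    by (rule Quotient3_rep_abs[OF Quotient3_tensor]) (simp add: tensor_rel_def span_zero)
  then have "free_lift g (rep_tensor (abs_tensor f) - f) = 0"
    unfolding tensor_rel_def by (rule free_lift_relators[OF assms])
  then show ?thesis
    by (simp add: tensor_lift_def linear_diff[OF linear_free_lift])
qed

lemma linear_tensor_lift:
  assumes "multilinear g"
  shows "linear (tensor_lift g)"
proof (rule linearI)
  fix s t :: "'a tensor" and c :: real
  obtain f h where [simp]: "s = abs_tensor f" "t = abs_tensor h"
    by (metis Quotient3_abs_rep Quotient3_tensor)
  show "tensor_lift g (s + t) = tensor_lift g s + tensor_lift g t"
    by (simp add: plus_tensor.abs_eq tensor_lift_abs[OF assms] linear_add[OF linear_free_lift])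
  show "tensor_lift g (c *\<^sub>R s) = c *\<^sub>R tensor_lift g s"
    by (simp add: scaleR_tensor.abs_eq tensor_lift_abs[OF assms] linear_scale[OF linear_free_lift])
qed

lemma tensor_lift_pure:
  assumes "multilinear g"
  shows "tensor_lift g (pure_tensor vs) = g vs"
  by (simp add: pure_tensor.abs_eq tensor_lift_abs[OF assms] free_lift_single)

lemma multilinear_pure_tensor: "multilinear pure_tensor"
  unfolding multilinear_def
proof (intro allI linearI)
  fix us ws :: "'a list" and x y :: 'a and c :: real
  show "pure_tensor (us @ [x + y] @ ws)
      = pure_tensor (us @ [x] @ ws) + pure_tensor (us @ [y] @ ws)"
  proof transfer
    fix us ws :: "'a list" and x y
    have "Poly_Mapping.single (us @ [x + y] @ ws) 1
        - Poly_Mapping.single (us @ [x] @ ws) 1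
        - Poly_Mapping.single (us @ [y] @ ws) 1 \<in> (tensor_relators :: ('a list \<Rightarrow>\<^sub>0 real) set)"
      unfolding tensor_relators_def by blast
    then show "tensor_rel (Poly_Mapping.single (us @ [x + y] @ ws) 1)
       (Poly_Mapping.single (us @ [x] @ ws) 1 + Poly_Mapping.single (us @ [y] @ ws) 1)"
      unfolding tensor_rel_def by (metis diff_diff_add span_base)
  qed
  show "pure_tensor (us @ [c *\<^sub>R x] @ ws) = c *\<^sub>R pure_tensor (us @ [x] @ ws)"
  proof transfer
    fix us ws :: "'a list" and x and c :: real
    have "Poly_Mapping.single (us @ [c *\<^sub>R x] @ ws) 1
        - c *\<^sub>R Poly_Mapping.single (us @ [x] @ ws) 1
          \<in> (tensor_relators :: ('a list \<Rightarrow>\<^sub>0 real) set)"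
      unfolding tensor_relators_def by blast
    then show "tensor_rel (Poly_Mapping.single (us @ [c *\<^sub>R x] @ ws) 1)
       (c *\<^sub>R Poly_Mapping.single (us @ [x] @ ws) 1)"
      unfolding tensor_rel_def by (rule span_base)
  qed
qed

(* The tensors of lists of basis vectors form a basis of the tensor algebra. *)

fun coordinate :: "'v::real_vector set \<Rightarrow> 'v list \<Rightarrow> 'v list \<Rightarrow> real" where
  "coordinate B [] [] = 1"
| "coordinate B (b # bs) (v # vs) = representation B v b * coordinate B bs vs"
| "coordinate B _ _ = 0"

lemma multilinear_coordinate:
  assumes "independent B" "span B = UNIV"
  shows "multilinear (coordinate B bs)"
  unfolding multilinear_def
proof (intro allI)
  fix us ws
  show "linear (\<lambda>x. coordinate B bs (us @ [x] @ ws))"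
  proof (induction us arbitrary: bs)
    case Nil
    show ?case
      by (cases bs)
        (auto intro!: linearI simp: representation_add representation_scale assms algebra_simps)
  next
    case (Cons u us)
    show ?case
    proof (cases bs)
      case (Cons c cs)
      show ?thesis
        using linear_compose_scale_right[OF Cons.IH[of cs], of "representation B u c"]
        by (simp add: \<open>bs = c # cs\<close>)
    qed (auto intro: linearI)
  qed
qed

lemma coordinate_basis:
  assumes "independent B" "bs \<in> lists B" "cs \<in> lists B"
  shows "coordinate B bs cs = (if bs = cs then 1 else 0)"
  using assms
proof (induction B bs cs rule: coordinate.induct)
  case (2 B b bs v vs)
  then have "representation B v = (\<lambda>w. if w = v then 1 else 0)"
    by (intro representation_basis) auto
  with 2 show ?case by auto
qed auto

lemma pure_tensor_basis:
  assumes "independent B" "span B = UNIV"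
  shows inj_on_pure_tensor_lists: "inj_on pure_tensor (lists B)"
    and independent_pure_tensor_lists: "independent (pure_tensor ` lists B)"
    and span_pure_tensor_lists: "span (pure_tensor ` lists B) = UNIV"
proof -
  let ?c = "\<lambda>bs. tensor_lift (coordinate B bs)"
  have lin: "linear (?c bs)" for bs
    by (rule linear_tensor_lift[OF multilinear_coordinate[OF assms]])
  have c: "?c bs (pure_tensor cs) = (if bs = cs then 1 else 0)"
    if "bs \<in> lists B" "cs \<in> lists B" for bs cs
    using that tensor_lift_pure[OF multilinear_coordinate[OF assms]] coordinate_basis[OF assms(1)]
    by simp
  show inj: "inj_on pure_tensor (lists B)"
    by (rule inj_onI) (metis c zero_neq_one)
  show "independent (pure_tensor ` lists B)"
  proof
    assume "dependent (pure_tensor ` lists B)"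
    then obtain T u where T: "finite T" "T \<subseteq> pure_tensor ` lists B"
      "(\<Sum>v\<in>T. u v *\<^sub>R v) = 0" "\<exists>v\<in>T. u v \<noteq> 0"
      unfolding dependent_explicit by blast
    then obtain cs where cs: "cs \<in> lists B" "pure_tensor cs \<in> T" "u (pure_tensor cs) \<noteq> 0"
      by blast
    have "0 = ?c cs (\<Sum>v\<in>T. u v *\<^sub>R v)"
      using T(3) by (simp add: linear_0[OF lin])
    also have "\<dots> = (\<Sum>v\<in>T. u v * ?c cs v)"
      by (simp add: linear_sum[OF lin] linear_scale[OF lin])
    also have "\<dots> = (\<Sum>v\<in>T. if v = pure_tensor cs then u v else 0)"
    proof (rule sum.cong[OF refl])
      fix v assume "v \<in> T"
      with T(2) obtain ds where ds: "ds \<in> lists B" "v = pure_tensor ds" by blast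
      then show "u v * ?c cs v = (if v = pure_tensor cs then u v else 0)"
        using c[OF cs(1) ds(1)] inj_onD[OF inj _ cs(1) ds(1)] by auto
    qed
    also have "\<dots> = u (pure_tensor cs)" using T(1) cs(2) by simp
    finally show False using cs(3) by simp
  qed
  have pure: "pure_tensor (bs @ vs) \<in> span (pure_tensor ` lists B)" if "bs \<in> lists B" for bs vs
    using that
  proof (induction vs arbitrary: bs)
    case Nil
    then show ?case by (simp add: span_base)
  next
    case (Cons v vs)
    have "linear (\<lambda>x. pure_tensor (bs @ [x] @ vs))"
      using multilinear_pure_tensor unfolding multilinear_def by blast
    note l = linear_0[OF this] linear_add[OF this] linear_scale[OF this]
    have "v \<in> span B" by (simp add: assms(2))
    then have "pure_tensor (bs @ [v] @ vs) \<in> span (pure_tensor ` lists B)"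
    proof (induction rule: span_induct_alt)
      case base
      show ?case by (subst l(1)) (rule span_zero)
    next
      case (step k x y)
      have "pure_tensor ((bs @ [x]) @ vs) \<in> span (pure_tensor ` lists B)"
        using Cons.prems step.hyps by (intro Cons.IH) auto
      then show ?case
        unfolding l(2) l(3) using step.IH by (intro span_add span_scale) auto
    qed
    then show ?case by simp
  qed
  have "t \<in> span (pure_tensor ` lists B)" for t
  proof -
    obtain f where f: "t = abs_tensor f" by (metis Quotient3_abs_rep Quotient3_tensor)
    have "abs_tensor f = free_lift pure_tensor f"
    proof -
      let ?A = "Poly_Mapping.keys f"
      have lin: "linear (abs_tensor :: ('a list \<Rightarrow>\<^sub>0 real) \<Rightarrow> _)"
        by (rule linearI) (simp_all add: plus_tensor.abs_eq scaleR_tensor.abs_eq)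
      have "(\<Sum>v\<in>?A. Poly_Mapping.lookup f v *\<^sub>R Poly_Mapping.single v (1::real)) = f"
        by (rule poly_mapping_eqI)
          (simp add: lookup_sum lookup_scaleR lookup_single when_def in_keys_iff if_distrib
            cong: if_cong)
      then have "abs_tensor f
          = abs_tensor (\<Sum>v\<in>?A. Poly_Mapping.lookup f v *\<^sub>R Poly_Mapping.single v (1::real))"
        by simp
      also have "\<dots> = free_lift pure_tensor f"
        by (simp add: linear_sum[OF lin] linear_scale[OF lin] free_lift_def pure_tensor.abs_eq)
      finally show ?thesis .
    qed
    also have "\<dots> \<in> span (pure_tensor ` lists B)"
      unfolding free_lift_def using pure[of "[]"] by (intro span_sum span_scale) auto
    finally show ?thesis using f by simp
  qed
  then show "span (pure_tensor ` lists B) = UNIV" by auto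
qed

(* Multiplication in the tensor algebra: pure_tensor us \<otimes> pure_tensor ws = pure_tensor (us @ ws). *)
definition tensor_prod ::
    "'v::real_vector tensor \<Rightarrow> 'v tensor \<Rightarrow> 'v tensor" (infixr "\<otimes>" 75) where
  "s \<otimes> t = tensor_lift (\<lambda>us. tensor_lift (\<lambda>ws. pure_tensor (us @ ws)) t) s"

(* Componentwise multiplication in each tensor power of an algebra,
   (u1 \<otimes> ... \<otimes> uk)(w1 \<otimes> ... \<otimes> wk) = u1 w1 \<otimes> ... \<otimes> uk wk. *)
definition tensor_times ::
    "'h::real_algebra_1 tensor \<Rightarrow> 'h tensor \<Rightarrow> 'h tensor" where
  "tensor_times s t =
     tensor_lift (\<lambda>us. tensor_lift (\<lambda>ws.
       if length us = length ws then pure_tensor (map2 (*) us ws) else 0) t) s"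

(* \<Delta> \<otimes> id \<otimes> ... \<otimes> id and id \<otimes> ... \<otimes> id \<otimes> \<Delta>, on tensors of positive degree *)
definition apply_first ::
    "('v::real_vector \<Rightarrow> 'v tensor) \<Rightarrow> 'v tensor \<Rightarrow> 'v tensor" where
  "apply_first \<Delta> = tensor_lift (\<lambda>vs. \<Delta> (hd vs) \<otimes> pure_tensor (tl vs))"

definition apply_last ::
    "('v::real_vector \<Rightarrow> 'v tensor) \<Rightarrow> 'v tensor \<Rightarrow> 'v tensor" where
  "apply_last \<Delta> = tensor_lift (\<lambda>vs. pure_tensor (butlast vs) \<otimes> \<Delta> (last vs))"

(* The image of U \<otimes> W in the second tensor power *)
definition tensor_subspace :: "'v::real_vector set \<Rightarrow> 'v set \<Rightarrow> 'v tensor set" where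
  "tensor_subspace U W = span {pure_tensor [u, w] | u w. u \<in> U \<and> w \<in> W}"

definition internal_direct_sum ::
    "('i \<Rightarrow> 'v::real_vector set) \<Rightarrow> 'i set \<Rightarrow> 'v set \<Rightarrow> bool" where
  "internal_direct_sum V I W \<longleftrightarrow>
     subspace W \<and> (\<forall>i\<in>I. subspace (V i) \<and> V i \<subseteq> W) \<and>
     (\<forall>x\<in>W. \<exists>!f. (\<forall>i\<in>I. f i \<in> V i) \<and> (\<forall>i. i \<notin> I \<longrightarrow> f i = 0) \<and>
        finite {i. f i \<noteq> 0} \<and> x = (\<Sum>i | f i \<noteq> 0. f i))"

(* The underlying space is the whole type, and the associative unital product is that of
   the class real_algebra_1. *)
locale graded_connected_hopf_algebra =
  fixes H :: "nat \<Rightarrow> 'h::real_algebra_1 set"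
    and \<Delta> :: "'h \<Rightarrow> 'h tensor"
  assumes graded: "internal_direct_sum H UNIV UNIV"
    and connected: "H 0 = span {1}"
    and mult_graded: "\<lbrakk>w \<in> H i; z \<in> H j\<rbrakk> \<Longrightarrow> w * z \<in> H (i + j)"
    and comult_linear: "linear \<Delta>"
    and comult_graded:
      "x \<in> H n \<Longrightarrow> \<Delta> x \<in> span (\<Union>j\<in>{0..n}. tensor_subspace (H j) (H (n - j)))"
    and comult_reduced:
      "\<lbrakk>n \<ge> 1; x \<in> H n\<rbrakk> \<Longrightarrow>
         \<Delta> x - pure_tensor [1, x] - pure_tensor [x, 1]
           \<in> span (\<Union>j\<in>{1..n-1}. tensor_subspace (H j) (H (n - j)))"
    and coassoc: "apply_first \<Delta> (\<Delta> x) = apply_last \<Delta> (\<Delta> x)"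
    and comult_one: "\<Delta> 1 = pure_tensor [1, 1]"
    and comult_mult: "\<Delta> (w * z) = tensor_times (\<Delta> w) (\<Delta> z)"

(* The a-fold coproduct, for a \<ge> 1 *)
definition iterated_coproduct ::
    "('h::real_algebra_1 \<Rightarrow> 'h tensor) \<Rightarrow> nat \<Rightarrow> 'h \<Rightarrow> 'h tensor" where
  "iterated_coproduct \<Delta> a x = (apply_last \<Delta> ^^ (a - 1)) (pure_tensor [x])"

definition hopf_power ::
    "('h::real_algebra_1 \<Rightarrow> 'h tensor) \<Rightarrow> nat \<Rightarrow> 'h \<Rightarrow> 'h" where
  "hopf_power \<Delta> a x = tensor_lift prod_list (iterated_coproduct \<Delta> a x)"

definition graded_basis ::
    "(nat \<Rightarrow> 'h::real_algebra_1 set) \<Rightarrow> (nat \<Rightarrow> 'h set) \<Rightarrow> bool" where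
  "graded_basis H B \<longleftrightarrow>
     (\<forall>n. independent (B n) \<and> span (B n) = H n) \<and> B 0 = {1}"

definition all_basis :: "('i \<Rightarrow> 'h set) \<Rightarrow> 'h set" where
  "all_basis B = (\<Union>i. B i)"

(* product_coeff B zs y is the coefficient of y in the product of the list zs;
   coproduct_coeff B \<Delta> x zs is the coefficient of the basis tensor zs in the
   (length zs)-fold coproduct of x. *)
definition product_coeff ::
    "(nat \<Rightarrow> 'h::real_algebra_1 set) \<Rightarrow> 'h list \<Rightarrow> 'h \<Rightarrow> real" where
  "product_coeff B zs y = representation (all_basis B) (prod_list zs) y"

definition coproduct_coeff ::
    "(nat \<Rightarrow> 'h::real_algebra_1 set) \<Rightarrow> ('h \<Rightarrow> 'h tensor) \<Rightarrow> 'h \<Rightarrow> 'h list \<Rightarrow> real" where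
  "coproduct_coeff B \<Delta> x zs =
     representation (pure_tensor ` lists (all_basis B))
       (iterated_coproduct \<Delta> (length zs) x) (pure_tensor zs)"

definition state_space_basis ::
    "(nat \<Rightarrow> 'h::real_algebra_1 set) \<Rightarrow> ('h \<Rightarrow> 'h tensor) \<Rightarrow> (nat \<Rightarrow> 'h set) \<Rightarrow> bool" where
  "state_space_basis H \<Delta> B \<longleftrightarrow>
     graded_basis H B \<and>
     (\<forall>w\<in>all_basis B. \<forall>z\<in>all_basis B. \<forall>y\<in>all_basis B. product_coeff B [w, z] y \<ge> 0) \<and>
     (\<forall>x\<in>all_basis B. \<forall>w\<in>all_basis B. \<forall>z\<in>all_basis B. coproduct_coeff B \<Delta> x [w, z] \<ge> 0) \<and>
     (\<forall>n>1. \<forall>x\<in>B n. \<Delta> x \<noteq> pure_tensor [1, x] + pure_tensor [x, 1])"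

(* The rescaling function on B n *)
definition rescaling ::
    "(nat \<Rightarrow> 'h::real_algebra_1 set) \<Rightarrow> ('h \<Rightarrow> 'h tensor) \<Rightarrow> nat \<Rightarrow> 'h \<Rightarrow> real" where
  "rescaling B \<Delta> n x = (\<Sum>cs | set cs \<subseteq> B 1 \<and> length cs = n. coproduct_coeff B \<Delta> x cs)"

(* Comparing coefficients of y in
     a^(-n) \<Psi>^a(x) = (\<Sum>y. \<eta>(x) / \<eta>(y) * K x y *\<^sub>R y)
   gives this entry K x y. *)
definition hopf_power_chain ::
    "(nat \<Rightarrow> 'h::real_algebra_1 set) \<Rightarrow> ('h \<Rightarrow> 'h tensor) \<Rightarrow> nat \<Rightarrow> nat \<Rightarrow> 'h \<Rightarrow> 'h \<Rightarrow> real" where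
  "hopf_power_chain B \<Delta> a n x y =
     rescaling B \<Delta> n y / rescaling B \<Delta> n x
       * representation (all_basis B) ((1 / real a ^ n) *\<^sub>R hopf_power \<Delta> a x) y"

(* Distributions on a state space S are functions whose values off S are irrelevant. *)
definition stationary_distribution ::
    "'s set \<Rightarrow> ('s \<Rightarrow> 's \<Rightarrow> real) \<Rightarrow> ('s \<Rightarrow> real) \<Rightarrow> bool" where
  "stationary_distribution S K p \<longleftrightarrow>
     (\<forall>x\<in>S. p x \<ge> 0) \<and> (\<Sum>x\<in>S. p x) = 1 \<and>
     (\<forall>y\<in>S. (\<Sum>x\<in>S. p x * K x y) = p y)"

definition unique_stationary_distribution ::
    "'s set \<Rightarrow> ('s \<Rightarrow> 's \<Rightarrow> real) \<Rightarrow> ('s \<Rightarrow> real) \<Rightarrow> bool" where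
  "unique_stationary_distribution S K p \<longleftrightarrow>
     stationary_distribution S K p \<and>
     (\<forall>q. stationary_distribution S K q \<longrightarrow> (\<forall>x\<in>S. q x = p x))"

definition chain_distribution ::
    "(nat \<Rightarrow> 'h::real_algebra_1 set) \<Rightarrow> ('h \<Rightarrow> 'h tensor) \<Rightarrow> 'h list \<Rightarrow> 'h \<Rightarrow> real" where
  "chain_distribution B \<Delta> cs x =
     rescaling B \<Delta> (length cs) x / (fact (length cs))\<^sup>2
       * (\<Sum>\<sigma> | \<sigma> permutes {..<length cs}. product_coeff B (permute_list \<sigma> cs) x)"

(* chain_distribution B \<Delta> cs depends only on the multiset of entries of cs. *)
definition mset_distribution ::
    "(nat \<Rightarrow> 'h::real_algebra_1 set) \<Rightarrow> ('h \<Rightarrow> 'h tensor) \<Rightarrow> 'h multiset \<Rightarrow> 'h \<Rightarrow> real" where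
  "mset_distribution B \<Delta> M = chain_distribution B \<Delta> (SOME cs. mset cs = M)"

(* Multidegrees are lists of naturals of a fixed length r. *)
definition multidegrees :: "nat \<Rightarrow> nat list set" where
  "multidegrees r = {\<nu>. length \<nu> = r}"

definition unit_multidegree :: "nat \<Rightarrow> nat \<Rightarrow> nat list" where
  "unit_multidegree r i = (replicate r 0)[i := 1]"

definition multigrading ::
    "(nat \<Rightarrow> 'h::real_algebra_1 set) \<Rightarrow> ('h \<Rightarrow> 'h tensor) \<Rightarrow> (nat \<Rightarrow> 'h set) \<Rightarrow>
     nat \<Rightarrow> (nat list \<Rightarrow> 'h set) \<Rightarrow> (nat list \<Rightarrow> 'h set) \<Rightarrow> bool" where
  "multigrading H \<Delta> B r HH BB \<longleftrightarrow>
     (\<forall>n. internal_direct_sum HH {\<nu> \<in> multidegrees r. sum_list \<nu> = n} (H n)) \<and>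
     (\<forall>\<mu>\<in>multidegrees r. \<forall>\<rho>\<in>multidegrees r. \<forall>w\<in>HH \<mu>. \<forall>z\<in>HH \<rho>.
        w * z \<in> HH (map2 (+) \<mu> \<rho>)) \<and>
     (\<forall>\<nu>\<in>multidegrees r. \<forall>x\<in>HH \<nu>.
        \<Delta> x \<in> span (\<Union>(\<mu>, \<rho>)\<in>{(\<mu>, \<rho>) \<in> multidegrees r \<times> multidegrees r. map2 (+) \<mu> \<rho> = \<nu>}.
                    tensor_subspace (HH \<mu>) (HH \<rho>))) \<and>
     (\<forall>\<nu>\<in>multidegrees r. independent (BB \<nu>) \<and> span (BB \<nu>) = HH \<nu>) \<and>
     (\<forall>n. B n = (\<Union>\<nu>\<in>{\<nu> \<in> multidegrees r. sum_list \<nu> = n}. BB \<nu>))"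

(* b 0 repeated \<nu> ! 0 times, then b 1 repeated \<nu> ! 1 times, and so on *)
definition multidegree_word :: "(nat \<Rightarrow> 'h) \<Rightarrow> nat list \<Rightarrow> 'h list" where
  "multidegree_word b \<nu> = concat (map (\<lambda>i. replicate (\<nu> ! i) (b i)) [0..<length \<nu>])"

end

theory Submission
  imports Defs "HOL-Combinatorics.Multiset_Permutations"
begin

text \<open>
  Write \<open>E ys\<close> for the convolution product of the coordinate functionals of a word \<open>ys\<close> of basis
  elements of positive degree, so that \<open>E ys x\<close> is the coproduct structure constant of \<open>x\<close> at \<open>ys\<close>.
  By multiplicativity of the coproduct, \<open>E ys (w z)\<close> is the sum of \<open>E us w E ws z\<close> over all ways of
  splitting \<open>ys\<close> into two subwords, up to terms in which the two words are longer in total. Since the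
  Hopf power is a convolution power of the identity, \<open>E ys\<close> composed with it is the sum of \<open>E ts\<close>
  over the \<open>a ^ length ys\<close> inverse riffle shuffles \<open>ts\<close> of \<open>ys\<close>, up to longer words.

  Let \<open>v\<close> of degree \<open>n\<close> be an eigenvector of eigenvalue \<open>a ^ n\<close>. Words longer than \<open>n\<close> vanish on it, so
  on words of length \<open>n\<close> the function \<open>E ys v\<close> is harmonic for the shuffle, hence invariant under
  rearrangement. If it is zero, then descending through the lengths \<open>k < n\<close> it is zero on all words,
  since it equals \<open>a ^ (k - n)\<close> times the average of its rearrangements; thus \<open>v = 0\<close>. The symmetrised
  products of \<open>n\<close> elements of degree one are eigenvectors realising all symmetric functions on words
  of length \<open>n\<close>, so they span the eigenspace, and rescaling turns them into stationary distributions.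
\<close>

section \<open>Multilinear maps on the tensor algebra\<close>

text \<open>A distribution \<open>p\<close> on \<open>B n\<close> is encoded as the vector
  \<open>dist_vec n p\<close> with coordinates \<open>p x / eta n x\<close>. This undoes the
  rescaling in the chain, so stationarity becomes the eigenvector equation. Since
  \<open>eta n\<close> is the sum of \<open>E cs\<close> over all words of length \<open>n\<close>
  in \<open>B 1\<close>, the total mass of \<open>p\<close> is the sum of the word values of its
  vector. The obstacle is that \<open>E ys\<close> on a product is not just a sum over splittings: a
  letter of degree above one can be a coordinate of a product of two elements of positive degree.
  Replacing it by those two factors lengthens the words in total, so length behaves as a filtration,
  and on a homogeneous vector it is bounded by the degree. Hence words in letters of every positive
  degree are carried along, although only letters of degree one survive at length \<open>n\<close>.
  The bound \<open>a \<ge> 2\<close> matters twice: two packs are needed to bring an arbitrary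
  letter to the front, and powers of \<open>a\<close> must increase strictly for the descent in
  length. The constant \<open>n!^2\<close> has one factor \<open>n!\<close> from summing over all
  permutations and one from the words on which the functionals \<open>E\<close> detect a product of
  \<open>n\<close> elements of degree one.\<close>

lemma linear_at_multilinear:
  "multilinear g \<Longrightarrow> linear (\<lambda>x. g (us @ x # ws))"
  by (simp add: multilinear_def)

lemma linear_zero_map: "linear (\<lambda>x. 0)"
  by (auto intro!: linearI)

lemma tensor_eq_pure_sum: "\<exists>f. t = (\<Sum>vs\<in>Poly_Mapping.keys f. Poly_Mapping.lookup f vs *\<^sub>R pure_tensor vs)"
proof -
  obtain f where f: "t = abs_tensor f" by (metis Quotient3_abs_rep Quotient3_tensor)
  have lin: "linear (abs_tensor :: ('a list \<Rightarrow>\<^sub>0 real) \<Rightarrow> _)"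
    by (rule linearI) (simp_all add: plus_tensor.abs_eq scaleR_tensor.abs_eq)
  have "f = (\<Sum>v\<in>Poly_Mapping.keys f. Poly_Mapping.lookup f v *\<^sub>R Poly_Mapping.single v (1::real))"
    by (rule poly_mapping_eqI)
      (simp add: lookup_sum lookup_scaleR lookup_single when_def in_keys_iff if_distrib cong: if_cong)
  then have "t = abs_tensor (\<Sum>v\<in>Poly_Mapping.keys f. Poly_Mapping.lookup f v *\<^sub>R Poly_Mapping.single v (1::real))"
    using f by simp
  then show ?thesis
    by (auto simp: linear_sum[OF lin] linear_scale[OF lin] pure_tensor.abs_eq)
qed

lemma span_pure_tensor: "span (range pure_tensor) = (UNIV :: 'v::real_vector tensor set)"
proof -
  have "t \<in> span (range pure_tensor)" for t :: "'v tensor"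
    using tensor_eq_pure_sum[of t] by (metis (no_types, lifting) rangeI span_base span_scale span_sum)
  then show ?thesis by auto
qed

lemma linear_eq_on_pure:
  assumes "linear F" "linear G" "\<And>vs. F (pure_tensor vs) = G (pure_tensor vs)"
  shows "F t = G t"
proof (rule linear_eq_on_span[OF assms(1,2)])
  show "t \<in> span (range pure_tensor)" by (simp add: span_pure_tensor)
qed (use assms(3) in auto)

text \<open>For fixed \<open>t\<close> the lift is a finite sum over the chosen representative of
  \<open>t\<close>, so linearity in a parameter passes through it term by term.\<close>

lemma linear_tensor_lift_family:
  assumes "\<And>vs. linear (\<lambda>x. g x vs)"
  shows "linear (\<lambda>x. tensor_lift (g x) t)"
  unfolding tensor_lift_def free_lift_def
  using assms by (intro linear_compose_sum ballI linear_compose_scale_right) auto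

lemma linear_pure_at: "linear (\<lambda>x. pure_tensor (us @ x # ws))"
  by (rule linear_at_multilinear[OF multilinear_pure_tensor])

lemma multilinear_pure_append: "multilinear (\<lambda>ws. pure_tensor (us @ ws))"
  unfolding multilinear_def using linear_pure_at[of "us @ _"] by simp

lemma multilinear_tensor_prod_left: "multilinear (\<lambda>us. tensor_lift (\<lambda>ws. pure_tensor (us @ ws)) t)"
  unfolding multilinear_def
  by (intro allI linear_tensor_lift_family) (simp add: linear_pure_at)

lemma linear_tensor_prod_left: "linear (\<lambda>s. s \<otimes> t)"
  unfolding tensor_prod_def by (rule linear_tensor_lift[OF multilinear_tensor_prod_left])

lemma pure_prod_eq: "pure_tensor us \<otimes> t = tensor_lift (\<lambda>ws. pure_tensor (us @ ws)) t"
  unfolding tensor_prod_def by (simp add: tensor_lift_pure multilinear_tensor_prod_left)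

lemma pure_prod_pure: "pure_tensor us \<otimes> pure_tensor ws = pure_tensor (us @ ws)"
  by (simp add: pure_prod_eq tensor_lift_pure multilinear_pure_append)

lemma linear_pure_prod: "linear (\<lambda>t. pure_tensor us \<otimes> t)"
  unfolding pure_prod_eq by (rule linear_tensor_lift[OF multilinear_pure_append])

lemma linear_pure_at_prod: "linear (\<lambda>x. pure_tensor (us @ x # ws) \<otimes> t)"
  unfolding pure_prod_eq
  by (intro linear_tensor_lift_family) (simp add: linear_pure_at)

lemma pure_nil_prod: "pure_tensor [] \<otimes> t = t"
  using linear_eq_on_pure[OF linear_pure_prod linear_ident, of "[]"] by (simp add: pure_prod_pure)

lemma pure_prod_assoc: "pure_tensor us \<otimes> pure_tensor ws \<otimes> t = pure_tensor (us @ ws) \<otimes> t"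
  by (rule linear_eq_on_pure[OF linear_compose[OF linear_pure_prod linear_pure_prod, unfolded o_def] linear_pure_prod])
    (simp add: pure_prod_pure)

text \<open>The varied entry is either the last one and passes through \<open>\<Delta>\<close>, or
  lies in the prefix that is left alone.\<close>

lemma multilinear_apply_last:
  assumes "linear \<Delta>"
  shows "multilinear (\<lambda>vs. pure_tensor (butlast vs) \<otimes> \<Delta> (last vs))"
  unfolding multilinear_def
proof (intro allI)
  fix us ws :: "'a list"
  show "linear (\<lambda>x. pure_tensor (butlast (us @ [x] @ ws)) \<otimes> \<Delta> (last (us @ [x] @ ws)))"
  proof (cases ws rule: rev_cases)
    case Nil
    then show ?thesis
      using linear_compose[OF assms linear_pure_prod] by (simp add: o_def)
  next
    case (snoc ws' y)
    then show ?thesis using linear_pure_at_prod[of us ws' "\<Delta> y"]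
      by (simp add: butlast_append)
  qed
qed

lemma multilinear_apply_first:
  assumes "linear \<Delta>"
  shows "multilinear (\<lambda>vs. \<Delta> (hd vs) \<otimes> pure_tensor (tl vs))"
  unfolding multilinear_def
proof (intro allI)
  fix us ws :: "'a list"
  show "linear (\<lambda>x. \<Delta> (hd (us @ [x] @ ws)) \<otimes> pure_tensor (tl (us @ [x] @ ws)))"
  proof (cases us)
    case Nil
    then show ?thesis
      using linear_compose[OF assms linear_tensor_prod_left] by (simp add: o_def)
  next
    case (Cons y us')
    have "linear (\<lambda>x. s \<otimes> pure_tensor (us' @ x # ws))" for s
      unfolding tensor_prod_def
      using linear_pure_at[of "_ @ us'"]
      by (intro linear_tensor_lift_family) (simp add: tensor_lift_pure multilinear_pure_append)
    with Cons show ?thesis by simp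
  qed
qed

lemma apply_last_pure: "linear \<Delta> \<Longrightarrow> apply_last \<Delta> (pure_tensor (us @ [x])) = pure_tensor us \<otimes> \<Delta> x"
  by (simp add: apply_last_def tensor_lift_pure multilinear_apply_last)

lemma apply_first_pure: "linear \<Delta> \<Longrightarrow> apply_first \<Delta> (pure_tensor (x # us)) = \<Delta> x \<otimes> pure_tensor us"
  by (simp add: apply_first_def tensor_lift_pure multilinear_apply_first)

lemma linear_apply_last: "linear \<Delta> \<Longrightarrow> linear (apply_last \<Delta>)"
  unfolding apply_last_def by (intro linear_tensor_lift multilinear_apply_last)

lemma linear_apply_first: "linear \<Delta> \<Longrightarrow> linear (apply_first \<Delta>)"
  unfolding apply_first_def by (intro linear_tensor_lift multilinear_apply_first)

lemma multilinear_prod_list: "multilinear (prod_list :: 'h::real_algebra_1 list \<Rightarrow> 'h)"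
  unfolding multilinear_def by (auto intro!: linearI simp: algebra_simps)

lemma linear_funpow: "linear F \<Longrightarrow> linear (F ^^ n)" for F :: "'a::real_vector \<Rightarrow> 'a"
proof (induction n)
  case 0
  show ?case using linear_id by (simp add: id_def)
next
  case (Suc n)
  then show ?case using linear_compose[of "F ^^ n" F] by (simp add: o_def)
qed

text \<open>Extending a bilinear map by zero to lists of other lengths makes it multilinear on all
  lists, which is the kind of function that \<open>tensor_lift\<close> accepts: one type holds all
  tensor powers.\<close>

definition on_pairs :: "('a \<Rightarrow> 'a \<Rightarrow> 'w::zero) \<Rightarrow> 'a list \<Rightarrow> 'w" where
  "on_pairs \<beta> vs = (if length vs = 2 then \<beta> (vs ! 0) (vs ! 1) else 0)"

lemma linear_mult_left: "linear (\<lambda>x. x * y)" for y :: "'a::real_algebra"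
  by (auto intro!: linearI simp: algebra_simps)

lemma linear_mult_right: "linear (\<lambda>x. y * x)" for y :: "'a::real_algebra"
  by (auto intro!: linearI simp: algebra_simps)

lemma linear_mult_pure:
  fixes y :: "'a::real_algebra"
  shows "linear (\<lambda>x. pure_tensor (us @ x * y # ws))" and "linear (\<lambda>x. pure_tensor (us @ y * x # ws))"
  using linear_compose[OF linear_mult_left linear_pure_at] linear_compose[OF linear_mult_right linear_pure_at]
  by (auto simp: o_def)

lemma append_two_cases:
  assumes "length (us @ x # ws) = 2"
  obtains w where "us = []" "ws = [w]" | u where "us = [u]" "ws = []"
  using assms by (cases us; cases ws) (auto simp: length_Suc_conv)

lemma multilinear_on_pairs:
  assumes "bilinear \<beta>"
  shows "multilinear (on_pairs \<beta>)"
  unfolding multilinear_def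
proof (intro allI)
  fix us ws :: "'a list"
  show "linear (\<lambda>x. on_pairs \<beta> (us @ [x] @ ws))"
  proof (cases "length us + length ws = 1")
    case True
    then consider w where "us = []" "ws = [w]" | u where "us = [u]" "ws = []"
      using append_two_cases[of us undefined ws] by auto
    then show ?thesis using assms by cases (auto simp: on_pairs_def bilinear_def)
  qed (auto simp: on_pairs_def linear_zero_map)
qed

definition on_triples :: "('a \<Rightarrow> 'a \<Rightarrow> 'a \<Rightarrow> 'w::zero) \<Rightarrow> 'a list \<Rightarrow> 'w" where
  "on_triples \<tau> vs = (if length vs = 3 then \<tau> (vs ! 0) (vs ! 1) (vs ! 2) else 0)"

lemma multilinear_on_triples:
  assumes "\<And>u w. linear (\<tau> u w)" "\<And>u w. linear (\<lambda>x. \<tau> u x w)" "\<And>u w. linear (\<lambda>x. \<tau> x u w)"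
  shows "multilinear (on_triples \<tau>)"
  unfolding multilinear_def
proof (intro allI)
  fix us ws :: "'a list"
  consider (1) p q where "us = []" "ws = [p, q]" | (2) p q where "us = [p]" "ws = [q]"
    | (3) p q where "us = [p, q]" "ws = []" | (4) "length us + length ws \<noteq> 2"
    by (cases us; cases "tl us"; cases ws; cases "tl ws") auto
  then show "linear (\<lambda>x. on_triples \<tau> (us @ [x] @ ws))"
    by cases (auto simp: on_triples_def linear_zero_map assms numeral_2_eq_2 numeral_3_eq_3)
qed

section \<open>Componentwise multiplication of tensors\<close>

lemma split_at_lengthE:
  assumes "length us + length ws + 1 = length vs"
  obtains us' y ws' where "vs = us' @ y # ws'" "length us' = length us" "length ws' = length ws"
  using assms by (intro that[of "take (length us) vs" "vs ! length us" "drop (Suc (length us)) vs"])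
    (auto simp: id_take_nth_drop)

lemma linear_tensor_times_entry:
  fixes vs :: "'a::real_algebra list"
  shows
  "linear (\<lambda>x. if length (us @ x # ws) = length vs then pure_tensor (map2 (*) (us @ x # ws) vs) else 0)"
proof (cases "length us + length ws + 1 = length vs")
  case True
  then obtain us' y ws' where *: "vs = us' @ y # ws'" "length us' = length us" "length ws' = length ws"
    by (rule split_at_lengthE)
  show ?thesis
    using * linear_mult_pure(1)[of "map2 (*) us us'" y "map2 (*) ws ws'"] by simp
qed (auto simp: linear_zero_map)

lemma linear_tensor_times_entry_right:
  fixes vs :: "'a::real_algebra list"
  shows
  "linear (\<lambda>x. if length vs = length (us @ x # ws) then pure_tensor (map2 (*) vs (us @ x # ws)) else 0)"
proof (cases "length us + length ws + 1 = length vs")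
  case True
  then obtain us' y ws' where *: "vs = us' @ y # ws'" "length us' = length us" "length ws' = length ws"
    by (rule split_at_lengthE)
  show ?thesis
    using * linear_mult_pure(2)[of "map2 (*) us' us" y "map2 (*) ws' ws"] by simp
qed (auto simp: linear_zero_map)

lemma multilinear_tensor_times:
  fixes t :: "'a::real_algebra_1 tensor"
  shows
  "multilinear (\<lambda>us. tensor_lift (\<lambda>ws. if length us = length ws then pure_tensor (map2 (*) us ws) else 0) t)"
  unfolding multilinear_def
  unfolding append_Cons append_Nil by (intro allI linear_tensor_lift_family linear_tensor_times_entry)

lemma multilinear_tensor_times_right:
  fixes us :: "'a::real_algebra_1 list"
  shows
  "multilinear (\<lambda>ws. if length us = length ws then pure_tensor (map2 (*) us ws) else 0)"
  unfolding multilinear_def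
  unfolding append_Cons append_Nil by (intro allI linear_tensor_times_entry_right)

lemma linear_tensor_times_left: "linear (\<lambda>s. tensor_times s t)"
  unfolding tensor_times_def by (rule linear_tensor_lift[OF multilinear_tensor_times])

lemma tensor_times_pure:
  "tensor_times (pure_tensor us) t =
     tensor_lift (\<lambda>ws. if length us = length ws then pure_tensor (map2 (*) us ws) else 0) t"
  unfolding tensor_times_def by (simp add: tensor_lift_pure multilinear_tensor_times)

lemma linear_tensor_times_pure: "linear (tensor_times (pure_tensor us))"
  unfolding tensor_times_pure by (rule linear_tensor_lift[OF multilinear_tensor_times_right])

lemma tensor_times_pure_pure:
  "length us = length ws \<Longrightarrow> tensor_times (pure_tensor us) (pure_tensor ws) = pure_tensor (map2 (*) us ws)"
  by (subst tensor_times_pure, subst tensor_lift_pure[OF multilinear_tensor_times_right]) simp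

lemma linear_sum_list: "linear F \<Longrightarrow> F (\<Sum>x\<leftarrow>xs. g x) = (\<Sum>x\<leftarrow>xs. F (g x))"
  by (induction xs) (auto simp: linear_0 linear_add)

section \<open>Direct sums and Sweedler sums\<close>

lemma direct_sum_unique:
  assumes V: "internal_direct_sum V I W"
    and f: "\<And>i. i \<in> I \<Longrightarrow> f i \<in> V i" "\<And>i. i \<notin> I \<Longrightarrow> f i = 0" "finite {i. f i \<noteq> 0}"
    and g: "\<And>i. i \<in> I \<Longrightarrow> g i \<in> V i" "\<And>i. i \<notin> I \<Longrightarrow> g i = 0" "finite {i. g i \<noteq> 0}"
    and eq: "(\<Sum>i | f i \<noteq> 0. f i) = (\<Sum>i | g i \<noteq> 0. g i)"
  shows "f = g"
proof -
  define P where "P h \<longleftrightarrow> (\<forall>i\<in>I. h i \<in> V i) \<and> (\<forall>i. i \<notin> I \<longrightarrow> h i = 0) \<and>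
        finite {i. h i \<noteq> 0} \<and> (\<Sum>i | f i \<noteq> 0. f i) = (\<Sum>i | h i \<noteq> 0. h i)" for h
  have "f i \<in> W" if "f i \<noteq> 0" for i
    using that f(1,2) V by (cases "i \<in> I") (auto simp: internal_direct_sum_def)
  then have "(\<Sum>i | f i \<noteq> 0. f i) \<in> W"
    using V by (intro subspace_sum) (auto simp: internal_direct_sum_def)
  then have "\<exists>!h. P h" using V unfolding internal_direct_sum_def P_def by blast
  moreover have "P f" unfolding P_def using f by blast
  moreover have "P g" unfolding P_def using g eq by blast
  ultimately show "f = g" by blast
qed

text \<open>The family concentrated at \<open>i\<close> with value \<open>x\<close> and the one
  concentrated at \<open>j\<close> both sum to \<open>x\<close>, so uniqueness of the decomposition
  identifies them.\<close>

lemma direct_sum_disjoint: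
  assumes V: "internal_direct_sum V I W" and ij: "i \<in> I" "j \<in> I" "i \<noteq> j" and x: "x \<in> V i" "x \<in> V j"
  shows "x = 0"
proof -
  let ?f = "\<lambda>l k. if k = l then x else 0"
  have z: "0 \<in> V k" if "k \<in> I" for k using V that by (auto simp: internal_direct_sum_def subspace_0)
  have fin: "finite {k. ?f l k \<noteq> 0}" for l
    by (rule finite_subset[of _ "{l}"]) auto
  have sum: "(\<Sum>k | ?f l k \<noteq> 0. ?f l k) = x" for l
    by (subst sum.mono_neutral_left[where T = "{l}"]) auto
  have "?f i = ?f j"
    by (rule direct_sum_unique[OF V]) (use ij x z fin in \<open>auto simp: sum\<close>)
  then show ?thesis using ij(3) by metis
qed

lemma direct_sum_eq_zero:
  assumes "internal_direct_sum V I W" "finite J" "J \<subseteq> I" "\<And>i. i \<in> J \<Longrightarrow> f i \<in> V i" "(\<Sum>i\<in>J. f i) = 0" "i \<in> J"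
  shows "f i = 0"
proof -
  let ?g = "\<lambda>i. if i \<in> J then f i else 0"
  have z: "0 \<in> V i" if "i \<in> I" for i using assms(1) that by (auto simp: internal_direct_sum_def subspace_0)
  have fin: "finite {i. ?g i \<noteq> 0}" by (rule finite_subset[OF _ assms(2)]) auto
  have "(\<Sum>i | ?g i \<noteq> 0. ?g i) = (\<Sum>i\<in>J. f i)"
    by (rule sum.mono_neutral_cong_left) (use assms in auto)
  then have sum: "(\<Sum>i | ?g i \<noteq> 0. ?g i) = 0" using assms(5) by simp
  have "?g = (\<lambda>i. 0)"
  proof (rule direct_sum_unique[OF assms(1)])
    show "(\<Sum>i | ?g i \<noteq> 0. ?g i) = (\<Sum>i | (0::'b) \<noteq> 0. 0)" unfolding sum by simp
  qed (use assms(3,4) z fin in auto)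
  then show ?thesis using assms(6) by metis
qed

text \<open>A linear relation is grouped by the component that each vector belongs to. Directness
  makes every group vanish separately, and a group is a relation inside one independent set
  \<open>C i\<close>.\<close>

lemma direct_sum_basis:
  assumes V: "internal_direct_sum V I W" and C: "\<And>i. i \<in> I \<Longrightarrow> independent (C i) \<and> span (C i) = V i"
  shows independent_direct_sum_basis: "independent (\<Union>i\<in>I. C i)"
    and span_direct_sum_basis: "span (\<Union>i\<in>I. C i) = W"
proof -
  have disj: "i = j" if "i \<in> I" "j \<in> I" "x \<in> C i" "x \<in> C j" for i j x
    using direct_sum_disjoint[OF V that(1,2)] C that by (metis span_base dependent_zero)
  show "independent (\<Union>i\<in>I. C i)"
    unfolding dependent_explicit
  proof safe
    fix T u x
    assume T: "finite T" "T \<subseteq> (\<Union>i\<in>I. C i)" "(\<Sum>v\<in>T. u v *\<^sub>R v) = 0" and x: "x \<in> T" "u x \<noteq> 0"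
    define idx where "idx y = (SOME i. i \<in> I \<and> y \<in> C i)" for y
    have idx: "idx y \<in> I \<and> y \<in> C (idx y)" if "y \<in> T" for y
      unfolding idx_def by (rule someI_ex) (use T(2) that in auto)
    define f where "f i = (\<Sum>v\<in>{v \<in> T. idx v = i}. u v *\<^sub>R v)" for i
    have "(\<Sum>i\<in>idx ` T. f i) = 0"
      unfolding f_def by (subst sum.group) (use T in auto)
    moreover have "f i \<in> V i" if "i \<in> idx ` T" for i
    proof -
      have "f i \<in> span (C i)" unfolding f_def
        by (intro span_sum span_scale span_base) (use idx in auto)
      then show ?thesis using C idx that by auto
    qed
    ultimately have "f (idx x) = 0"
      using direct_sum_eq_zero[OF V, of "idx ` T" f "idx x"] T(1) x(1) idx by blast
    moreover have "independent (C (idx x))" using C idx x(1) by blast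
    moreover have "finite {v \<in> T. idx v = idx x}" "{v \<in> T. idx v = idx x} \<subseteq> C (idx x)"
      using T idx by auto (metis idx)
    ultimately have "u x = 0"
      unfolding f_def using independentD[of "C (idx x)" "{v \<in> T. idx v = idx x}" u x] x by auto
    with x show False by blast
  qed
  have sub: "subspace W" "V i \<subseteq> W" if "i \<in> I" for i
    using V that by (auto simp: internal_direct_sum_def)
  show "span (\<Union>i\<in>I. C i) = W"
  proof (rule antisym)
    show "span (\<Union>i\<in>I. C i) \<subseteq> W"
      using V C by (intro span_minimal) (auto simp: internal_direct_sum_def dest: span_base)
    show "W \<subseteq> span (\<Union>i\<in>I. C i)"
    proof
      fix x assume "x \<in> W"
      then obtain f where f: "\<forall>i\<in>I. f i \<in> V i" "\<forall>i. i \<notin> I \<longrightarrow> f i = 0" "x = (\<Sum>i | f i \<noteq> 0. f i)"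
        using V unfolding internal_direct_sum_def by meson
      have "f i \<in> span (\<Union>i\<in>I. C i)" if "f i \<noteq> 0" for i
      proof -
        have "i \<in> I" using f(2) that by blast
        then show ?thesis using C f(1) span_mono[of "C i" "\<Union>i\<in>I. C i"] by blast
      qed
      then show "x \<in> span (\<Union>i\<in>I. C i)" unfolding f(3) by (intro span_sum) auto
    qed
  qed
qed

lemma span_pairs_mono:
  assumes "t \<in> span {pure_tensor [u, w] | u w. P u w}" "\<And>u w. P u w \<Longrightarrow> Q u w"
  shows "t \<in> span {pure_tensor [u, w] | u w. Q u w}"
proof -
  have "{pure_tensor [u, w] | u w. P u w} \<subseteq> {pure_tensor [u, w] | u w. Q u w}"
    using assms(2) by blast
  then show ?thesis using assms(1) span_mono by blast
qed

lemma span_tensor_subspaces: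
  assumes "t \<in> span (\<Union>(i, j)\<in>K. tensor_subspace (U i) (W j))"
  shows "t \<in> span {pure_tensor [u, w] | u w. \<exists>(i, j)\<in>K. u \<in> U i \<and> w \<in> W j}" (is "t \<in> span ?S")
proof -
  have "(\<Union>(i, j)\<in>K. tensor_subspace (U i) (W j)) \<subseteq> span ?S"
    unfolding tensor_subspace_def
  proof safe
    fix i j t assume "(i, j) \<in> K" and t: "t \<in> span {pure_tensor [u, w] |u w. u \<in> U i \<and> w \<in> W j}"
    then show "t \<in> span ?S" by (intro span_pairs_mono[OF t]) auto
  qed
  then show ?thesis using assms span_minimal[OF _ subspace_span] by blast
qed

text \<open>Scalars are absorbed into the left factor, so no coefficients are left and a plain list
  of pairs suffices.\<close>

lemma pair_tensor_list:
  assumes "t \<in> span {pure_tensor [u, w] | u w. P u w}"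
  shows "\<exists>S. t = (\<Sum>(u, w)\<leftarrow>S. pure_tensor [u, w])"
  using assms
proof (induction rule: span_induct_alt)
  case base
  show ?case by (rule exI[of _ "[]"]) simp
next
  case (step c x y)
  then obtain S u w where "y = (\<Sum>(u, w)\<leftarrow>S. pure_tensor [u, w])" "x = pure_tensor [u, w]" by blast
  moreover have "pure_tensor [c *\<^sub>R u, w] = c *\<^sub>R pure_tensor [u, w]"
    using linear_scale[OF linear_pure_at[of "[]" "[w]"]] by simp
  ultimately show ?case by (intro exI[of _ "(c *\<^sub>R u, w) # S"]) simp
qed

lemma bilinearI:
  "(\<And>u. linear (\<beta> u)) \<Longrightarrow> (\<And>w. linear (\<lambda>u. \<beta> u w)) \<Longrightarrow> bilinear \<beta>"
  by (simp add: bilinear_def)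

lemma bilinear_times:
  fixes F G :: "'a::real_vector \<Rightarrow> 'b::real_algebra"
  assumes "linear F" "linear G"
  shows "bilinear (\<lambda>u w. F u * G w)"
  by (intro bilinearI linear_compose[OF assms(2) linear_mult_right, unfolded o_def]
      linear_compose[OF assms(1) linear_mult_left, unfolded o_def])

lemma linear_bilinear_right: "bilinear \<beta> \<Longrightarrow> linear F \<Longrightarrow> linear (\<lambda>x. \<beta> u (F x))"
  using linear_compose[of F "\<beta> u"] by (simp add: bilinear_def o_def)

lemma linear_bilinear_left: "bilinear \<beta> \<Longrightarrow> linear F \<Longrightarrow> linear (\<lambda>x. \<beta> (F x) w)"
  using linear_compose[of F "\<lambda>u. \<beta> u w"] by (simp add: bilinear_def o_def)

section \<open>Sweedler calculus for the coproduct\<close>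

context graded_connected_hopf_algebra
begin

lemma subspace_H: "subspace (H n)"
  using graded by (simp add: internal_direct_sum_def)

lemma comult_graded_pairs:
  assumes "x \<in> H n"
  shows "\<Delta> x \<in> span {pure_tensor [u, w] | u w. \<exists>j\<le>n. u \<in> H j \<and> w \<in> H (n - j)}"
proof -
  have "(\<Union>j\<in>{0..n}. tensor_subspace (H j) (H (n - j)))
      = (\<Union>(i, j)\<in>(\<lambda>j. (j, n - j)) ` {0..n}. tensor_subspace (H i) (H j))" by auto
  then have "\<Delta> x \<in> span {pure_tensor [u, w] | u w. \<exists>(i, j)\<in>(\<lambda>j. (j, n - j)) ` {0..n}. u \<in> H i \<and> w \<in> H j}"
    using comult_graded[OF assms] by (intro span_tensor_subspaces) simp
  then show ?thesis by (rule span_pairs_mono) auto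
qed

lemma comult_reduced_pairs:
  assumes "n \<ge> 1" "x \<in> H n"
  shows "\<Delta> x - pure_tensor [1, x] - pure_tensor [x, 1] \<in>
    span {pure_tensor [u, w] | u w. \<exists>j\<in>{1..n-1}. u \<in> H j \<and> w \<in> H (n - j)}"
proof -
  have "(\<Union>j\<in>{1..n-1}. tensor_subspace (H j) (H (n - j)))
      = (\<Union>(i, j)\<in>(\<lambda>j. (j, n - j)) ` {1..n-1}. tensor_subspace (H i) (H j))" by auto
  then have "\<Delta> x - pure_tensor [1, x] - pure_tensor [x, 1] \<in>
    span {pure_tensor [u, w] | u w. \<exists>(i, j)\<in>(\<lambda>j. (j, n - j)) ` {1..n-1}. u \<in> H i \<and> w \<in> H j}"
    using comult_reduced[OF assms] by (intro span_tensor_subspaces) simp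
  then show ?thesis by (rule span_pairs_mono) auto
qed

lemma span_homogeneous: "span (\<Union>n. H n) = UNIV"
proof -
  have "x \<in> span (\<Union>n. H n)" for x
  proof -
  have "\<exists>f. (\<forall>i. f i \<in> H i) \<and> x = (\<Sum>i | f i \<noteq> 0. f i)"
    using graded unfolding internal_direct_sum_def by (metis UNIV_I)
  then obtain f where f: "\<forall>i. f i \<in> H i" "x = (\<Sum>i | f i \<noteq> 0. f i)" by blast
  have "(\<Sum>i | f i \<noteq> 0. f i) \<in> span (\<Union>n. H n)"
    by (intro span_sum span_base) (use f(1) in blast)
  then show "x \<in> span (\<Union>n. H n)" using f(2) by simp
  qed
  then show ?thesis by auto
qed

lemma comult_in_pairs: "\<Delta> x \<in> span {pure_tensor [u, w] | u w. True}"
proof -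
  have "x \<in> span (\<Union>n. H n)" by (simp add: span_homogeneous)
  then show ?thesis
  proof (induction rule: span_induct_alt)
    case base
    show ?case by (simp add: linear_0[OF comult_linear] span_zero)
  next
    case (step c x y)
    then obtain n where "x \<in> H n" by blast
    then have "\<Delta> x \<in> span {pure_tensor [u, w] | u w. True}"
      by (intro span_pairs_mono[OF comult_graded_pairs]) auto
    with step show ?case
      by (auto simp: linear_add[OF comult_linear] linear_scale[OF comult_linear] intro!: span_add span_scale)
  qed
qed

text \<open>An arbitrary choice of such an expression, not linear in \<open>x\<close>. Sums over it
  are therefore taken through \<open>sw\<close>, which factors through the tensor and is
  linear.\<close>

definition sweedler :: "'h \<Rightarrow> ('h \<times> 'h) list" where
  "sweedler x = (SOME S. \<Delta> x = (\<Sum>(u, w)\<leftarrow>S. pure_tensor [u, w]))"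

lemma comult_sweedler: "\<Delta> x = (\<Sum>(u, w)\<leftarrow>sweedler x. pure_tensor [u, w])"
  unfolding sweedler_def by (rule someI_ex) (rule pair_tensor_list[OF comult_in_pairs])

text \<open>Sweedler notation: \<open>sw \<beta> x\<close> is \<open>\<Sum> \<beta> x\<^sub>1 x\<^sub>2\<close> where \<open>\<Delta> x = \<Sum> x\<^sub>1 \<otimes> x\<^sub>2\<close>;
  only meaningful for bilinear \<open>\<beta>\<close>.\<close>

definition sw :: "('h \<Rightarrow> 'h \<Rightarrow> 'w::real_vector) \<Rightarrow> 'h \<Rightarrow> 'w" where
  "sw \<beta> x = tensor_lift (on_pairs \<beta>) (\<Delta> x)"

lemma lift_pair: "bilinear \<beta> \<Longrightarrow> tensor_lift (on_pairs \<beta>) (pure_tensor [u, w]) = \<beta> u w"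
  by (simp add: tensor_lift_pure multilinear_on_pairs on_pairs_def)

lemma sw_eq_sum_list: "bilinear \<beta> \<Longrightarrow> sw \<beta> x = (\<Sum>(u, w)\<leftarrow>sweedler x. \<beta> u w)"
  unfolding sw_def
  by (subst comult_sweedler) (simp add: linear_sum_list[OF linear_tensor_lift] multilinear_on_pairs lift_pair split_def)

lemma linear_sw: "bilinear \<beta> \<Longrightarrow> linear (sw \<beta>)"
  using linear_compose[OF comult_linear linear_tensor_lift[OF multilinear_on_pairs]]
  by (simp add: sw_def[abs_def] o_def)

lemma linear_sw_family:
  assumes "\<And>u w. linear (\<lambda>y. \<beta> y u w)"
  shows "linear (\<lambda>y. sw (\<beta> y) x)"
  unfolding sw_def
proof (rule linear_tensor_lift_family)
  show "linear (\<lambda>y. on_pairs (\<beta> y) vs)" for vs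
    using assms by (cases "length vs = 2") (auto simp: on_pairs_def linear_zero_map)
qed

lemma linear_of_sw:
  assumes "linear F" "bilinear \<beta>"
  shows "F (sw \<beta> x) = sw (\<lambda>u w. F (\<beta> u w)) x"
proof -
  have "bilinear (\<lambda>u w. F (\<beta> u w))"
    using assms linear_compose[OF _ assms(1)] by (auto simp: bilinear_def o_def)
  then show ?thesis using assms
    by (simp add: sw_eq_sum_list linear_sum_list split_def)
qed

lemma lift_in_subspace:
  assumes "bilinear \<beta>" "t \<in> span {pure_tensor [u, w] | u w. P u w}" "subspace V"
    "\<And>u w. P u w \<Longrightarrow> \<beta> u w \<in> V"
  shows "tensor_lift (on_pairs \<beta>) t \<in> V"
  using assms(2)
proof (induction rule: span_induct_alt)
  case base
  show ?case by (simp add: linear_0[OF linear_tensor_lift] multilinear_on_pairs assms subspace_0)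
next
  case (step c x y)
  note l = linear_tensor_lift[OF multilinear_on_pairs[OF assms(1)]]
  from step.hyps have "tensor_lift (on_pairs \<beta>) x \<in> V"
    by (auto simp: lift_pair assms)
  with step.IH show ?case
    by (simp add: linear_add[OF l] linear_scale[OF l] subspace_add subspace_scale assms(3))
qed

lemma sw_in_subspace:
  assumes "bilinear \<beta>" "\<Delta> x \<in> span {pure_tensor [u, w] | u w. P u w}" "subspace V"
    "\<And>u w. P u w \<Longrightarrow> \<beta> u w \<in> V"
  shows "sw \<beta> x \<in> V"
  unfolding sw_def using lift_in_subspace[OF assms] .

lemma sw_homogeneous_zero:
  assumes "bilinear \<beta>" "x \<in> H n"
    "\<And>u w j. j \<le> n \<Longrightarrow> u \<in> H j \<Longrightarrow> w \<in> H (n - j) \<Longrightarrow> \<beta> u w = 0"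
  shows "sw \<beta> x = 0"
  using sw_in_subspace[OF assms(1) comult_graded_pairs[OF assms(2)], of "{0}", OF subspace_single_0] assms(3)
  by blast

lemma sw_one: "bilinear \<beta> \<Longrightarrow> sw \<beta> 1 = \<beta> 1 1"
  by (simp add: sw_def comult_one lift_pair)

text \<open>In the reduced coproduct both factors have degree strictly between \<open>0\<close> and
  \<open>n\<close>; where \<open>\<beta>\<close> vanishes on those pairs, only the two outer terms
  are left.\<close>

lemma sw_reduced:
  assumes "bilinear \<beta>" "n \<ge> 1" "x \<in> H n"
    "\<And>u w j. j \<in> {1..n-1} \<Longrightarrow> u \<in> H j \<Longrightarrow> w \<in> H (n - j) \<Longrightarrow> \<beta> u w = 0"
  shows "sw \<beta> x = \<beta> 1 x + \<beta> x 1"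
proof -
  have "tensor_lift (on_pairs \<beta>) (\<Delta> x - pure_tensor [1, x] - pure_tensor [x, 1]) \<in> {0}"
    using lift_in_subspace[OF assms(1) comult_reduced_pairs[OF assms(2,3)], of "{0}", OF subspace_single_0] assms(4)
    by blast
  then show ?thesis
    by (simp add: sw_def linear_diff[OF linear_tensor_lift[OF multilinear_on_pairs[OF assms(1)]]]
        lift_pair[OF assms(1)] diff_eq_eq add.commute)
qed

text \<open>Coassociativity tested against a trilinear map: the functional \<open>?T\<close> induced
  by \<open>\<tau>\<close> is applied to both sides of \<open>coassoc\<close>, and the two ways of
  applying \<open>\<Delta>\<close> twice give the two nested sums.\<close>

lemma sw_assoc:
  assumes "\<And>u w. linear (\<tau> u w)" "\<And>u w. linear (\<lambda>x. \<tau> u x w)" "\<And>u w. linear (\<lambda>x. \<tau> x u w)"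
  shows "sw (\<lambda>u w. sw (\<lambda>p q. \<tau> u p q) w) x = sw (\<lambda>u w. sw (\<lambda>p q. \<tau> p q w) u) x"
proof -
  let ?T = "tensor_lift (on_triples \<tau>)"
  have m: "multilinear (on_triples \<tau>)" using multilinear_on_triples[OF assms] .
  have b: "bilinear (\<lambda>p q. \<tau> u p q)" "bilinear (\<lambda>p q. \<tau> p q u)" for u
    by (intro bilinearI assms)+
  have b1: "bilinear (\<lambda>u w. sw (\<lambda>p q. \<tau> u p q) w)"
    by (intro bilinearI linear_sw linear_sw_family b assms)
  have b2: "bilinear (\<lambda>u w. sw (\<lambda>p q. \<tau> p q w) u)"
    by (intro bilinearI linear_sw linear_sw_family b assms)
  have t: "?T (pure_tensor [u, p, q]) = \<tau> u p q" for u p q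
    by (simp add: tensor_lift_pure[OF m] on_triples_def)
  note l = linear_tensor_lift[OF m]
  have 1: "?T (pure_tensor [u] \<otimes> \<Delta> w) = sw (\<lambda>p q. \<tau> u p q) w" for u w
    by (subst comult_sweedler) (simp add: sw_eq_sum_list b linear_sum_list[OF linear_pure_prod] linear_sum_list[OF l]
        pure_prod_pure t split_def)
  have 2: "?T (\<Delta> u \<otimes> pure_tensor [w]) = sw (\<lambda>p q. \<tau> p q w) u" for u w
    by (subst comult_sweedler) (simp add: sw_eq_sum_list b linear_sum_list[OF linear_tensor_prod_left] linear_sum_list[OF l]
        pure_prod_pure t split_def)
  have "?T (apply_last \<Delta> (\<Delta> x)) = (\<Sum>(u, w)\<leftarrow>sweedler x. ?T (apply_last \<Delta> (pure_tensor [u, w])))"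
    by (subst comult_sweedler[of x])
      (simp add: linear_sum_list[OF linear_apply_last[OF comult_linear]] linear_sum_list[OF l] split_def)
  also have "\<dots> = sw (\<lambda>u w. sw (\<lambda>p q. \<tau> u p q) w) x"
    using apply_last_pure[OF comult_linear, of "[_]"] by (simp add: sw_eq_sum_list[OF b1] 1)
  finally have L: "?T (apply_last \<Delta> (\<Delta> x)) = sw (\<lambda>u w. sw (\<lambda>p q. \<tau> u p q) w) x" .
  have "?T (apply_first \<Delta> (\<Delta> x)) = (\<Sum>(u, w)\<leftarrow>sweedler x. ?T (apply_first \<Delta> (pure_tensor [u, w])))"
    by (subst comult_sweedler[of x])
      (simp add: linear_sum_list[OF linear_apply_first[OF comult_linear]] linear_sum_list[OF l] split_def)
  also have "\<dots> = sw (\<lambda>u w. sw (\<lambda>p q. \<tau> p q w) u) x"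
    by (simp add: sw_eq_sum_list[OF b2] apply_first_pure[OF comult_linear] 2)
  finally show ?thesis using L coassoc[of x] by simp
qed

lemma bilinear_shift:
  assumes "bilinear \<beta>"
  shows "bilinear (\<lambda>r s. \<beta> (p * r) (q * s))" and "bilinear (\<lambda>p q. sw (\<lambda>r s. \<beta> (p * r) (q * s)) z)"
proof -
  show "bilinear (\<lambda>r s. \<beta> (p * r) (q * s))"
  proof (rule bilinearI)
    show "linear (\<lambda>s. \<beta> (p * r) (q * s))" for r
      by (rule linear_bilinear_right[OF assms linear_mult_right])
    show "linear (\<lambda>r. \<beta> (p * r) (q * s))" for s
      by (rule linear_bilinear_left[OF assms linear_mult_right])
  qed
  show "bilinear (\<lambda>p q. sw (\<lambda>r s. \<beta> (p * r) (q * s)) z)"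
  proof (rule bilinearI)
    show "linear (\<lambda>q. sw (\<lambda>r s. \<beta> (p * r) (q * s)) z)" for p
      by (rule linear_sw_family) (rule linear_bilinear_right[OF assms linear_mult_left])
    show "linear (\<lambda>p. sw (\<lambda>r s. \<beta> (p * r) (q * s)) z)" for q
      by (rule linear_sw_family) (rule linear_bilinear_left[OF assms linear_mult_left])
  qed
qed

text \<open>The Sweedler form of \<open>comult_mult\<close>, with the sums for \<open>w\<close> and
  \<open>z\<close> taken one inside the other.\<close>

lemma sw_mult:
  assumes "bilinear \<beta>"
  shows "sw \<beta> (w * z) = sw (\<lambda>p q. sw (\<lambda>r s. \<beta> (p * r) (q * s)) z) w"
proof -
  let ?T = "tensor_lift (on_pairs \<beta>)"
  note b = bilinear_shift[OF assms]
  note l = linear_tensor_lift[OF multilinear_on_pairs[OF assms]]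
  have 1: "?T (tensor_times (pure_tensor [p, q]) (\<Delta> z)) = sw (\<lambda>r s. \<beta> (p * r) (q * s)) z" for p q
    by (subst comult_sweedler[of z])
      (simp add: sw_eq_sum_list[OF b(1)] linear_sum_list[OF linear_tensor_times_pure] linear_sum_list[OF l]
        tensor_times_pure_pure lift_pair assms split_def)
  show ?thesis
    unfolding sw_def[of \<beta>] comult_mult
    by (subst comult_sweedler[of w])
      (simp add: sw_eq_sum_list[OF b(2)] linear_sum_list[OF linear_tensor_times_left] linear_sum_list[OF l] 1 split_def)
qed

section \<open>Iterated coproducts and Hopf powers\<close>

lemma iterated_last:
  "(apply_last \<Delta> ^^ a) (pure_tensor (us @ [x])) = pure_tensor us \<otimes> (apply_last \<Delta> ^^ a) (pure_tensor [x])"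
proof (induction a arbitrary: us x)
  case 0
  show ?case by (simp add: pure_prod_pure)
next
  case (Suc a)
  note l = linear_funpow[OF linear_apply_last[OF comult_linear], of a]
  have step: "(apply_last \<Delta> ^^ Suc a) (pure_tensor (us @ [x]))
    = (\<Sum>(u, w)\<leftarrow>sweedler x. pure_tensor (us @ [u]) \<otimes> (apply_last \<Delta> ^^ a) (pure_tensor [w]))" for us
  proof -
    have "(apply_last \<Delta> ^^ Suc a) (pure_tensor (us @ [x])) = (apply_last \<Delta> ^^ a) (pure_tensor us \<otimes> \<Delta> x)"
      by (simp add: funpow_swap1 apply_last_pure[OF comult_linear])
    also have "\<dots> = (\<Sum>(u, w)\<leftarrow>sweedler x. (apply_last \<Delta> ^^ a) (pure_tensor ((us @ [u]) @ [w])))"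
      by (subst comult_sweedler)
        (simp add: linear_sum_list[OF linear_pure_prod] linear_sum_list[OF l] pure_prod_pure split_def)
    finally show ?thesis by (simp only: Suc.IH)
  qed
  show ?case using step[of us] step[of "[]"]
    by (simp add: linear_sum_list[OF linear_pure_prod] pure_prod_assoc split_def)
qed

text \<open>By \<open>iterated_last\<close>, the later applications of \<open>\<Delta>\<close> never
  touch the first factor, so it can be split off. This turns a recursion at the last factor into one
  at the first.\<close>

lemma iterated_coproduct_Suc:
  "iterated_coproduct \<Delta> (Suc (Suc a)) x
    = (\<Sum>(u, w)\<leftarrow>sweedler x. pure_tensor [u] \<otimes> iterated_coproduct \<Delta> (Suc a) w)"
proof -
  note l = linear_funpow[OF linear_apply_last[OF comult_linear], of a]
  have "iterated_coproduct \<Delta> (Suc (Suc a)) x = (apply_last \<Delta> ^^ a) (\<Delta> x)"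
    using apply_last_pure[OF comult_linear, of "[]"]
    by (simp add: iterated_coproduct_def funpow_swap1 pure_nil_prod)
  also have "\<dots> = (\<Sum>(u, w)\<leftarrow>sweedler x. (apply_last \<Delta> ^^ a) (pure_tensor ([u] @ [w])))"
    by (subst comult_sweedler) (simp add: linear_sum_list[OF l] split_def)
  finally show ?thesis by (simp only: iterated_last iterated_coproduct_def diff_Suc_1)
qed

lemma linear_iterated_coproduct: "linear (iterated_coproduct \<Delta> a)"
  using linear_compose[OF linear_pure_at[of "[]" "[]"] linear_funpow[OF linear_apply_last[OF comult_linear]]]
  by (simp add: iterated_coproduct_def[abs_def] o_def)

lemma linear_hopf_power: "linear (hopf_power \<Delta> a)"
  using linear_compose[OF linear_iterated_coproduct linear_tensor_lift[OF multilinear_prod_list]]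
  by (simp add: hopf_power_def[abs_def] o_def)

lemma hopf_power_1: "hopf_power \<Delta> (Suc 0) x = x"
  by (simp add: hopf_power_def iterated_coproduct_def tensor_lift_pure multilinear_prod_list)

lemma bilinear_mult_hopf_power: "bilinear (\<lambda>u w. u * hopf_power \<Delta> a w)"
  by (intro bilinear_times linear_hopf_power linear_ident)

text \<open>The Hopf power as a convolution power of the identity; the inductions on
  \<open>a\<close> below run on this recursion. It starts from exponent one because the truncated
  \<open>a - 1\<close> in \<open>iterated_coproduct\<close> makes exponents \<open>0\<close> and
  \<open>1\<close> coincide.\<close>

lemma hopf_power_Suc:
  "hopf_power \<Delta> (Suc (Suc a)) x = sw (\<lambda>u w. u * hopf_power \<Delta> (Suc a) w) x"
proof -
  note l = linear_tensor_lift[OF multilinear_prod_list]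
  have "tensor_lift prod_list (pure_tensor [u] \<otimes> t) = u * tensor_lift prod_list t" for u :: 'h and t
    by (rule linear_eq_on_pure[OF linear_compose[OF linear_pure_prod l, unfolded o_def]
          linear_compose[OF l linear_mult_right, unfolded o_def]])
      (simp add: pure_prod_pure tensor_lift_pure multilinear_prod_list)
  then show ?thesis
    unfolding sw_eq_sum_list[OF bilinear_mult_hopf_power]
    by (simp add: hopf_power_def iterated_coproduct_Suc linear_sum_list[OF l] split_def)
qed

end

section \<open>Words, shuffles and the convolution algebra of functionals\<close>

text \<open>The terms of the unshuffle coproduct on words: each letter goes left or right and order
  is kept. A list, not a set, so that repeated letters are counted with multiplicity.\<close>

fun splits :: "'a list \<Rightarrow> ('a list \<times> 'a list) list" where
  "splits [] = [([], [])]"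
| "splits (x # xs) =
     map (\<lambda>(us, ws). (x # us, ws)) (splits xs) @ map (\<lambda>(us, ws). (us, x # ws)) (splits xs)"

text \<open>The outcomes of all inverse riffle shuffles with \<open>a + 1\<close> packs, with multiplicity.\<close>

fun riffle :: "nat \<Rightarrow> 'a list \<Rightarrow> 'a list list" where
  "riffle 0 xs = [xs]"
| "riffle (Suc a) xs = concat (map (\<lambda>(us, ws). map ((@) us) (riffle a ws)) (splits xs))"

lemma mset_splits: "(us, ws) \<in> set (splits xs) \<Longrightarrow> mset us + mset ws = mset xs"
  by (induction xs arbitrary: us ws) auto

lemma splits_map: "splits (map f xs) = map (map_prod (map f) (map f)) (splits xs)"
  by (induction xs) (auto simp: o_def split_def map_prod_def)

lemma riffle_map: "riffle a (map f xs) = map (map f) (riffle a xs)"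
proof (induction a arbitrary: xs)
  case (Suc a)
  have "concat (map (\<lambda>(us, ws). map ((@) us) (riffle a ws)) (map (map_prod (map f) (map f)) S))
    = map (map f) (concat (map (\<lambda>(us, ws). map ((@) us) (riffle a ws)) S))" for S
    by (induction S) (auto simp: Suc.IH)
  then show ?case by (simp add: splits_map)
qed simp

lemma mset_riffle: "ts \<in> set (riffle a xs) \<Longrightarrow> mset ts = mset xs"
proof (induction a arbitrary: ts xs)
  case (Suc a)
  then show ?case using mset_splits by (fastforce simp: mset_splits)
qed simp

lemma splits_Nil_left: "([], xs) \<in> set (splits xs)"
  by (induction xs) (auto simp: image_iff)

lemma self_in_riffle: "xs \<in> set (riffle a xs)"
proof (induction a arbitrary: xs)
  case (Suc a)
  then show ?case using splits_Nil_left[of xs] by (force intro!: bexI[of _ "([], xs)"])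
qed simp

lemma append_in_riffle: "(us, ws) \<in> set (splits xs) \<Longrightarrow> us @ ws \<in> set (riffle (Suc a) xs)"
  using self_in_riffle[of ws a] by force

text \<open>Together with \<open>append_in_riffle\<close> this shows that one shuffle with at least
  two packs can move the letter \<open>y\<close> to the front: it alone forms the first
  pack.\<close>

lemma splits_single: "([y], xs @ zs) \<in> set (splits (xs @ y # zs))"
proof (induction xs)
  case Nil
  show ?case using imageI[OF splits_Nil_left, of "\<lambda>(us, ws). (y # us, ws)" zs] by simp
next
  case (Cons x xs)
  then show ?case by (auto simp: image_iff intro!: bexI[of _ "([y], xs @ zs)"])
qed

lemma sum_splits_power:
  "(\<Sum>(us, ws)\<leftarrow>splits xs. r ^ length ws) = (1 + r) ^ length xs" for r :: nat
  by (induction xs) (simp_all add: o_def split_def sum_list_const_mult distrib_right)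

text \<open>Every letter independently picks one of \<open>a + 1\<close> packs; peeling off the
  first pack is a binomial expansion.\<close>

lemma length_riffle: "length (riffle a xs) = (a + 1) ^ length xs"
proof (induction a arbitrary: xs)
  case (Suc a)
  then show ?case using sum_splits_power[of "Suc a" xs]
    by (simp add: length_concat o_def split_def)
qed simp

text \<open>Any rearrangement is reached by bringing the letters of \<open>ys\<close> to the front
  one at a time, the last letter first.\<close>

lemma mset_induct_move_front:
  assumes "mset xs = mset ys" "P xs" "\<And>us y ws. P (us @ y # ws) \<Longrightarrow> P (y # us @ ws)"
  shows "P ys"
proof -
  \<comment> \<open>After the letters of a suffix \<open>vs\<close> of \<open>ys\<close> have been
    moved, the word starts with \<open>vs\<close>; \<open>us\<close> holds the letters still
    waiting. At \<open>vs = ys\<close> nothing is left over.\<close>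
  have "\<exists>us. mset us + mset vs = mset xs \<and> P (vs @ us)" if "\<exists>zs. ys = zs @ vs" for vs
    using that
  proof (induction vs)
    case Nil
    then show ?case using assms(2) by auto
  next
    case (Cons v vs)
    then obtain zs where zs: "ys = zs @ v # vs" by blast
    then obtain us where us: "mset us + mset vs = mset xs" "P (vs @ us)"
      using Cons.IH by (metis append.assoc append_Cons append_Nil)
    have "mset us = add_mset v (mset zs)"
      using us(1) assms(1) zs by simp
    then have "v \<in> set us" by (metis set_mset_mset union_single_eq_member)
    then obtain p q where pq: "us = p @ v # q" by (metis split_list)
    then have "P (v # (vs @ p) @ q)" using assms(3)[of "vs @ p" v q] us(2) by simp
    then show ?case using us(1) pq by (intro exI[of _ "p @ q"]) auto
  qed
  from this[of ys] obtain us where "mset us + mset ys = mset xs" "P (ys @ us)" by auto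
  then show ?thesis using assms(1) by simp
qed

context graded_connected_hopf_algebra
begin

text \<open>For fixed \<open>x\<close>, \<open>sw\<close> evaluates a finite sum over one
  representative of \<open>\<Delta> x\<close>, and so is linear in the form \<open>\<beta>\<close>
  itself.\<close>

lemma sw_add: "sw (\<lambda>u w. \<beta> u w + \<gamma> u w) x = sw \<beta> x + sw \<gamma> x"
  by (auto simp: sw_def tensor_lift_def free_lift_def on_pairs_def scaleR_add_right
      simp flip: sum.distrib intro!: sum.cong)

lemma sw_scale: "sw (\<lambda>u w. c * \<beta> u w) x = c * sw \<beta> x" for c :: real
  by (simp add: sw_def tensor_lift_def free_lift_def on_pairs_def sum_distrib_left)
    (auto intro: sum.cong)

lemma sw_zero: "sw (\<lambda>u w. 0) x = 0"
  by (simp add: sw_def tensor_lift_def free_lift_def on_pairs_def)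

lemma sw_sum_list: "sw (\<lambda>u w. \<Sum>l\<leftarrow>L. \<beta> l u w) x = (\<Sum>l\<leftarrow>L. sw (\<beta> l) x)"
  by (induction L) (simp_all add: sw_zero sw_add)

definition conv :: "('h \<Rightarrow> real) \<Rightarrow> ('h \<Rightarrow> real) \<Rightarrow> 'h \<Rightarrow> real" where
  "conv F G = sw (\<lambda>u w. F u * G w)"

lemma linear_conv: "linear F \<Longrightarrow> linear G \<Longrightarrow> linear (conv F G)"
  unfolding conv_def by (intro linear_sw bilinear_times)

lemma conv_assoc:
  assumes "linear F" "linear G" "linear K"
  shows "conv F (conv G K) = conv (conv F G) K"
proof
  fix x
  have "linear (\<lambda>q. F u * (G p * K q))" "linear (\<lambda>p. F u * (G p * K q))" "linear (\<lambda>u. F u * (G p * K q))" for u p q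
    by (intro linear_compose[OF assms(1) linear_mult_left, unfolded o_def]
      linear_compose[OF linear_compose[OF assms(3) linear_mult_right, unfolded o_def] linear_mult_right, unfolded o_def]
      linear_compose[OF linear_compose[OF assms(2) linear_mult_left, unfolded o_def] linear_mult_right, unfolded o_def])+
  then have "sw (\<lambda>u w. sw (\<lambda>p q. F u * (G p * K q)) w) x = sw (\<lambda>u w. sw (\<lambda>p q. F p * (G q * K w)) u) x"
    by (intro sw_assoc)
  moreover have "sw (\<lambda>p q. F p * (G q * K w)) u = conv F G u * K w" for u w
    using sw_scale[of "K w" "\<lambda>p q. F p * G q" u] by (simp add: conv_def mult_ac)
  ultimately show "conv F (conv G K) x = conv (conv F G) K x"
    by (simp add: sw_scale conv_def)
qed

end

section \<open>Coordinate functionals, the counit and word functionals\<close>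

locale based_hopf_algebra = graded_connected_hopf_algebra H \<Delta>
  for H :: "nat \<Rightarrow> 'h::real_algebra_1 set" and \<Delta> +
  fixes B :: "nat \<Rightarrow> 'h set"
  assumes fin_dim: "\<And>n. \<exists>S. finite S \<and> span S = H n"
    and graded_basis: "graded_basis H B"
begin

abbreviation basis :: "'h set" where "basis \<equiv> all_basis B"

lemma B_basis: "independent (B n)" "span (B n) = H n"
  using graded_basis by (auto simp: graded_basis_def)

lemma one_in_B: "1 \<in> B 0" and B_0: "B 0 = {1}"
  using graded_basis by (auto simp: graded_basis_def)

lemma B_subset: "B n \<subseteq> basis"
  by (auto simp: all_basis_def)

lemma in_basis: "x \<in> B n \<Longrightarrow> x \<in> basis"
  using B_subset by blast

lemma B_in_H: "x \<in> B n \<Longrightarrow> x \<in> H n"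
  using B_basis span_base by blast

lemma independent_basis: "independent basis" and span_basis: "span basis = UNIV"
  using direct_sum_basis[OF graded, of B] B_basis by (auto simp: all_basis_def)

lemma finite_B: "finite (B n)"
  using fin_dim[of n] B_basis[of n] independent_span_bound span_superset by metis

lemma H_disjoint: "x \<in> H m \<Longrightarrow> x \<in> H n \<Longrightarrow> m \<noteq> n \<Longrightarrow> x = 0"
  using direct_sum_disjoint[OF graded] by blast

lemma B_disjoint: "x \<in> B m \<Longrightarrow> x \<in> B n \<Longrightarrow> m = n"
  using H_disjoint B_in_H B_basis dependent_zero by metis

text \<open>The dual-basis functional of \<open>y\<close>; it vanishes identically when
  \<open>y\<close> is not a basis element.\<close>

definition e :: "'h \<Rightarrow> 'h \<Rightarrow> real" where
  "e y v = representation basis v y"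

lemma linear_e: "linear (e y)"
  by (rule linearI) (simp_all add: e_def representation_add representation_scale independent_basis span_basis)

lemma e_basis: "x \<in> basis \<Longrightarrow> e y x = (if y = x then 1 else 0)"
  by (simp add: e_def representation_basis independent_basis)

lemma e_subset_zero:
  assumes "C \<subseteq> basis" "v \<in> span C" "e y v \<noteq> 0"
  shows "y \<in> C"
  using assms representation_extend[OF independent_basis assms(2,1)] representation_ne_zero
  by (metis e_def)

lemma e_homogeneous: "v \<in> H n \<Longrightarrow> e y v \<noteq> 0 \<Longrightarrow> y \<in> B n"
  using e_subset_zero[OF B_subset] B_basis by blast

lemma e_homogeneous_zero: "v \<in> H n \<Longrightarrow> y \<in> B m \<Longrightarrow> m \<noteq> n \<Longrightarrow> e y v = 0"
  using e_homogeneous B_disjoint by blast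

lemma expand_subset:
  assumes "C \<subseteq> basis" "v \<in> span C" "finite C"
  shows "v = (\<Sum>x\<in>C. e x v *\<^sub>R x)"
proof -
  have "independent C" using assms(1) independent_basis by (rule independent_mono[rotated])
  then have "(\<Sum>x\<in>C. representation C v x *\<^sub>R x) = v"
    by (rule sum_representation_eq) (use assms in auto)
  then show ?thesis using representation_extend[OF independent_basis assms(2,1)] by (simp add: e_def)
qed

lemma expand_homogeneous: "v \<in> H n \<Longrightarrow> v = (\<Sum>x\<in>B n. e x v *\<^sub>R x)"
  by (rule expand_subset) (simp_all add: B_subset B_basis finite_B)

lemma linear_homogeneous: "linear F \<Longrightarrow> v \<in> H n \<Longrightarrow> F v = (\<Sum>x\<in>B n. e x v *\<^sub>R F x)"
  using expand_homogeneous[of v n] by (metis (no_types, lifting) linear_sum linear_scale sum.cong)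

lemma e_sum_B:
  assumes "y \<in> B n"
  shows "e y (\<Sum>x\<in>B n. c x *\<^sub>R x) = c y"
proof -
  have "e y (\<Sum>x\<in>B n. c x *\<^sub>R x) = (\<Sum>x\<in>B n. c x * e y x)"
    by (simp add: linear_sum[OF linear_e] linear_scale[OF linear_e])
  also have "\<dots> = (\<Sum>x\<in>B n. if x = y then c x else 0)"
    by (intro sum.cong) (auto simp: e_basis in_basis)
  finally show ?thesis using assms finite_B by simp
qed

lemma eq_on_basis:
  assumes "linear F" "linear G" "\<And>n x. x \<in> B n \<Longrightarrow> F x = G x"
  shows "F = G"
proof
  fix x show "F x = G x"
    by (rule linear_eq_on_span[OF assms(1,2), of basis]) (use assms(3) span_basis in \<open>auto simp: all_basis_def\<close>)
qed

lemma bilinear_eq_on_basis: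
  assumes "bilinear \<beta>" "bilinear \<gamma>" "\<And>m n u w. u \<in> B m \<Longrightarrow> w \<in> B n \<Longrightarrow> \<beta> u w = \<gamma> u w"
  shows "\<beta> u w = \<gamma> u w"
proof -
  have l: "linear (\<beta> u)" "linear (\<gamma> u)" "linear (\<lambda>u. \<beta> u w)" "linear (\<lambda>u. \<gamma> u w)" for u w
    using assms by (auto simp: bilinear_def)
  have "\<beta> u = \<gamma> u" if "u \<in> B m" for u m
    using eq_on_basis[OF l(1,2)] assms(3) that by blast
  then have "(\<lambda>u. \<beta> u w) = (\<lambda>u. \<gamma> u w)"
    by (intro eq_on_basis l) auto
  then show ?thesis by meson
qed

text \<open>The locale carries no counit. In a connected graded bialgebra it is the projection to
  degree zero, hence the coordinate at \<open>1\<close>; \<open>counit_left\<close> and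
  \<open>counit_right\<close> confirm that it is the unit for convolution.\<close>

definition counit :: "'h \<Rightarrow> real" where "counit = e 1"

lemma linear_counit: "linear counit"
  by (simp add: counit_def linear_e)

lemma counit_1: "counit 1 = 1"
  using one_in_B by (simp add: counit_def e_basis in_basis)

lemma counit_homogeneous: "x \<in> H n \<Longrightarrow> n \<noteq> 0 \<Longrightarrow> counit x = 0"
  using e_homogeneous_zero[OF _ one_in_B] by (simp add: counit_def)

lemma counit_left: "linear F \<Longrightarrow> conv counit F = F"
proof (rule eq_on_basis)
  assume F: "linear F"
  have b: "bilinear (\<lambda>u w. counit u * F w)" by (intro bilinear_times linear_counit F)
  show "linear (conv counit F)" by (intro linear_conv linear_counit F)
  fix n x assume x: "x \<in> B n"
  show "conv counit F x = F x"
  proof (cases "n = 0")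
    case True
    then show ?thesis using x B_0 by (simp add: conv_def sw_one b counit_1)
  next
    case False
    with x have "sw (\<lambda>u w. counit u * F w) x = counit 1 * F x + counit x * F 1"
      by (intro sw_reduced[OF b, of n]) (auto simp: B_in_H counit_homogeneous)
    with x False show ?thesis by (simp add: conv_def counit_1 counit_homogeneous[OF B_in_H])
  qed
qed

lemma counit_right: "linear F \<Longrightarrow> conv F counit = F"
proof (rule eq_on_basis)
  assume F: "linear F"
  have b: "bilinear (\<lambda>u w. F u * counit w)" by (intro bilinear_times linear_counit F)
  show "linear (conv F counit)" by (intro linear_conv linear_counit F)
  fix n x assume x: "x \<in> B n"
  show "conv F counit x = F x"
  proof (cases "n = 0")
    case True
    then show ?thesis using x B_0 by (simp add: conv_def sw_one b counit_1)
  next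
    case False
    with x have "sw (\<lambda>u w. F u * counit w) x = F 1 * counit x + F x * counit 1"
      by (intro sw_reduced[OF b, of n]) (auto simp: B_in_H counit_homogeneous)
    with x False show ?thesis by (simp add: conv_def counit_1 counit_homogeneous[OF B_in_H])
  qed
qed

text \<open>Starting from the convolution unit makes concatenation of words correspond to
  convolution, see \<open>E_append\<close>.\<close>

fun E :: "'h list \<Rightarrow> 'h \<Rightarrow> real" where
  "E [] = counit"
| "E (y # ys) = conv (e y) (E ys)"

lemma linear_E: "linear (E ys)"
  by (induction ys) (simp_all add: linear_counit linear_conv linear_e)

lemma E_single: "E [y] = e y"
  by (simp add: counit_right linear_e)

lemma E_append: "E (us @ ws) = conv (E us) (E ws)"
  by (induction us) (simp_all add: counit_left linear_E conv_assoc linear_e)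

lemma representation_pure_tensor:
  assumes "set zs \<subseteq> basis"
  shows "representation (pure_tensor ` lists basis) t (pure_tensor zs) = tensor_lift (coordinate basis zs) t"
proof (rule linear_eq_on_span[where x = t and B = "pure_tensor ` lists basis"
      and f = "\<lambda>t. representation (pure_tensor ` lists basis) t (pure_tensor zs)"])
  note p = pure_tensor_basis[OF independent_basis span_basis]
  show "linear (\<lambda>t. representation (pure_tensor ` lists basis) t (pure_tensor zs))"
    by (rule linearI) (simp_all add: representation_add representation_scale p)
  show "linear (tensor_lift (coordinate basis zs))"
    by (intro linear_tensor_lift multilinear_coordinate independent_basis span_basis)
  show "t \<in> span (pure_tensor ` lists basis)" by (simp add: p)
  fix s assume "s \<in> pure_tensor ` lists basis"
  then obtain vs where vs: "vs \<in> lists basis" "s = pure_tensor vs" by blast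
  have zs: "zs \<in> lists basis" using assms by auto
  show "representation (pure_tensor ` lists basis) s (pure_tensor zs) = tensor_lift (coordinate basis zs) s"
    using vs zs inj_onD[OF p(1), of zs vs]
    by (auto simp: representation_basis p(2) tensor_lift_pure multilinear_coordinate independent_basis
        span_basis coordinate_basis)
qed

text \<open>The coordinate functional of a basis tensor factors along its first letter, which
  matches the recursion of \<open>E\<close> through \<open>iterated_coproduct_Suc\<close>. The empty
  word is excluded because exponent \<open>0\<close> of \<open>iterated_coproduct\<close> does not
  yield the counit.\<close>

lemma coproduct_coeff_eq:
  assumes "set zs \<subseteq> basis" "zs \<noteq> []"
  shows "coproduct_coeff B \<Delta> x zs = E zs x"
proof -
  have m: "multilinear (coordinate basis zs)" for zs
    by (intro multilinear_coordinate independent_basis span_basis)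
  note l = linear_tensor_lift[OF m]
  have "tensor_lift (coordinate basis zs) (iterated_coproduct \<Delta> (length zs) x) = E zs x"
    using assms(2)
  proof (induction zs arbitrary: x rule: list_nonempty_induct)
    case (single c)
    then show ?case
      by (simp add: iterated_coproduct_def tensor_lift_pure m counit_right linear_e) (simp add: e_def)
  next
    case (cons c cs)
    have *: "tensor_lift (coordinate basis (c # cs)) (pure_tensor [u] \<otimes> t) = e c u * tensor_lift (coordinate basis cs) t" for u t
      by (rule linear_eq_on_pure[OF linear_compose[OF linear_pure_prod l, unfolded o_def]
          linear_compose[OF l linear_mult_right, unfolded o_def]])
        (simp add: pure_prod_pure tensor_lift_pure m e_def)
    obtain k where k: "length cs = Suc k" using cons.hyps by (cases cs) auto
    have "tensor_lift (coordinate basis (c # cs)) (iterated_coproduct \<Delta> (length (c # cs)) x)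
      = (\<Sum>(u, w)\<leftarrow>sweedler x. e c u * E cs w)"
      unfolding list.size k add_Suc_right add_0_right iterated_coproduct_Suc
      by (simp add: linear_sum_list[OF l] split_def * cons.IH[unfolded k])
    then show ?case
      by (simp add: conv_def sw_eq_sum_list bilinear_times linear_e linear_E)
  qed
  then show ?thesis
    by (simp add: coproduct_coeff_def representation_pure_tensor assms(1))
qed

end

section \<open>Words evaluated on products and on Hopf powers\<close>

lemma sum_list_concat_map: "(\<Sum>x\<leftarrow>concat (map g xs). f x) = (\<Sum>x\<leftarrow>xs. \<Sum>y\<leftarrow>g x. f y)"
  for f :: "'a \<Rightarrow> 'b::monoid_add"
  by (induction xs) simp_all

lemma bilinear_add: "bilinear \<beta> \<Longrightarrow> bilinear \<gamma> \<Longrightarrow> bilinear (\<lambda>u w. \<beta> u w + \<gamma> u w)"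
  by (auto simp: bilinear_def intro: linear_compose_add)

lemma bilinear_scale: "bilinear \<beta> \<Longrightarrow> bilinear (\<lambda>u w. c * \<beta> u w)" for c :: real
  by (auto simp: bilinear_def intro: linear_compose[OF _ linear_mult_right, unfolded o_def])

lemma bilinear_sum: "(\<And>i. i \<in> S \<Longrightarrow> bilinear (\<beta> i)) \<Longrightarrow> bilinear (\<lambda>u w. \<Sum>i\<in>S. \<beta> i u w)"
  by (auto simp: bilinear_def intro!: linear_compose_sum)

lemma bilinear_linear_mult:
  "linear F \<Longrightarrow> bilinear (\<lambda>u w. F (u * w))" for F :: "'a::real_algebra \<Rightarrow> 'b::real_vector"
  by (intro bilinearI linear_compose[OF linear_mult_left, unfolded o_def]
      linear_compose[OF linear_mult_right, unfolded o_def])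

context based_hopf_algebra
begin

definition pos_basis :: "'h set" where "pos_basis = (\<Union>n\<in>{1..}. B n)"

lemma pos_basisE: "y \<in> pos_basis \<Longrightarrow> (\<And>m. m \<ge> 1 \<Longrightarrow> y \<in> B m \<Longrightarrow> thesis) \<Longrightarrow> thesis"
  by (auto simp: pos_basis_def)

lemma pos_basisI: "y \<in> B m \<Longrightarrow> m \<ge> 1 \<Longrightarrow> y \<in> pos_basis"
  by (auto simp: pos_basis_def)

lemma counit_mult: "counit (w * z) = counit w * counit z"
proof -
  have "counit (u * w) = counit u * counit w" if "u \<in> B i" "w \<in> B j" for u w i j
  proof (cases "i = 0 \<and> j = 0")
    case True
    with that B_0 show ?thesis by (auto simp: counit_1)
  next
    case False
    have "u \<in> H i" "w \<in> H j" "u * w \<in> H (i + j)"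
      using that B_in_H mult_graded by blast+
    then show ?thesis using False counit_homogeneous[of u i] counit_homogeneous[of w j]
        counit_homogeneous[of "u * w" "i + j"] by (cases "i = 0") auto
  qed
  then show ?thesis
    by (rule bilinear_eq_on_basis[OF bilinear_linear_mult[OF linear_counit]
          bilinear_times[OF linear_counit linear_counit]])
qed

text \<open>Checked on pairs of basis elements. If one factor is \<open>1\<close>, the counit terms
  give the value; if both have positive degree, the counit terms vanish and the sum over
  \<open>P\<close> picks out this pair, provided the degrees add up to \<open>m\<close>. The terms
  over \<open>P\<close> are the ones that later lengthen words.\<close>

lemma e_mult:
  assumes "y \<in> B m" "m \<ge> 1"
  defines "P \<equiv> \<Union>i\<in>{1..m-1}. B i \<times> B (m - i)"
  shows "e y (w * z) = e y w * counit z + counit w * e y z + (\<Sum>(p, q)\<in>P. e y (p * q) * (e p w * e q z))"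
proof -
  have finP: "finite P" unfolding P_def using finite_B by auto
  have bil: "bilinear (\<lambda>w z. e y w * counit z + counit w * e y z + (\<Sum>(p, q)\<in>P. e y (p * q) * (e p w * e q z)))"
    unfolding split_def
    by (intro bilinear_add bilinear_sum bilinear_scale bilinear_times linear_e linear_counit)
  have S: "(\<Sum>(p, q)\<in>P. e y (p * q) * (e p u * e q w)) = (if (u, w) \<in> P then e y (u * w) else 0)"
    if "u \<in> basis" "w \<in> basis" for u w
  proof -
    have "(\<Sum>(p, q)\<in>P. e y (p * q) * (e p u * e q w)) = (\<Sum>x\<in>P. if x = (u, w) then e y (u * w) else 0)"
      by (intro sum.cong) (auto simp: e_basis that split: if_splits)
    then show ?thesis using finP by simp
  qed
  have "e y (u * w) = e y u * counit w + counit u * e y w + (\<Sum>(p, q)\<in>P. e y (p * q) * (e p u * e q w))"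
    if u: "u \<in> B i" and w: "w \<in> B j" for u w i j
  proof -
    have P: "(u, w) \<in> P \<longleftrightarrow> i \<ge> 1 \<and> j \<ge> 1 \<and> i + j = m"
    proof
      assume "(u, w) \<in> P"
      then obtain k where k: "k \<in> {1..m-1}" "u \<in> B k" "w \<in> B (m - k)" unfolding P_def by blast
      then have "i = k" "j = m - k" using B_disjoint u w by blast+
      then show "i \<ge> 1 \<and> j \<ge> 1 \<and> i + j = m" using k(1) by auto
    next
      assume "i \<ge> 1 \<and> j \<ge> 1 \<and> i + j = m"
      then have "i \<in> {1..m-1}" "j = m - i" by auto
      then show "(u, w) \<in> P" unfolding P_def using u w by blast
    qed
    have uw: "u \<in> H i" "w \<in> H j" "u * w \<in> H (i + j)"
      using u w B_in_H mult_graded by blast+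
    have y1: "e y 1 = 0" using e_homogeneous_zero[OF B_in_H[OF one_in_B] assms(1)] assms(2) by auto
    consider "i = 0" | "j = 0" "i \<noteq> 0" | "i \<noteq> 0" "j \<noteq> 0" by blast
    then show ?thesis
    proof cases
      case 1
      then have "u = 1" using u B_0 by auto
      with 1 show ?thesis using S[of u w] u w P in_basis by (auto simp: y1 counit_1)
    next
      case 2
      then have "w = 1" using w B_0 by auto
      with 2 show ?thesis using S[of u w] u w P in_basis by (auto simp: y1 counit_1)
    next
      case 3
      then show ?thesis
        using S[of u w] u w P in_basis counit_homogeneous[OF uw(1)] counit_homogeneous[OF uw(2)]
          e_homogeneous_zero[OF uw(3) assms(1)] by auto
    qed
  qed
  then show ?thesis
    by (rule bilinear_eq_on_basis[OF bilinear_linear_mult[OF linear_e] bil])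
qed

text \<open>A list \<open>L\<close> stands for a formal sum of pairs of words, an element of the
  tensor square of the word algebra; \<open>prod2\<close> below multiplies such sums by
  componentwise concatenation.\<close>

definition eval2 :: "(real \<times> 'h list \<times> 'h list) list \<Rightarrow> 'h \<Rightarrow> 'h \<Rightarrow> real" where
  "eval2 L w z = (\<Sum>(c, us, ws)\<leftarrow>L. c * (E us w * E ws z))"

lemma eval2_append: "eval2 (L @ M) w z = eval2 L w z + eval2 M w z"
  by (simp add: eval2_def)

definition prod2 :: "(real \<times> 'h list \<times> 'h list) list \<Rightarrow> (real \<times> 'h list \<times> 'h list) list \<Rightarrow> (real \<times> 'h list \<times> 'h list) list" where
  "prod2 L M = concat (map (\<lambda>(c, us, ws). map (\<lambda>(d, us', ws'). (c * d, us @ us', ws @ ws')) M) L)"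

text \<open>The dual of multiplicativity of \<open>\<Delta>\<close>: passing from a functional to
  its values on products respects convolution. On word functionals convolution is concatenation,
  hence \<open>prod2\<close>.\<close>

lemma conv_mult:
  assumes F: "linear F" "\<And>w z. F (w * z) = eval2 L w z" and G: "linear G" "\<And>w z. G (w * z) = eval2 M w z"
  shows "conv F G (w * z) = eval2 (prod2 L M) w z"
proof -
  have b: "bilinear (\<lambda>u w. F u * G w)" by (intro bilinear_times F G)
  have FG: "F (p * r) * G (q * s) = (\<Sum>(c, us, ws)\<leftarrow>L. \<Sum>(d, us', ws')\<leftarrow>M.
     c * d * (E us p * E us' q) * (E ws r * E ws' s))" for p q r s
    unfolding F G eval2_def split_def sum_list_mult_const[symmetric]
    by (simp add: sum_list_const_mult[symmetric] mult_ac)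
  have "conv F G (w * z) = sw (\<lambda>p q. sw (\<lambda>r s. F (p * r) * G (q * s)) z) w"
    unfolding conv_def by (rule sw_mult[OF b])
  also have "\<dots> = sw (\<lambda>p q. \<Sum>(c, us, ws)\<leftarrow>L. \<Sum>(d, us', ws')\<leftarrow>M.
     c * d * (E us p * E us' q) * E (ws @ ws') z) w"
    unfolding FG split_def sw_sum_list sw_scale E_append conv_def ..
  also have "\<dots> = sw (\<lambda>p q. \<Sum>(c, us, ws)\<leftarrow>L. \<Sum>(d, us', ws')\<leftarrow>M.
     (c * d * E (ws @ ws') z) * (E us p * E us' q)) w"
    by (simp add: mult_ac)
  also have "\<dots> = (\<Sum>(c, us, ws)\<leftarrow>L. \<Sum>(d, us', ws')\<leftarrow>M.
     (c * d * E (ws @ ws') z) * E (us @ us') w)"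
    unfolding split_def sw_sum_list sw_scale E_append[of "fst (snd _)"] conv_def ..
  also have "\<dots> = eval2 (prod2 L M) w z"
    by (simp add: eval2_def prod2_def sum_list_concat_map split_def o_def mult_ac)
  finally show ?thesis .
qed

text \<open>Induction on the word. By \<open>e_mult\<close> the first letter contributes itself on
  the left, itself on the right, or a pair of shorter-degree letters. The first two choices combine
  with the splits of the tail to the splits of the whole word; everything else goes into the
  remainder.\<close>

lemma E_mult:
  assumes "set ys \<subseteq> pos_basis"
  shows "\<exists>R. (\<forall>(c, us, ws)\<in>set R. set us \<subseteq> pos_basis \<and> set ws \<subseteq> pos_basis \<and> length us + length ws > length ys) \<and>
    (\<forall>w z. E ys (w * z) = (\<Sum>(us, ws)\<leftarrow>splits ys. E us w * E ws z) + eval2 R w z)"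
  using assms
proof (induction ys)
  case Nil
  show ?case by (intro exI[of _ "[]"]) (simp add: counit_mult eval2_def)
next
  case (Cons y ys)
  then obtain R where R: "\<forall>(c, us, ws)\<in>set R. set us \<subseteq> pos_basis \<and> set ws \<subseteq> pos_basis \<and> length us + length ws > length ys"
    "\<And>w z. E ys (w * z) = (\<Sum>(us, ws)\<leftarrow>splits ys. E us w * E ws z) + eval2 R w z"
    by auto
  obtain m where m: "m \<ge> 1" "y \<in> B m" using Cons.prems pos_basisE by auto
  define P where "P = (\<Union>i\<in>{1..m-1}. B i \<times> B (m - i))"
  have "finite P" unfolding P_def using finite_B by auto
  then obtain ps where ps: "set ps = P" "distinct ps" using finite_distinct_list by blast
  \<comment> \<open>Here one letter \<open>y\<close> is traded for two letters \<open>p\<close> and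
    \<open>q\<close>, so the total length grows by one.\<close>
  define R0 where "R0 = map (\<lambda>(p, q). (e y (p * q), [p], [q])) ps"
  have R0: "\<forall>(c, us, ws)\<in>set R0. set us \<subseteq> pos_basis \<and> set ws \<subseteq> pos_basis \<and> length us + length ws = 2"
    unfolding R0_def using ps(1) by (auto simp: P_def intro!: pos_basisI)
  define L where "L = (1, [y], []) # (1, [], [y]) # R0"
  have ey: "e y (w * z) = eval2 L w z" for w z
    using e_mult[OF m(2,1), of w z] sum_list_distinct_conv_sum_set[OF ps(2), of "\<lambda>x. e y (fst x * snd x) * (e (fst x) w * e (snd x) z)"] ps(1)
    by (simp add: L_def R0_def P_def eval2_def counit_right linear_e split_def o_def)
  define M where "M = map (\<lambda>(us, ws). (1, us, ws)) (splits ys) @ R"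
  have Eys: "E ys (w * z) = eval2 M w z" for w z
    by (simp add: R(2) M_def eval2_append) (simp add: eval2_def split_def o_def)
  \<comment> \<open>A leading term of \<open>y\<close> times the remainder of \<open>ys\<close>, or
    a remainder term of \<open>y\<close> times anything from \<open>ys\<close>: either way at least
    one letter is gained.\<close>
  define R' where "R' = prod2 [(1, [y], []), (1, [], [y])] R @ prod2 R0 M"
  have lenM: "set us \<subseteq> pos_basis \<and> set ws \<subseteq> pos_basis \<and> length us + length ws \<ge> length ys" if inM: "(c, us, ws) \<in> set M" for c us ws
  proof -
    consider "(us, ws) \<in> set (splits ys)" | "(c, us, ws) \<in> set R" using inM by (auto simp: M_def)
    then show ?thesis
    proof cases
      case 1
      from mset_splits[OF 1] have "set us \<union> set ws = set ys" "length us + length ws = length ys"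
        by (metis set_mset_mset set_mset_union, metis size_mset size_union)
      then show ?thesis using Cons.prems by auto
    qed (use R(1) in fastforce)
  qed
  have "set us \<subseteq> pos_basis \<and> set ws \<subseteq> pos_basis \<and> length us + length ws > length (y # ys)"
    if inR': "(c, us, ws) \<in> set R'" for c us ws
  proof -
    consider "(c, us, ws) \<in> set (prod2 [(1, [y], []), (1, [], [y])] R)" | "(c, us, ws) \<in> set (prod2 R0 M)"
      using inR' by (auto simp: R'_def)
    then show ?thesis
    proof cases
      case 1
      then show ?thesis using R(1) Cons.prems by (fastforce simp: prod2_def)
    next
      case 2
      then obtain c1 us1 ws1 c2 us2 ws2 where "(c1, us1, ws1) \<in> set R0" "(c2, us2, ws2) \<in> set M"
        "us = us1 @ us2" "ws = ws1 @ ws2"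
        by (fastforce simp: prod2_def)
      then show ?thesis using R0 lenM by fastforce
    qed
  qed
  moreover have "E (y # ys) (w * z) = (\<Sum>(us, ws)\<leftarrow>splits (y # ys). E us w * E ws z) + eval2 R' w z" for w z
  proof -
    have "E (y # ys) (w * z) = eval2 (prod2 L M) w z"
      using conv_mult[OF linear_e ey linear_E Eys] by simp
    then show ?thesis
      by (simp add: L_def M_def R'_def prod2_def eval2_append)
        (simp add: eval2_def split_def o_def)
  qed
  ultimately show ?case by blast
qed

text \<open>Induction on the number of packs through \<open>hopf_power_Suc\<close>:
  \<open>E_mult\<close> splits off the word of the first pack, and the induction hypothesis shuffles
  the rest. Neither step shortens the words in total, so an excess once gained is kept.\<close>

lemma E_hopf_power:
  assumes "set ys \<subseteq> pos_basis"
  shows "\<exists>R. (\<forall>(c, ts)\<in>set R. set ts \<subseteq> pos_basis \<and> length ts > length ys) \<and>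
    (\<forall>v. E ys (hopf_power \<Delta> (Suc a) v) = (\<Sum>ts\<leftarrow>riffle a ys. E ts v) + (\<Sum>(c, ts)\<leftarrow>R. c * E ts v))"
  using assms
proof (induction a arbitrary: ys)
  case 0
  show ?case by (intro exI[of _ "[]"]) (simp add: hopf_power_1)
next
  case (Suc a)
  \<comment> \<open>The remainder depends on the word, and the induction hypothesis is used for many
    words at once; choice turns it into a function \<open>Q\<close>.\<close>
  have "\<forall>ws. \<exists>Q. set ws \<subseteq> pos_basis \<longrightarrow> (\<forall>(c, ts)\<in>set Q. set ts \<subseteq> pos_basis \<and> length ts > length ws) \<and>
    (\<forall>v. E ws (hopf_power \<Delta> (Suc a) v) = (\<Sum>ts\<leftarrow>riffle a ws. E ts v) + (\<Sum>(c, ts)\<leftarrow>Q. c * E ts v))"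
    using Suc.IH by blast
  from choice[OF this] obtain Q where Q':
    "\<forall>ws. set ws \<subseteq> pos_basis \<longrightarrow> (\<forall>(c, ts)\<in>set (Q ws). set ts \<subseteq> pos_basis \<and> length ts > length ws) \<and>
    (\<forall>v. E ws (hopf_power \<Delta> (Suc a) v) = (\<Sum>ts\<leftarrow>riffle a ws. E ts v) + (\<Sum>(c, ts)\<leftarrow>Q ws. c * E ts v))" ..
  have Q: "\<forall>(c, ts)\<in>set (Q ws). set ts \<subseteq> pos_basis \<and> length ts > length ws"
    "E ws (hopf_power \<Delta> (Suc a) v) = (\<Sum>ts\<leftarrow>riffle a ws. E ts v) + (\<Sum>(c, ts)\<leftarrow>Q ws. c * E ts v)"
    if "set ws \<subseteq> pos_basis" for ws v
    using Q'[rule_format, OF that] by blast+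
  obtain R where R: "\<forall>(c, us, ws)\<in>set R. set us \<subseteq> pos_basis \<and> set ws \<subseteq> pos_basis \<and> length us + length ws > length ys"
    "\<And>w z. E ys (w * z) = (\<Sum>(us, ws)\<leftarrow>splits ys. E us w * E ws z) + eval2 R w z"
    using E_mult[OF Suc.prems] by auto
  have S: "set us \<subseteq> pos_basis \<and> set ws \<subseteq> pos_basis \<and> length us + length ws = length ys" if "(us, ws) \<in> set (splits ys)" for us ws
  proof -
    from mset_splits[OF that] have "set us \<union> set ws = set ys" "length us + length ws = length ys"
      by (metis set_mset_mset set_mset_union, metis size_mset size_union)
    then show ?thesis using Suc.prems by auto
  qed
  have riff: "set ts \<subseteq> pos_basis \<and> length ts = length ws" if "ts \<in> set (riffle a ws)" "set ws \<subseteq> pos_basis" for ts ws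
    using mset_riffle[OF that(1)] that(2) by (metis mset_eq_setD mset_eq_length)
  have conv_term: "sw (\<lambda>u w. E us u * E ws (hopf_power \<Delta> (Suc a) w)) v
    = (\<Sum>ts\<leftarrow>riffle a ws. E (us @ ts) v) + (\<Sum>(c, ts)\<leftarrow>Q ws. c * E (us @ ts) v)"
    if "set ws \<subseteq> pos_basis" for us ws v
  proof -
    have "E us u * E ws (hopf_power \<Delta> (Suc a) w)
      = (\<Sum>ts\<leftarrow>riffle a ws. E us u * E ts w) + (\<Sum>(c, ts)\<leftarrow>Q ws. c * (E us u * E ts w))" for u w
      unfolding Q(2)[OF that] split_def distrib_left sum_list_const_mult[symmetric] by (simp only: mult.left_commute)
    then show ?thesis
      unfolding E_append conv_def by (simp add: sw_add sw_sum_list split_def sw_scale)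
  qed
  \<comment> \<open>\<open>R1\<close> takes a leading split followed by a remainder of the induction
    hypothesis; \<open>R2\<close> takes a remainder of \<open>E_mult\<close> followed by any term of
    the induction hypothesis.\<close>
  define R1 where "R1 = concat (map (\<lambda>(us, ws). map (\<lambda>(c, ts). (c, us @ ts)) (Q ws)) (splits ys))"
  define R2 where "R2 = concat (map (\<lambda>(c, us, ws).
      map (\<lambda>ts. (c, us @ ts)) (riffle a ws) @ map (\<lambda>(d, ts). (c * d, us @ ts)) (Q ws)) R)"
  have "E ys (hopf_power \<Delta> (Suc (Suc a)) v)
     = (\<Sum>ts\<leftarrow>riffle (Suc a) ys. E ts v) + (\<Sum>(c, ts)\<leftarrow>R1 @ R2. c * E ts v)" for v
  proof -
    have "E ys (hopf_power \<Delta> (Suc (Suc a)) v) = sw (\<lambda>u w. E ys (u * hopf_power \<Delta> (Suc a) w)) v"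
      unfolding hopf_power_Suc by (rule linear_of_sw[OF linear_E bilinear_mult_hopf_power])
    also have "\<dots> = (\<Sum>(us, ws)\<leftarrow>splits ys. sw (\<lambda>u w. E us u * E ws (hopf_power \<Delta> (Suc a) w)) v)
      + (\<Sum>(c, us, ws)\<leftarrow>R. c * sw (\<lambda>u w. E us u * E ws (hopf_power \<Delta> (Suc a) w)) v)"
      unfolding R(2) eval2_def split_def sw_add sw_sum_list sw_scale ..
    also have "(\<Sum>(us, ws)\<leftarrow>splits ys. sw (\<lambda>u w. E us u * E ws (hopf_power \<Delta> (Suc a) w)) v)
      = (\<Sum>(us, ws)\<leftarrow>splits ys. (\<Sum>ts\<leftarrow>riffle a ws. E (us @ ts) v) + (\<Sum>(c, ts)\<leftarrow>Q ws. c * E (us @ ts) v))"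
      by (intro arg_cong[where f = sum_list] map_cong) (use S conv_term in auto)
    also have "\<dots> = (\<Sum>ts\<leftarrow>riffle (Suc a) ys. E ts v) + (\<Sum>(c, ts)\<leftarrow>R1. c * E ts v)"
      by (simp add: R1_def sum_list_concat_map split_def o_def sum_list_addf)
    also have "(\<Sum>(c, us, ws)\<leftarrow>R. c * sw (\<lambda>u w. E us u * E ws (hopf_power \<Delta> (Suc a) w)) v)
      = (\<Sum>(c, us, ws)\<leftarrow>R. c * ((\<Sum>ts\<leftarrow>riffle a ws. E (us @ ts) v) + (\<Sum>(d, ts)\<leftarrow>Q ws. d * E (us @ ts) v)))"
      by (intro arg_cong[where f = sum_list] map_cong) (use R(1) conv_term in fastforce)+
    also have "\<dots> = (\<Sum>(c, ts)\<leftarrow>R2. c * E ts v)"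
      by (simp add: R2_def sum_list_concat_map split_def o_def sum_list_const_mult[symmetric] distrib_left mult_ac)
    finally show ?thesis by simp
  qed
  moreover have "set ts \<subseteq> pos_basis \<and> length ts > length ys" if inR: "(c, ts) \<in> set (R1 @ R2)" for c ts
  proof -
    consider us ws ts' where "(us, ws) \<in> set (splits ys)" "(c, ts') \<in> set (Q ws)" "ts = us @ ts'"
      | c us ws ts' where "(c, us, ws) \<in> set R" "ts' \<in> set (riffle a ws)" "ts = us @ ts'"
      | c us ws d ts' where "(c, us, ws) \<in> set R" "(d, ts') \<in> set (Q ws)" "ts = us @ ts'"
      using inR by (fastforce simp: R1_def R2_def)
    then show ?thesis
    proof cases
      case (1 us ws ts')
      then show ?thesis using S[OF 1(1)] Q(1)[of ws] by fastforce
    next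
      case (2 c us ws ts')
      then have "set us \<subseteq> pos_basis \<and> set ws \<subseteq> pos_basis \<and> length us + length ws > length ys" using R(1) by blast
      then show ?thesis using riff[OF 2(2)] 2(3) by auto
    next
      case (3 c us ws d ts')
      then have "set us \<subseteq> pos_basis \<and> set ws \<subseteq> pos_basis \<and> length us + length ws > length ys" using R(1) by blast
      then show ?thesis using Q(1)[of ws] 3(2,3) by fastforce
    qed
  qed
  ultimately show ?case by blast
qed

text \<open>Each letter consumes a tensor factor of its own degree, which is at least one, and these
  degrees add up to \<open>n\<close>. Equality of length and degree forces every letter into degree
  one.\<close>

lemma E_degree:
  assumes "v \<in> H n" "set ys \<subseteq> pos_basis" "E ys v \<noteq> 0"
  shows "length ys \<le> n \<and> (length ys = n \<longrightarrow> set ys \<subseteq> B 1)"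
  using assms
proof (induction ys arbitrary: v n)
  case (Cons y ys)
  have "\<exists>j u w. j \<le> n \<and> u \<in> H j \<and> w \<in> H (n - j) \<and> e y u * E ys w \<noteq> 0"
    using sw_homogeneous_zero[OF bilinear_times[OF linear_e linear_E], of v n y ys] Cons.prems
    unfolding E.simps conv_def by blast
  then obtain j u w where *: "j \<le> n" "u \<in> H j" "w \<in> H (n - j)" "e y u \<noteq> 0" "E ys w \<noteq> 0" by auto
  obtain m where m: "m \<ge> 1" "y \<in> B m" using Cons.prems(2) pos_basisE by auto
  with * have "y \<in> B j" "j = m" using e_homogeneous B_disjoint by blast+
  moreover have "length ys \<le> n - j \<and> (length ys = n - j \<longrightarrow> set ys \<subseteq> B 1)"
    using Cons.IH[OF *(3) _ *(5)] Cons.prems(2) by simp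
  ultimately show ?case using m *(1)
    by (cases "j = 1") auto
qed auto

end

section \<open>Eigenvectors of the Hopf power\<close>

lemma sum_list_eq_bound_imp_eq:
  assumes "\<And>x. x \<in> set xs \<Longrightarrow> f x \<le> m" "(\<Sum>x\<leftarrow>xs. f x) = real (length xs) * m" "x \<in> set xs"
  shows "f x = m"
proof -
  have "(\<Sum>x\<leftarrow>xs. m - f x) = real (length xs) * m - (\<Sum>x\<leftarrow>xs. f x)"
    by (induction xs) (auto simp: algebra_simps)
  then have "(\<Sum>x\<leftarrow>xs. m - f x) = 0" using assms(2) by simp
  moreover have "\<forall>y\<in>set (map (\<lambda>x. m - f x) xs). 0 \<le> y" using assms(1) by auto
  ultimately have "\<forall>z\<in>set (map (\<lambda>x. m - f x) xs). z = 0"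
    by (subst (asm) sum_list_nonneg_eq_0_iff) auto
  then show ?thesis using assms(3) by auto
qed

lemma count_splits_Nil: "(\<Sum>(us, ws)\<leftarrow>splits xs. if us = [] then 1 else 0) = (1::nat)"
  by (induction xs) (simp_all add: o_def split_def)

lemma count_splits_single: "(\<Sum>(us, ws)\<leftarrow>splits xs. if us = [y] then 1 else 0) = count (mset xs) y"
proof (induction xs)
  case (Cons x xs)
  then show ?case using count_splits_Nil[of xs] by (cases "x = y") (simp_all add: o_def split_def)
qed simp

lemma mset_upt_permute_list:
  assumes "mset l = mset [0..<n]"
  shows "\<exists>\<tau>. \<tau> permutes {..<n} \<and> permute_list \<tau> [0..<n] = l"
  using mset_eq_permutation[OF assms] by auto

section \<open>Symmetrised products of degree-one elements\<close>

context graded_connected_hopf_algebra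
begin

text \<open>Elements of \<open>H 1\<close> are primitive, so by multiplicativity of the coproduct
  each letter goes entirely to the left or entirely to the right.\<close>

lemma sw_word:
  assumes "set cs \<subseteq> H 1" "bilinear \<beta>"
  shows "sw \<beta> (prod_list cs) = (\<Sum>(us, ws)\<leftarrow>splits cs. \<beta> (prod_list us) (prod_list ws))"
  using assms
proof (induction cs arbitrary: \<beta>)
  case Nil
  then show ?case by (simp add: sw_one)
next
  case (Cons c cs)
  let ?P = "prod_list cs"
  have "sw \<beta> (prod_list (c # cs)) = sw (\<lambda>p q. sw (\<lambda>r s. \<beta> (p * r) (q * s)) ?P) c"
    using sw_mult[OF Cons.prems(2)] by simp
  \<comment> \<open>For \<open>n = 1\<close> the range of intermediate degrees is empty, so
    \<open>sw_reduced\<close> applies to every bilinear map.\<close>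
  also have "\<dots> = sw (\<lambda>r s. \<beta> r (c * s)) ?P + sw (\<lambda>r s. \<beta> (c * r) s) ?P"
    using sw_reduced[OF bilinear_shift(2)[OF Cons.prems(2)], of 1 c ?P] Cons.prems(1) by simp
  also have "sw (\<lambda>r s. \<beta> r (c * s)) ?P = (\<Sum>(us, ws)\<leftarrow>splits cs. \<beta> (prod_list us) (c * prod_list ws))"
    using Cons.IH[OF _ bilinear_shift(1)[OF Cons.prems(2), of 1 c]] Cons.prems(1) by simp
  also have "sw (\<lambda>r s. \<beta> (c * r) s) ?P = (\<Sum>(us, ws)\<leftarrow>splits cs. \<beta> (c * prod_list us) (prod_list ws))"
    using Cons.IH[OF _ bilinear_shift(1)[OF Cons.prems(2), of c 1]] Cons.prems(1) by simp
  finally show ?case by (simp add: o_def split_def)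
qed

lemma set_splits: "(us, ws) \<in> set (splits xs) \<Longrightarrow> set us \<subseteq> set xs \<and> set ws \<subseteq> set xs"
  by (metis mset_splits set_mset_mset set_mset_union Un_upper1 Un_upper2)

lemma hopf_power_word:
  "set cs \<subseteq> H 1 \<Longrightarrow> hopf_power \<Delta> (Suc a) (prod_list cs) = (\<Sum>ts\<leftarrow>riffle a cs. prod_list ts)"
proof (induction a arbitrary: cs)
  case (Suc a)
  have "hopf_power \<Delta> (Suc (Suc a)) (prod_list cs)
    = (\<Sum>(us, ws)\<leftarrow>splits cs. prod_list us * hopf_power \<Delta> (Suc a) (prod_list ws))"
    unfolding hopf_power_Suc by (rule sw_word[OF Suc.prems bilinear_mult_hopf_power])
  also have "\<dots> = (\<Sum>(us, ws)\<leftarrow>splits cs. \<Sum>ts\<leftarrow>riffle a ws. prod_list (us @ ts))"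
  proof (intro arg_cong[where f = sum_list] map_cong refl, clarify)
    fix us ws assume "(us, ws) \<in> set (splits cs)"
    then have "set ws \<subseteq> H 1" using set_splits Suc.prems by blast
    then show "prod_list us * hopf_power \<Delta> (Suc a) (prod_list ws) = (\<Sum>ts\<leftarrow>riffle a ws. prod_list (us @ ts))"
      by (simp add: Suc.IH sum_list_const_mult)
  qed
  also have "\<dots> = (\<Sum>ts\<leftarrow>riffle (Suc a) cs. prod_list ts)"
    by (simp add: sum_list_concat_map split_def o_def)
  finally show ?case .
qed (simp add: hopf_power_1)

text \<open>The sum runs over permutations rather than distinct rearrangements, as in
  \<open>chain_distribution\<close>; with repeated letters each rearrangement occurs several
  times.\<close>

definition sym_prod :: "'h list \<Rightarrow> 'h" where
  "sym_prod cs = (\<Sum>\<sigma> | \<sigma> permutes {..<length cs}. prod_list (permute_list \<sigma> cs))"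

text \<open>Shuffling positions instead of letters makes each outcome \<open>l\<close> one
  permutation \<open>\<tau>\<close>, independent of \<open>\<sigma>\<close> even when letters
  repeat; reindexing the sum over \<open>\<sigma>\<close> absorbs it.\<close>

lemma sum_permuted_word:
  assumes "l \<in> set (riffle a [0..<length cs])"
  shows "(\<Sum>\<sigma> | \<sigma> permutes {..<length cs}. prod_list (map (\<lambda>i. cs ! \<sigma> i) l)) = sym_prod cs"
proof -
  let ?n = "length cs"
  obtain \<tau> where \<tau>: "\<tau> permutes {..<?n}" "permute_list \<tau> [0..<?n] = l"
    using mset_upt_permute_list[OF mset_riffle[OF assms]] by blast
  have "map (\<lambda>i. cs ! \<sigma> i) l = permute_list (\<sigma> \<circ> \<tau>) cs" if "\<sigma> permutes {..<?n}" for \<sigma>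
  proof -
    have "map (\<lambda>i. cs ! \<sigma> i) l = permute_list \<tau> (map (\<lambda>i. cs ! \<sigma> i) [0..<?n])"
      using \<tau> permute_list_map[of \<tau> "[0..<?n]" "\<lambda>i. cs ! \<sigma> i"] by simp
    also have "\<dots> = permute_list \<tau> (permute_list \<sigma> cs)" by (simp add: permute_list_def)
    also have "\<dots> = permute_list (\<sigma> \<circ> \<tau>) cs" using \<tau>(1) by (simp add: permute_list_compose)
    finally show ?thesis .
  qed
  then have "(\<Sum>\<sigma> | \<sigma> permutes {..<?n}. prod_list (map (\<lambda>i. cs ! \<sigma> i) l))
    = (\<Sum>\<sigma> | \<sigma> permutes {..<?n}. prod_list (permute_list (\<sigma> \<circ> \<tau>) cs))"
    by (intro sum.cong) auto
  also have "\<dots> = sym_prod cs"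
    unfolding sym_prod_def
    by (rule sum_permutations_compose_right[OF \<tau>(1), symmetric, of "\<lambda>\<sigma>. prod_list (permute_list \<sigma> cs)"])
  finally show ?thesis .
qed

text \<open>Every shuffle outcome contributes one full copy of \<open>sym_prod cs\<close>, so the
  eigenvalue is the number of outcomes.\<close>

lemma hopf_power_sym_prod:
  assumes "set cs \<subseteq> H 1"
  shows "hopf_power \<Delta> (Suc a) (sym_prod cs) = real (Suc a) ^ length cs *\<^sub>R sym_prod cs"
proof -
  let ?n = "length cs" and ?R = "riffle a [0..<length cs]"
  have p: "permute_list \<sigma> cs = map (\<lambda>i. cs ! \<sigma> i) [0..<?n]" for \<sigma>
    by (simp add: permute_list_def)
  have "hopf_power \<Delta> (Suc a) (sym_prod cs)
    = (\<Sum>\<sigma> | \<sigma> permutes {..<?n}. hopf_power \<Delta> (Suc a) (prod_list (permute_list \<sigma> cs)))"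
    unfolding sym_prod_def by (rule linear_sum[OF linear_hopf_power])
  also have "\<dots> = (\<Sum>\<sigma> | \<sigma> permutes {..<?n}. \<Sum>l\<leftarrow>?R. prod_list (map (\<lambda>i. cs ! \<sigma> i) l))"
  proof (intro sum.cong refl)
    fix \<sigma> assume "\<sigma> \<in> {\<sigma>. \<sigma> permutes {..<?n}}"
    then have "set (permute_list \<sigma> cs) \<subseteq> H 1" using assms by simp
    then show "hopf_power \<Delta> (Suc a) (prod_list (permute_list \<sigma> cs)) = (\<Sum>l\<leftarrow>?R. prod_list (map (\<lambda>i. cs ! \<sigma> i) l))"
      using hopf_power_word[OF \<open>set (permute_list \<sigma> cs) \<subseteq> H 1\<close>, of a] by (simp add: p riffle_map o_def)
  qed
  also have "\<dots> = (\<Sum>l\<leftarrow>?R. \<Sum>\<sigma> | \<sigma> permutes {..<?n}. prod_list (map (\<lambda>i. cs ! \<sigma> i) l))"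
  proof -
    have "(\<Sum>\<sigma>\<in>S. \<Sum>l\<leftarrow>L. f \<sigma> l) = (\<Sum>l\<leftarrow>L. \<Sum>\<sigma>\<in>S. f \<sigma> l)"
      for S :: "(nat \<Rightarrow> nat) set" and L :: "nat list list" and f :: "(nat \<Rightarrow> nat) \<Rightarrow> nat list \<Rightarrow> 'h"
      by (induction L) (simp_all add: sum.distrib)
    then show ?thesis .
  qed
  also have "\<dots> = (\<Sum>l\<leftarrow>?R. sym_prod cs)"
    by (intro arg_cong[where f = sum_list] map_cong) (auto simp: sum_permuted_word)
  also have "\<dots> = real (length ?R) *\<^sub>R sym_prod cs"
    by (simp add: sum_list_triv scaleR_conv_of_real)
  finally show ?thesis by (simp add: length_riffle)
qed

end

context based_hopf_algebra
begin

lemma prod_list_homogeneous: "set cs \<subseteq> H 1 \<Longrightarrow> prod_list cs \<in> H (length cs)"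
proof (induction cs)
  case Nil
  then show ?case using B_in_H[OF one_in_B] by simp
next
  case (Cons c cs)
  then show ?case using mult_graded[of c 1 "prod_list cs" "length cs"] by simp
qed

lemma sym_prod_homogeneous: "set cs \<subseteq> H 1 \<Longrightarrow> sym_prod cs \<in> H (length cs)"
  unfolding sym_prod_def
proof (intro subspace_sum subspace_H)
  fix \<sigma> assume "set cs \<subseteq> H 1" "\<sigma> \<in> {\<sigma>. \<sigma> permutes {..<length cs}}"
  then show "prod_list (permute_list \<sigma> cs) \<in> H (length cs)"
    using prod_list_homogeneous[of "permute_list \<sigma> cs"] by simp
qed

text \<open>The product of the factorials of the multiplicities in \<open>M\<close>, that is, the
  number of permutations that fix a word with these letters.\<close>

definition mfact :: "'h multiset \<Rightarrow> real" where
  "mfact M = fact (size M) / real (card (permutations_of_multiset M))"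

lemma card_permutations_pos: "card (permutations_of_multiset M) > 0"
  by (simp add: card_gt_0_iff permutations_of_multiset_nonempty permutations_of_multiset_not_empty)

lemma mfact_pos: "mfact M > 0"
  by (simp add: mfact_def card_permutations_pos)

lemma mfact_remove:
  assumes "y \<in># M"
  shows "real (count M y) * mfact (M - {#y#}) = mfact M"
proof -
  have s: "size M > 0" using assms by (cases M) auto
  obtain k where k: "count M y = k" "k \<noteq> 0" using assms by simp
  then show ?thesis
    using s card_permutations_pos[of M] fact_reduce[OF s, where 'a = real]
    by (simp add: mfact_def real_card_permutations_of_multiset_remove[OF assms] size_Diff_singleton[OF assms] field_simps)
qed

text \<open>Peeling off the first letter \<open>y\<close>, only splits whose left part is
  \<open>[y]\<close> survive, and there are as many of these as occurrences of \<open>y\<close> in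
  \<open>cs\<close>. The counts multiply up to the product of the multiplicity factorials.\<close>

lemma E_word:
  assumes "set ys \<subseteq> B 1" "set cs \<subseteq> B 1"
  shows "E ys (prod_list cs) = (if mset ys = mset cs then mfact (mset cs) else 0)"
  using assms
proof (induction ys arbitrary: cs)
  case Nil
  show ?case
  proof (cases "cs = []")
    case False
    then have "counit (prod_list cs) = 0"
      using Nil B_in_H by (intro counit_homogeneous[OF prod_list_homogeneous]) auto
    with False show ?thesis by simp
  qed (simp add: counit_1 mfact_def)
next
  case (Cons y ys)
  have cs: "set cs \<subseteq> H 1" using Cons.prems B_in_H by auto
  have ey: "e y (prod_list us) = (if us = [y] then 1 else 0)" if "set us \<subseteq> B 1" for us
  proof (cases "length us = 1")
    case True
    then obtain c where "us = [c]" by (auto simp: length_Suc_conv)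
    then show ?thesis using that e_basis[OF in_basis] by auto
  next
    case False
    moreover have "prod_list us \<in> H (length us)" using that B_in_H by (intro prod_list_homogeneous) auto
    ultimately show ?thesis using e_homogeneous_zero[of _ "length us" y 1] Cons.prems by auto
  qed
  let ?f = "if mset ys = mset cs - {#y#} then mfact (mset cs - {#y#}) else 0"
  have "E (y # ys) (prod_list cs) = (\<Sum>(us, ws)\<leftarrow>splits cs. e y (prod_list us) * E ys (prod_list ws))"
    unfolding E.simps conv_def by (rule sw_word[OF cs bilinear_times[OF linear_e linear_E]])
  also have "\<dots> = (\<Sum>(us, ws)\<leftarrow>splits cs. real (if us = [y] then 1 else 0) * ?f)"
  proof (intro arg_cong[where f = sum_list] map_cong refl, clarify)
    fix us ws assume s: "(us, ws) \<in> set (splits cs)"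
    then have "set us \<subseteq> B 1" "set ws \<subseteq> B 1" using set_splits Cons.prems by blast+
    moreover have "mset ws = mset cs - {#y#}" if "us = [y]"
      using mset_splits[OF s] that by (simp flip: \<open>mset us + mset ws = mset cs\<close>)
    ultimately show "e y (prod_list us) * E ys (prod_list ws) = real (if us = [y] then 1 else 0) * ?f"
      using Cons.IH[of ws] Cons.prems ey by auto
  qed
  also have "\<dots> = real (\<Sum>(us, ws)\<leftarrow>splits cs. if us = [y] then 1 else 0) * ?f"
  proof -
    have "real (\<Sum>x\<leftarrow>L. if fst x = [y] then 1 else 0) = (\<Sum>x\<leftarrow>L. real (if fst x = [y] then 1 else 0))"
      for L :: "('h list \<times> 'h list) list" by (induction L) auto
    then show ?thesis unfolding split_def by (simp only: sum_list_mult_const)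
  qed
  also have "\<dots> = real (count (mset cs) y) * ?f" by (simp only: count_splits_single)
  also have "\<dots> = (if mset (y # ys) = mset cs then mfact (mset cs) else 0)"
  proof (cases "y \<in># mset cs")
    case True
    then have "mset ys = mset cs - {#y#} \<longleftrightarrow> mset (y # ys) = mset cs"
      by (metis add_mset_remove_trivial insert_DiffM mset.simps(2))
    then show ?thesis using mfact_remove[OF True] by auto
  next
    case False
    then have "count (mset cs) y = 0" by (simp add: not_in_iff)
    moreover have "mset (y # ys) \<noteq> mset cs" using False by (metis list.set_intros(1) set_mset_mset)
    ultimately show ?thesis by simp
  qed
  finally show ?case .
qed

lemma E_sym_prod:
  assumes "set ys \<subseteq> B 1" "set cs \<subseteq> B 1"
  shows "E ys (sym_prod cs) = (if mset ys = mset cs then fact (length cs) * mfact (mset cs) else 0)"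
proof -
  have "E ys (sym_prod cs) = (\<Sum>\<sigma> | \<sigma> permutes {..<length cs}. E ys (prod_list (permute_list \<sigma> cs)))"
    unfolding sym_prod_def by (rule linear_sum[OF linear_E])
  also have "\<dots> = (\<Sum>\<sigma> | \<sigma> permutes {..<length cs}. if mset ys = mset cs then mfact (mset cs) else 0)"
    by (intro sum.cong refl) (use assms in \<open>simp add: E_word\<close>)
  also have "\<dots> = fact (length cs) * (if mset ys = mset cs then mfact (mset cs) else 0)"
    using card_permutations[of "{..<length cs}" "length cs"] by simp
  finally show ?thesis by simp
qed

definition words :: "nat \<Rightarrow> 'h list set" where
  "words n = {cs. set cs \<subseteq> B 1 \<and> length cs = n}"

lemma finite_words: "finite (words n)"
  unfolding words_def by (rule finite_lists_length_eq[OF finite_B])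

text \<open>The origin of the normalising constant: \<open>cs\<close> has
  \<open>n! / mfact (mset cs)\<close> rearrangements, the value on each is
  \<open>n! * mfact (mset cs)\<close>, and other words contribute nothing.\<close>

lemma sum_words_sym_prod:
  assumes "cs \<in> words n"
  shows "(\<Sum>ys\<in>words n. E ys (sym_prod cs)) = (fact n)\<^sup>2"
proof -
  have sub: "permutations_of_multiset (mset cs) \<subseteq> words n"
    using assms by (auto simp: words_def permutations_of_multiset_def dest: mset_eq_setD mset_eq_length)
  have "(\<Sum>ys\<in>words n. E ys (sym_prod cs)) = (\<Sum>ys\<in>permutations_of_multiset (mset cs). fact n * mfact (mset cs))"
  proof (rule sum.mono_neutral_cong_right[OF finite_words sub])
    show "\<forall>ys\<in>words n - permutations_of_multiset (mset cs). E ys (sym_prod cs) = 0"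
      using assms by (auto simp: words_def E_sym_prod permutations_of_multiset_def)
    fix ys assume ys: "ys \<in> permutations_of_multiset (mset cs)"
    then have "ys \<in> words n" using sub by blast
    with ys show "E ys (sym_prod cs) = fact n * mfact (mset cs)"
      using assms by (simp add: words_def E_sym_prod permutations_of_multiset_def)
  qed
  also have "\<dots> = fact n * fact n"
    using card_permutations_pos[of "mset cs"] assms by (simp add: mfact_def words_def)
  finally show ?thesis by (simp add: power2_eq_square)
qed

section \<open>Eigenvectors and their values on words\<close>

lemma eigen_expansion:
  assumes v: "hopf_power \<Delta> (Suc a) v = real (Suc a) ^ n *\<^sub>R v"
    and ys: "set ys \<subseteq> pos_basis"
    and longer: "\<And>ts. set ts \<subseteq> pos_basis \<Longrightarrow> length ts > length ys \<Longrightarrow> E ts v = 0"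
  shows "real (Suc a) ^ n * E ys v = (\<Sum>ts\<leftarrow>riffle a ys. E ts v)"
proof -
  obtain R where R: "\<forall>(c, ts)\<in>set R. set ts \<subseteq> pos_basis \<and> length ts > length ys"
    "E ys (hopf_power \<Delta> (Suc a) v) = (\<Sum>ts\<leftarrow>riffle a ys. E ts v) + (\<Sum>(c, ts)\<leftarrow>R. c * E ts v)"
    using E_hopf_power[OF ys, of a] by blast
  have "(\<Sum>(c, ts)\<leftarrow>R. c * E ts v) = (\<Sum>x\<leftarrow>R. 0)"
    by (intro arg_cong[where f = sum_list] map_cong) (use R(1) longer in auto)
  with R(2) show ?thesis by (simp add: v linear_scale[OF linear_E])
qed

text \<open>Maximum principle: \<open>ts \<mapsto> E ts v\<close> is harmonic for the inverse riffle shuffle, which can move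
  any letter to the front and hence connects all rearrangements of a word.\<close>

lemma eigen_symmetric:
  assumes v: "v \<in> H n" "hopf_power \<Delta> (Suc (Suc a)) v = real (Suc (Suc a)) ^ n *\<^sub>R v"
    and ys: "set ys \<subseteq> pos_basis" "length ys = n" and zs: "mset zs = mset ys"
  shows "E zs v = E ys v"
proof -
  let ?S = "permutations_of_multiset (mset ys)"
  define m where "m = Max ((\<lambda>ts. E ts v) ` ?S)"
  have le: "E ts v \<le> m" if "mset ts = mset ys" for ts
    unfolding m_def using that by (intro Max_ge finite_imageI finite_permutations_of_multiset imageI)
      (simp add: permutations_of_multiset_def)
  have "m \<in> (\<lambda>ts. E ts v) ` ?S"
    unfolding m_def by (intro Max_in) (auto simp: permutations_of_multiset_not_empty)
  then obtain xs where xs: "mset xs = mset ys" "E xs v = m" by (auto simp: permutations_of_multiset_def)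
  have all: "E ts v = m" if "mset ts = mset ys" for ts
  proof -
    have "mset ts = mset ys \<and> E ts v = m"
    proof (rule mset_induct_move_front[of xs ts "\<lambda>ts. mset ts = mset ys \<and> E ts v = m"])
      fix us y ws
      assume *: "mset (us @ y # ws) = mset ys \<and> E (us @ y # ws) v = m"
      let ?w = "us @ y # ws"
      have w: "set ?w \<subseteq> pos_basis" "length ?w = n"
        using * ys by (metis mset_eq_setD, metis mset_eq_length)
      have "real (Suc (Suc a)) ^ n * E ?w v = (\<Sum>ts\<leftarrow>riffle (Suc a) ?w. E ts v)"
      proof (rule eigen_expansion[OF v(2) w(1)])
        fix ts assume "set ts \<subseteq> pos_basis" "length ts > length ?w"
        then show "E ts v = 0" using E_degree[OF v(1), of ts] w(2) by auto
      qed
      \<comment> \<open>The eigenvalue equals the number of shuffle outcomes, so the maximum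
        \<open>m\<close> is the mean of the values at the outcomes; as none exceeds
        \<open>m\<close>, all are equal to it.\<close>
      then have "(\<Sum>ts\<leftarrow>riffle (Suc a) ?w. E ts v) = real (length (riffle (Suc a) ?w)) * m"
        unfolding length_riffle w(2) using * by simp
      \<comment> \<open>This needs a second pack, whence the exponent \<open>Suc (Suc a)\<close> in
        the statement.\<close>
      moreover have "y # us @ ws \<in> set (riffle (Suc a) ?w)"
        using append_in_riffle[OF splits_single[of y us ws], of a] by simp
      moreover have "E ts v \<le> m" if "ts \<in> set (riffle (Suc a) ?w)" for ts
        using mset_riffle[OF that] le * by simp
      ultimately have "E (y # us @ ws) v = m"
        by (intro sum_list_eq_bound_imp_eq[of "riffle (Suc a) ?w" "\<lambda>ts. E ts v"]) auto
      then show "mset (y # us @ ws) = mset ys \<and> E (y # us @ ws) v = m" using * by simp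
    qed (use xs that in auto)
    then show ?thesis by blast
  qed
  show ?thesis using all zs by simp
qed

text \<open>A nonzero eigenvector killed by all words longer than \<open>k\<close> but not by all words of length \<open>k\<close>
  would have eigenvalue at most \<open>(a + 1)\<^sup>k\<close>, the number of shuffles of a word of length \<open>k\<close>.\<close>

lemma eigen_zero:
  assumes v: "v \<in> H n" "hopf_power \<Delta> (Suc a) v = real (Suc a) ^ n *\<^sub>R v" and a: "a \<ge> 1" and n: "n \<ge> 1"
    and top: "\<And>ys. set ys \<subseteq> B 1 \<Longrightarrow> length ys = n \<Longrightarrow> E ys v = 0"
  shows "v = 0"
proof -
  \<comment> \<open>\<open>d\<close> bounds how far the length falls short of \<open>n\<close>; the
    induction descends from the longest words.\<close>
  have zero: "E ys v = 0" if "set ys \<subseteq> pos_basis" "length ys + d \<ge> n" for ys d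
    using that
  proof (induction d arbitrary: ys)
    case 0
    then show ?case using E_degree[OF v(1) 0(1)] top by fastforce
  next
    case (Suc d)
    show ?case
    proof (cases "length ys + d \<ge> n")
      case False
      let ?S = "permutations_of_multiset (mset ys)" and ?k = "length ys"
      define m where "m = Max ((\<lambda>ts. \<bar>E ts v\<bar>) ` ?S)"
      have le: "\<bar>E ts v\<bar> \<le> m" if "mset ts = mset ys" for ts
        unfolding m_def using that by (intro Max_ge finite_imageI finite_permutations_of_multiset imageI)
      (simp add: permutations_of_multiset_def)
      have "m \<in> (\<lambda>ts. \<bar>E ts v\<bar>) ` ?S"
        unfolding m_def by (intro Max_in) (auto simp: permutations_of_multiset_not_empty)
      then obtain xs where xs: "mset xs = mset ys" "\<bar>E xs v\<bar> = m" by (auto simp: permutations_of_multiset_def)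
      have w: "set xs \<subseteq> pos_basis" "length xs = ?k"
        using xs Suc.prems by (metis mset_eq_setD, metis mset_eq_length)
      have "real (Suc a) ^ n * E xs v = (\<Sum>ts\<leftarrow>riffle a xs. E ts v)"
        using Suc.IH False Suc.prems w by (intro eigen_expansion[OF v(2) w(1)]) auto
      then have "real (Suc a) ^ n * m = \<bar>\<Sum>ts\<leftarrow>riffle a xs. E ts v\<bar>"
        using xs(2) by (metis abs_mult abs_of_nonneg of_nat_0_le_iff zero_le_power)
      also have "\<dots> \<le> (\<Sum>ts\<leftarrow>riffle a xs. \<bar>E ts v\<bar>)"
        using sum_list_abs[of "map (\<lambda>ts. E ts v) (riffle a xs)"] by (simp add: o_def)
      also have "\<dots> \<le> (\<Sum>ts\<leftarrow>riffle a xs. m)"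
        by (rule sum_list_mono) (use le mset_riffle xs(1) in metis)
      also have "\<dots> = real (Suc a) ^ ?k * m"
        by (simp add: sum_list_triv length_riffle w(2))
      finally have "(real (Suc a) ^ n - real (Suc a) ^ ?k) * m \<le> 0" by (simp add: algebra_simps)
      \<comment> \<open>The number of outcomes on \<open>?k\<close> letters is strictly below the
        eigenvalue because \<open>?k < n\<close> and the base exceeds one.\<close>
      moreover have "real (Suc a) ^ ?k < real (Suc a) ^ n"
        using a False by (intro power_strict_increasing) auto
      moreover have "m \<ge> 0" using xs(2) by auto
      ultimately have "m = 0" by (simp add: mult_le_0_iff)
      then show ?thesis using le[of ys] by simp
    qed (use Suc in blast)
  qed
  \<comment> \<open>One-letter words with a letter from \<open>B n\<close> are the coordinates of
    \<open>v\<close>; their deficit is \<open>n - 1\<close>.\<close>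
  have "e x v = 0" if "x \<in> B n" for x
    using zero[of "[x]" "n - 1"] that n pos_basisI[OF that] by (simp add: counit_right linear_e)
  then show "v = 0" using expand_homogeneous[OF v(1)] by simp
qed

end

section \<open>The Markov chain\<close>

lemma linear_scaleR_left: "linear f \<Longrightarrow> linear (\<lambda>x. f x *\<^sub>R b)"
  by (auto intro!: linearI simp: linear_add linear_scale scaleR_add_left)

context graded_connected_hopf_algebra
begin

lemma sw_sum: "sw (\<lambda>u w. \<Sum>i\<in>I. \<beta> i u w) x = (\<Sum>i\<in>I. sw (\<beta> i) x)"
  by (induction I rule: infinite_finite_induct) (simp_all add: sw_zero sw_add)

lemma sw_scaleR_left: "sw (\<lambda>u w. f u w *\<^sub>R b) x = sw f x *\<^sub>R b"
  by (auto simp: sw_def tensor_lift_def free_lift_def on_pairs_def scaleR_sum_left intro!: sum.cong)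

lemma bilinear_pure: "bilinear (\<lambda>u w. pure_tensor [u, w])"
  using linear_pure_at[of "[_]" "[]"] linear_pure_at[of "[]" "[_]"] by (intro bilinearI) auto

lemma sw_pure: "sw (\<lambda>u w. pure_tensor [u, w]) x = \<Delta> x"
  by (simp add: sw_eq_sum_list bilinear_pure flip: comult_sweedler)

end

context based_hopf_algebra
begin

lemma E_pair: "E [w, z] = conv (e w) (e z)"
  by (simp add: counit_right linear_e)

text \<open>The full basis may be infinite, so the expansion \<open>\<gamma>\<close> of
  \<open>\<beta>\<close> is truncated to degrees adding up to \<open>n\<close>. It agrees with
  \<open>\<beta>\<close> on all pairs of factors that can occur in \<open>\<Delta> x\<close>, and
  \<open>sw\<close> does not see the difference.\<close>

lemma sw_expand:
  assumes \<beta>: "bilinear \<beta>" and x: "x \<in> H n"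
  shows "sw \<beta> x = (\<Sum>i\<le>n. \<Sum>w\<in>B i. \<Sum>z\<in>B (n - i). E [w, z] x *\<^sub>R \<beta> w z)"
proof -
  define \<gamma> where "\<gamma> u v = (\<Sum>i\<le>n. \<Sum>w\<in>B i. \<Sum>z\<in>B (n - i). (e w u * e z v) *\<^sub>R \<beta> w z)" for u v
  have b: "bilinear (\<lambda>u v. (e w u * e z v) *\<^sub>R \<beta> w z)" for w z
    by (intro bilinearI linear_scaleR_left linear_compose[OF linear_e linear_mult_left, unfolded o_def]
        linear_compose[OF linear_e linear_mult_right, unfolded o_def])
  have bil: "bilinear (\<lambda>u v. \<beta> u v - \<gamma> u v)"
    using \<beta> unfolding \<gamma>_def
    by (auto simp: bilinear_def intro!: linear_compose_sub linear_compose_sum b[unfolded bilinear_def, THEN conjunct1, rule_format]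
        b[unfolded bilinear_def, THEN conjunct2, rule_format])
  have eq: "\<beta> u v = \<gamma> u v" if "j \<le> n" "u \<in> H j" "v \<in> H (n - j)" for u v j
  proof -
    have l: "linear (\<beta> w)" "linear (\<lambda>u. \<beta> u w)" for w using \<beta> by (auto simp: bilinear_def)
    have "\<beta> u v = (\<Sum>w\<in>B j. e w u *\<^sub>R \<beta> w v)" by (rule linear_homogeneous[OF l(2) that(2)])
    also have "\<dots> = (\<Sum>w\<in>B j. \<Sum>z\<in>B (n - j). (e w u * e z v) *\<^sub>R \<beta> w z)"
      by (subst linear_homogeneous[OF l(1) that(3)]) (simp add: scaleR_sum_right)
    also have "\<dots> = \<gamma> u v"
    proof -
      have "(\<Sum>w\<in>B i. \<Sum>z\<in>B (n - i). (e w u * e z v) *\<^sub>R \<beta> w z) = 0" if "i \<noteq> j" for i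
        using e_homogeneous_zero[OF \<open>u \<in> H j\<close> _ that] by simp
      then show ?thesis unfolding \<gamma>_def using that(1)
        by (intro sum.mono_neutral_cong_right[of "{..n}" "{j}", symmetric, simplified] ) auto
    qed
    finally show ?thesis .
  qed
  have "sw \<beta> x = sw (\<lambda>u v. (\<beta> u v - \<gamma> u v) + \<gamma> u v) x" by simp
  also have "\<dots> = sw (\<lambda>u v. \<beta> u v - \<gamma> u v) x + sw \<gamma> x" by (rule sw_add)
  also have "sw (\<lambda>u v. \<beta> u v - \<gamma> u v) x = 0"
    by (rule sw_homogeneous_zero[OF bil x]) (simp add: eq)
  also have "sw \<gamma> x = (\<Sum>i\<le>n. \<Sum>w\<in>B i. \<Sum>z\<in>B (n - i). E [w, z] x *\<^sub>R \<beta> w z)"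
    unfolding \<gamma>_def sw_sum sw_scaleR_left E_pair conv_def ..
  finally show ?thesis by simp
qed

lemma eq_homogeneousI: "v \<in> H n \<Longrightarrow> w \<in> H n \<Longrightarrow> (\<And>y. y \<in> B n \<Longrightarrow> e y v = e y w) \<Longrightarrow> v = w"
  using expand_homogeneous[of v n] expand_homogeneous[of w n] by (metis (no_types, lifting) sum.cong)

lemma hopf_power_homogeneous: "v \<in> H n \<Longrightarrow> hopf_power \<Delta> (Suc a) v \<in> H n"
proof (induction a arbitrary: v n)
  case (Suc a)
  show ?case unfolding hopf_power_Suc
  proof (rule sw_in_subspace[OF bilinear_mult_hopf_power comult_graded_pairs[OF Suc.prems] subspace_H])
    fix u w assume "\<exists>j\<le>n. u \<in> H j \<and> w \<in> H (n - j)"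
    then obtain j where "j \<le> n" "u \<in> H j" "w \<in> H (n - j)" by blast
    then show "u * hopf_power \<Delta> (Suc a) w \<in> H n"
      using mult_graded[of u j "hopf_power \<Delta> (Suc a) w" "n - j"] Suc.IH by simp
  qed
qed (simp add: hopf_power_1)

definition eta :: "nat \<Rightarrow> 'h \<Rightarrow> real" where
  "eta n v = (\<Sum>cs\<in>words n. E cs v)"

lemma linear_eta: "linear (eta n)"
  unfolding eta_def[abs_def] by (intro linear_compose_sum ballI linear_E)

lemma words_basis: "cs \<in> words n \<Longrightarrow> set cs \<subseteq> basis"
  using B_subset unfolding words_def by blast

lemma words_H: "cs \<in> words n \<Longrightarrow> set cs \<subseteq> H 1"
  using B_in_H unfolding words_def by blast

lemma rescaling_eq: "n \<ge> 1 \<Longrightarrow> rescaling B \<Delta> n x = eta n x"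
  unfolding rescaling_def eta_def words_def
  by (intro sum.cong refl coproduct_coeff_eq) (use B_subset in auto)

text \<open>Stationarity without nonnegativity and normalisation: a linear condition, so it applies
  to arbitrary linear combinations.\<close>

definition balanced :: "nat \<Rightarrow> nat \<Rightarrow> ('h \<Rightarrow> real) \<Rightarrow> bool" where
  "balanced a n p \<longleftrightarrow> (\<forall>y\<in>B n. (\<Sum>x\<in>B n. p x * hopf_power_chain B \<Delta> a n x y) = p y)"

text \<open>Dividing by \<open>eta n x\<close> reverses the rescaling (a Doob transform) that turns
  the Hopf power into the chain.\<close>

definition dist_vec :: "nat \<Rightarrow> ('h \<Rightarrow> real) \<Rightarrow> 'h" where
  "dist_vec n p = (\<Sum>x\<in>B n. (p x / eta n x) *\<^sub>R x)"

lemma dist_vec_homogeneous: "dist_vec n p \<in> H n"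
  unfolding dist_vec_def by (intro subspace_sum subspace_scale subspace_H B_in_H)

lemma linear_dist_vec: "linear F \<Longrightarrow> F (dist_vec n p) = (\<Sum>x\<in>B n. (p x / eta n x) *\<^sub>R F x)"
  by (simp add: dist_vec_def linear_sum linear_scale)

lemma chain_eq:
  "n \<ge> 1 \<Longrightarrow> hopf_power_chain B \<Delta> a n x y = eta n y / eta n x * (e y (hopf_power \<Delta> a x) / real a ^ n)"
  by (simp add: hopf_power_chain_def rescaling_eq flip: e_def) (simp add: linear_scale[OF linear_e])

lemma chain_distribution_eq:
  assumes "n \<ge> 1" "cs \<in> words n"
  shows "chain_distribution B \<Delta> cs x = eta n x / (fact n)\<^sup>2 * e x (sym_prod cs)"
  using assms by (simp add: chain_distribution_def words_def rescaling_eq product_coeff_def sym_prod_def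
      linear_sum[OF linear_e] flip: e_def)

end

section \<open>Positivity on a state space basis\<close>

locale state_space = based_hopf_algebra H \<Delta> B
  for H :: "nat \<Rightarrow> 'h::real_algebra_1 set" and \<Delta> and B +
  assumes state_space: "state_space_basis H \<Delta> B"
begin

lemma E_pair_nonneg: "x \<in> basis \<Longrightarrow> w \<in> basis \<Longrightarrow> z \<in> basis \<Longrightarrow> E [w, z] x \<ge> 0"
proof -
  assume *: "x \<in> basis" "w \<in> basis" "z \<in> basis"
  then have "coproduct_coeff B \<Delta> x [w, z] \<ge> 0"
    using state_space unfolding state_space_basis_def by blast
  then show ?thesis using coproduct_coeff_eq[of "[w, z]" x] * by simp
qed

lemma e_mult_nonneg: "y \<in> basis \<Longrightarrow> w \<in> basis \<Longrightarrow> z \<in> basis \<Longrightarrow> e y (w * z) \<ge> 0"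
  using state_space unfolding state_space_basis_def product_coeff_def e_def by simp

text \<open>Only the twofold coproduct constants are assumed nonnegative; longer words follow by
  expanding one coproduct at a time.\<close>

lemma E_nonneg: "x \<in> B n \<Longrightarrow> set ys \<subseteq> basis \<Longrightarrow> E ys x \<ge> 0"
proof (induction ys arbitrary: x n)
  case Nil
  then show ?case by (simp add: counit_def e_basis in_basis)
next
  case (Cons y ys)
  have "E (y # ys) x = (\<Sum>i\<le>n. \<Sum>w\<in>B i. \<Sum>z\<in>B (n - i). E [w, z] x * (e y w * E ys z))"
    unfolding E.simps(2)[of y ys] conv_def
    using sw_expand[OF bilinear_times[OF linear_e linear_E] B_in_H[OF Cons.prems(1)]] by simp
  also have "\<dots> \<ge> 0"
    using Cons E_pair_nonneg in_basis by (intro sum_nonneg mult_nonneg_nonneg) (auto simp: e_basis)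
  finally show ?case .
qed

text \<open>Nonnegativity is assumed for products of two basis elements; here the tail of the word
  is expanded in the basis before the next letter is multiplied on.\<close>

lemma e_word_nonneg:
  assumes "y \<in> basis" "cs \<in> words n"
  shows "e y (prod_list cs) \<ge> 0"
  using assms
proof (induction cs arbitrary: y n)
  case Nil
  then show ?case using e_basis[OF in_basis[OF one_in_B]] by simp
next
  case (Cons c cs)
  have cs: "c \<in> B 1" "cs \<in> words (length cs)" using Cons.prems by (auto simp: words_def)
  have "linear (\<lambda>x. e y (c * x))"
    using linear_compose[OF linear_mult_right linear_e] by (simp add: o_def)
  from linear_homogeneous[OF this prod_list_homogeneous[OF words_H[OF cs(2)]]]
  have "e y (prod_list (c # cs)) = (\<Sum>x\<in>B (length cs). e x (prod_list cs) * e y (c * x))" by simp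
  also have "\<dots> \<ge> 0"
    using Cons.IH[OF _ cs(2)] Cons.prems cs(1) in_basis
    by (intro sum_nonneg mult_nonneg_nonneg e_mult_nonneg) auto
  finally show ?case .
qed

text \<open>Otherwise all inner terms of the coproduct vanish and only \<open>1 \<otimes> x\<close>
  and \<open>x \<otimes> 1\<close> remain, so \<open>x\<close> would be primitive of degree above
  one, which a state space basis excludes.\<close>

lemma reducible:
  assumes x: "x \<in> B n" and n: "n > 1"
  shows "\<exists>i w z. 1 \<le> i \<and> i < n \<and> w \<in> B i \<and> z \<in> B (n - i) \<and> E [w, z] x > 0"
proof (rule ccontr)
  assume "\<not> ?thesis"
  then have z: "E [w, z] x = 0" if "1 \<le> i" "i < n" "w \<in> B i" "z \<in> B (n - i)" for i w z
    using E_pair_nonneg[of x w z] that x in_basis by fastforce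
  let ?S = "\<lambda>i. \<Sum>w\<in>B i. \<Sum>z\<in>B (n - i). E [w, z] x *\<^sub>R pure_tensor [w, z]"
  have l: "linear (\<lambda>z. pure_tensor [1, z])" "linear (\<lambda>z. pure_tensor [z, 1])"
    using bilinear_pure by (auto simp: bilinear_def)
  have E1: "E [1, z] = e z" "E [z, 1] = e z" for z
    unfolding E_pair counit_def[symmetric] by (simp_all add: counit_left counit_right linear_e)
  have "\<Delta> x = sw (\<lambda>u w. pure_tensor [u, w]) x" by (rule sw_pure[symmetric])
  also have "\<dots> = (\<Sum>i\<le>n. ?S i)" by (rule sw_expand[OF bilinear_pure B_in_H[OF x]])
  also have "\<dots> = (\<Sum>i\<in>{0, n}. ?S i)"
  proof (intro sum.mono_neutral_right ballI)
    fix i assume "i \<in> {..n} - {0, n}"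
    then show "?S i = 0" using z[of i] by (intro sum.neutral ballI) auto
  qed auto
  also have "\<dots> = ?S 0 + ?S n" using n by simp
  also have "?S 0 = pure_tensor [1, x]"
    using linear_homogeneous[OF l(1) B_in_H[OF x]] by (simp add: B_0 E1 del: E.simps)
  also have "?S n = pure_tensor [x, 1]"
    using linear_homogeneous[OF l(2) B_in_H[OF x]] by (simp add: B_0 E1 del: E.simps)
  finally show False using state_space x n unfolding state_space_basis_def by blast
qed

text \<open>\<open>x\<close> is broken up by \<open>reducible\<close> until all pieces have degree
  one, and the words of the pieces are concatenated. Nonnegativity prevents the positive term from
  being cancelled.\<close>

lemma word_exists:
  assumes "x \<in> B n" "n \<ge> 1"
  shows "\<exists>cs\<in>words n. E cs x > 0"
  using assms
proof (induction n arbitrary: x rule: less_induct)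
  case (less n)
  show ?case
  proof (cases "n = 1")
    case True
    then have "[x] \<in> words n" "E [x] x > 0"
      using less.prems in_basis by (auto simp: words_def E_single e_basis simp del: E.simps)
    then show ?thesis by blast
  next
    case False
    then obtain i w z where iwz: "1 \<le> i" "i < n" "w \<in> B i" "z \<in> B (n - i)" "E [w, z] x > 0"
      using reducible[OF less.prems(1)] less.prems(2) by auto
    have "\<exists>us\<in>words i. E us w > 0" "\<exists>vs\<in>words (n - i). E vs z > 0"
      using less.IH[of i w] less.IH[of "n - i" z] iwz by simp_all
    then obtain us vs where uv: "us \<in> words i" "E us w > 0" "vs \<in> words (n - i)" "E vs z > 0"
      by blast
    let ?t = "\<lambda>i w z. E [w, z] x * (E us w * E vs z)"
    have nonneg: "?t i w z \<ge> 0" if "w \<in> B i" "z \<in> B j" for i j w z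
      using E_pair_nonneg[OF in_basis[OF less.prems(1)] in_basis[OF that(1)] in_basis[OF that(2)]]
        E_nonneg[OF that(1) words_basis[OF uv(1)]] E_nonneg[OF that(2) words_basis[OF uv(3)]]
      by (intro mult_nonneg_nonneg)
    have "E (us @ vs) x = (\<Sum>i\<le>n. \<Sum>w\<in>B i. \<Sum>z\<in>B (n - i). ?t i w z)"
      unfolding E_append conv_def
      using sw_expand[OF bilinear_times[OF linear_E linear_E] B_in_H[OF less.prems(1)]] by simp
    also have "\<dots> > 0"
    proof (rule sum_pos2[of _ i])
      show "(\<Sum>w\<in>B i. \<Sum>z\<in>B (n - i). ?t i w z) > 0"
      proof (rule sum_pos2[of _ w])
        show "(\<Sum>z\<in>B (n - i). ?t i w z) > 0"
          by (rule sum_pos2[of _ z]) (use iwz uv nonneg finite_B in auto)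
      qed (use iwz nonneg finite_B in \<open>auto intro!: sum_nonneg\<close>)
    qed (use iwz nonneg in \<open>auto intro!: sum_nonneg\<close>)
    finally show ?thesis using uv iwz by (intro bexI[of _ "us @ vs"]) (auto simp: words_def)
  qed
qed

lemma eta_pos:
  assumes "x \<in> B n" "n \<ge> 1"
  shows "eta n x > 0"
proof -
  obtain cs where "cs \<in> words n" "E cs x > 0" using word_exists[OF assms] by blast
  then show ?thesis unfolding eta_def
    using E_nonneg[OF assms(1) words_basis] by (intro sum_pos2[OF finite_words]) auto
qed

lemma e_dist_vec: "x \<in> B n \<Longrightarrow> e x (dist_vec n p) = p x / eta n x"
  unfolding dist_vec_def by (rule e_sum_B)

section \<open>Stationarity as an eigenvector equation\<close>

lemma chain_sum:
  assumes n: "n \<ge> 1" and a: "a \<ge> 1" and y: "y \<in> B n"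
  shows "(\<Sum>x\<in>B n. p x * hopf_power_chain B \<Delta> a n x y)
    = eta n y / real a ^ n * e y (hopf_power \<Delta> a (dist_vec n p))"
  unfolding linear_dist_vec[OF linear_compose[OF linear_hopf_power linear_e, unfolded o_def]]
  by (simp add: chain_eq[OF n] sum_distrib_left mult_ac divide_inverse)

text \<open>Compared coordinate by coordinate in degree \<open>n\<close>: the factors
  \<open>eta n y\<close> are positive and cancel.\<close>

lemma balanced_iff:
  assumes n: "n \<ge> 1" and a: "a \<ge> 1"
  shows "balanced a n p \<longleftrightarrow> hopf_power \<Delta> a (dist_vec n p) = real a ^ n *\<^sub>R dist_vec n p"
proof -
  obtain a' where a': "a = Suc a'" using a by (cases a) auto
  have "balanced a n p \<longleftrightarrow> (\<forall>y\<in>B n. e y (hopf_power \<Delta> a (dist_vec n p)) = e y (real a ^ n *\<^sub>R dist_vec n p))"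
    unfolding balanced_def
  proof (intro ball_cong refl)
    fix y assume y: "y \<in> B n"
    have "eta n y > 0" "real a ^ n > 0" using eta_pos[OF y n] a by auto
    then show "((\<Sum>x\<in>B n. p x * hopf_power_chain B \<Delta> a n x y) = p y) =
      (e y (hopf_power \<Delta> a (dist_vec n p)) = e y (real a ^ n *\<^sub>R dist_vec n p))"
      unfolding chain_sum[OF n a y] linear_scale[OF linear_e] e_dist_vec[OF y]
      by (auto simp: field_simps)
  qed
  also have "\<dots> \<longleftrightarrow> hopf_power \<Delta> a (dist_vec n p) = real a ^ n *\<^sub>R dist_vec n p"
    using eq_homogeneousI[OF hopf_power_homogeneous[OF dist_vec_homogeneous[of n p], of a']
        subspace_scale[OF subspace_H dist_vec_homogeneous[of n p], of "real a ^ n"]]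
    unfolding a' by auto
  finally show ?thesis .
qed

text \<open>The left side is \<open>eta n\<close> applied to the vector, and \<open>eta n\<close>
  cancels the denominators. Normalisation thus becomes a condition on word values.\<close>

lemma sum_dist:
  assumes "n \<ge> 1"
  shows "(\<Sum>ys\<in>words n. E ys (dist_vec n p)) = (\<Sum>x\<in>B n. p x)"
proof -
  have "(\<Sum>ys\<in>words n. E ys (dist_vec n p)) = eta n (dist_vec n p)" by (simp add: eta_def)
  also have "\<dots> = (\<Sum>x\<in>B n. p x)"
    unfolding linear_dist_vec[OF linear_eta]
    by (intro sum.cong) (use eta_pos[OF _ assms] in \<open>fastforce simp: less_le\<close>)+
  finally show ?thesis .
qed

lemma words_pos_basis: "ys \<in> words n \<Longrightarrow> set ys \<subseteq> pos_basis"
  unfolding words_def using pos_basisI[of _ 1] by auto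

lemma balanced_symmetric:
  assumes "n \<ge> 1" "a \<ge> 2" "balanced a n p" "ys \<in> words n" "mset zs = mset ys"
  shows "E zs (dist_vec n p) = E ys (dist_vec n p)"
proof -
  have a: "a = Suc (Suc (a - 2))" using assms(2) by simp
  then obtain a' where a': "a = Suc (Suc a')" by blast
  show ?thesis
  proof (rule eigen_symmetric[OF dist_vec_homogeneous _ words_pos_basis[OF assms(4)] _ assms(5)])
    have "hopf_power \<Delta> a (dist_vec n p) = real a ^ n *\<^sub>R dist_vec n p"
      using balanced_iff[of n a p] assms(1-3) by simp
    then show "hopf_power \<Delta> (Suc (Suc a')) (dist_vec n p) = real (Suc (Suc a')) ^ n *\<^sub>R dist_vec n p"
      by (simp only: a')
  qed (use assms in \<open>simp add: words_def\<close>)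
qed

text \<open>The difference of the two vectors is an eigenvector that vanishes on all words of length
  \<open>n\<close> in \<open>B 1\<close>, so \<open>eigen_zero\<close> applies.\<close>

lemma balanced_determined:
  assumes "n \<ge> 1" "a \<ge> 2" "balanced a n p" "balanced a n q"
    "\<And>ys. ys \<in> words n \<Longrightarrow> E ys (dist_vec n p) = E ys (dist_vec n q)"
    and x: "x \<in> B n"
  shows "p x = q x"
proof -
  obtain a' where a': "a = Suc a'" "a' \<ge> 1" using assms(2) by (cases a) auto
  let ?v = "dist_vec n p - dist_vec n q"
  have "?v = 0"
  proof (rule eigen_zero[of _ n a'])
    show "?v \<in> H n" by (intro subspace_diff subspace_H dist_vec_homogeneous)
    have "hopf_power \<Delta> a ?v = real a ^ n *\<^sub>R ?v"
      using balanced_iff[of n a p] balanced_iff[of n a q] assms(1-4)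
      by (simp add: linear_diff[OF linear_hopf_power] scaleR_diff_right)
    then show "hopf_power \<Delta> (Suc a') ?v = real (Suc a') ^ n *\<^sub>R ?v"
      by (simp only: a')
    fix ys assume "set ys \<subseteq> B 1" "length ys = n"
    then show "E ys ?v = 0" using assms(5)[of ys] by (simp add: words_def linear_diff[OF linear_E])
  qed (use a'(2) assms(1) in simp_all)
  then have "e x (dist_vec n p) = e x (dist_vec n q)" by simp
  then show ?thesis using eta_pos[OF x assms(1)] by (simp add: e_dist_vec x)
qed

lemma dist_vec_chain_distribution:
  assumes "n \<ge> 1" "cs \<in> words n"
  shows "dist_vec n (chain_distribution B \<Delta> cs) = (1 / (fact n)\<^sup>2) *\<^sub>R sym_prod cs"
proof (rule eq_homogeneousI[OF dist_vec_homogeneous])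
  show "(1 / (fact n)\<^sup>2) *\<^sub>R sym_prod cs \<in> H n"
    using sym_prod_homogeneous[OF words_H[OF assms(2)]] assms(2)
    by (auto simp: words_def intro: subspace_scale[OF subspace_H])
  fix y assume "y \<in> B n"
  then show "e y (dist_vec n (chain_distribution B \<Delta> cs)) = e y ((1 / (fact n)\<^sup>2) *\<^sub>R sym_prod cs)"
    using eta_pos[of y n] assms
    by (simp add: e_dist_vec chain_distribution_eq[OF assms] linear_scale[OF linear_e] less_imp_neq[THEN not_sym])
qed

lemma stationary_iff:
  "stationary_distribution (B n) (hopf_power_chain B \<Delta> a n) p \<longleftrightarrow>
     (\<forall>x\<in>B n. p x \<ge> 0) \<and> (\<Sum>x\<in>B n. p x) = 1 \<and> balanced a n p"
  by (simp add: stationary_distribution_def balanced_def)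

lemma chain_distribution_stationary:
  assumes "n \<ge> 1" "a \<ge> 1" "cs \<in> words n"
  shows "stationary_distribution (B n) (hopf_power_chain B \<Delta> a n) (chain_distribution B \<Delta> cs)"
  unfolding stationary_iff
proof (intro conjI ballI)
  fix x assume x: "x \<in> B n"
  have "e x (sym_prod cs) \<ge> 0"
    unfolding sym_prod_def linear_sum[OF linear_e]
    by (intro sum_nonneg e_word_nonneg[of _ _ n] in_basis[OF x]) (use assms in \<open>auto simp: words_def\<close>)
  then show "chain_distribution B \<Delta> cs x \<ge> 0"
    using eta_pos[OF x assms(1)] by (simp add: chain_distribution_eq[OF assms(1,3)])
next
  \<comment> \<open>Read off from the word values, the mass is that of \<open>sym_prod cs\<close>,
    which the normalisation divides out.\<close>
  show "(\<Sum>x\<in>B n. chain_distribution B \<Delta> cs x) = 1"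
    unfolding sum_dist[OF assms(1), symmetric] dist_vec_chain_distribution[OF assms(1,3)]
    by (simp add: linear_scale[OF linear_E] sum_words_sym_prod[OF assms(3)] flip: sum_divide_distrib)
next
  obtain a' where a': "a = Suc a'" using assms(2) by (cases a) auto
  have "length cs = n" using assms(3) by (simp add: words_def)
  then have "hopf_power \<Delta> a (sym_prod cs) = real a ^ n *\<^sub>R sym_prod cs"
    using hopf_power_sym_prod[OF words_H[OF assms(3)], of a'] by (simp only: a')
  then show "balanced a n (chain_distribution B \<Delta> cs)"
    unfolding balanced_iff[OF assms(1,2)] dist_vec_chain_distribution[OF assms(1,3)]
    by (simp add: linear_scale[OF linear_hopf_power])
qed

text \<open>The word values are constant on the rearrangements of \<open>cs\<close>, vanish
  elsewhere and sum to one. They are therefore the same for \<open>p\<close> and \<open>q\<close>,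
  and they determine a balanced function.\<close>

lemma stationary_unique_if_mset:
  assumes n: "n \<ge> 1" and a: "a \<ge> 2" and cs: "cs \<in> words n"
    and p: "balanced a n p" "(\<Sum>x\<in>B n. p x) = 1" "\<And>ys. ys \<in> words n \<Longrightarrow> mset ys \<noteq> mset cs \<Longrightarrow> E ys (dist_vec n p) = 0"
    and q: "balanced a n q" "(\<Sum>x\<in>B n. q x) = 1" "\<And>ys. ys \<in> words n \<Longrightarrow> mset ys \<noteq> mset cs \<Longrightarrow> E ys (dist_vec n q) = 0"
    and x: "x \<in> B n"
  shows "p x = q x"
proof -
  have sub: "permutations_of_multiset (mset cs) \<subseteq> words n"
    using cs by (auto simp: words_def permutations_of_multiset_def dest: mset_eq_setD mset_eq_length)
  have t: "E ys (dist_vec n p) = 1 / real (card (permutations_of_multiset (mset cs)))"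
    if p: "balanced a n p" "(\<Sum>x\<in>B n. p x) = 1" "\<And>ys. ys \<in> words n \<Longrightarrow> mset ys \<noteq> mset cs \<Longrightarrow> E ys (dist_vec n p) = 0"
      and ys: "mset ys = mset cs" for p ys
  proof -
    have "1 = (\<Sum>zs\<in>words n. E zs (dist_vec n p))" using sum_dist[OF n] p(2) by simp
    also have "\<dots> = (\<Sum>zs\<in>permutations_of_multiset (mset cs). E cs (dist_vec n p))"
    proof (rule sum.mono_neutral_cong_right[OF finite_words sub])
      show "\<forall>zs\<in>words n - permutations_of_multiset (mset cs). E zs (dist_vec n p) = 0"
        using p(3) by (simp add: permutations_of_multiset_def)
      fix zs assume "zs \<in> permutations_of_multiset (mset cs)"
      then show "E zs (dist_vec n p) = E cs (dist_vec n p)"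
        by (intro balanced_symmetric[OF n a p(1) cs]) (simp add: permutations_of_multiset_def)
    qed
    finally show ?thesis
      using card_permutations_pos[of "mset cs"] balanced_symmetric[OF n a p(1) cs ys] by (simp add: field_simps)
  qed
  show ?thesis
  proof (rule balanced_determined[OF n a p(1) q(1) _ x])
    fix ys assume "ys \<in> words n"
    then show "E ys (dist_vec n p) = E ys (dist_vec n q)"
      using t[OF p] t[OF q] p(3) q(3) by (cases "mset ys = mset cs") auto
  qed
qed

end

section \<open>Stationary distributions and multigradings\<close>

lemma stationary_restrict:
  assumes "finite S" "C \<subseteq> S" "stationary_distribution S K q" "\<And>x. x \<in> S - C \<Longrightarrow> q x = 0"
  shows "stationary_distribution C K q"
proof -
  have "(\<Sum>x\<in>C. q x * f x) = (\<Sum>x\<in>S. q x * f x)" for f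
    by (rule sum.mono_neutral_left) (use assms in auto)
  from this[of "\<lambda>_. 1"] this[of "\<lambda>x. K x _"] show ?thesis
    using assms(2,3) by (auto simp: stationary_distribution_def)
qed

text \<open>No transition leads from \<open>C\<close> to the rest of \<open>S\<close>, so no mass
  leaks out.\<close>

lemma stationary_extend:
  assumes "finite S" "C \<subseteq> S" "stationary_distribution C K p" "\<And>x y. x \<in> C \<Longrightarrow> y \<in> S - C \<Longrightarrow> K x y = 0"
  shows "stationary_distribution S K (\<lambda>x. if x \<in> C then p x else 0)"
proof -
  have eq: "(\<Sum>x\<in>S. (if x \<in> C then p x else 0) * f x) = (\<Sum>x\<in>C. p x * f x)" for f
    by (rule sum.mono_neutral_cong_right) (use assms in auto)
  have "(\<Sum>x\<in>C. p x * K x y) = (if y \<in> C then p y else 0)" if "y \<in> S" for y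
    using assms(3,4) that by (auto simp: stationary_distribution_def)
  then show ?thesis
    using assms(3) eq[of "\<lambda>_. 1"] by (auto simp: stationary_distribution_def eq)
qed

lemma count_concat_replicate:
  "count (mset (concat (map (\<lambda>j. replicate (f j) (b j)) js))) y = (\<Sum>j\<leftarrow>js. if b j = y then f j else 0)"
  by (induction js) auto

lemma multidegree_zero: "\<nu> \<in> multidegrees r \<Longrightarrow> sum_list \<nu> = 0 \<Longrightarrow> \<nu> = replicate r 0"
  by (auto simp: multidegrees_def intro: replicate_eqI)

lemma multidegree_unit:
  assumes "\<nu> \<in> multidegrees r" "sum_list \<nu> = 1"
  shows "\<exists>i<r. \<nu> = unit_multidegree r i"
proof -
  have len: "length \<nu> = r" using assms by (simp add: multidegrees_def)
  have "\<exists>x\<in>set \<nu>. x \<noteq> 0" using assms(2) by (metis sum_list_eq_0_iff zero_neq_one)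
  then obtain i where i: "i < r" "\<nu> ! i \<noteq> 0" using len by (metis in_set_conv_nth)
  have le: "\<nu> ! i \<le> sum_list \<nu>" using elem_le_sum_list i len by blast
  have "sum_list (\<nu>[i := 0]) = 0"
    using assms(2) i len le by (simp add: sum_list_update)
  then have "\<nu>[i := 0] = replicate r 0"
    using len by (intro multidegree_zero) (simp_all add: multidegrees_def)
  then have "\<nu>[i := 0, i := 1] = unit_multidegree r i" by (simp add: unit_multidegree_def)
  moreover have "\<nu> ! i = 1" using le assms(2) i by simp
  ultimately have "\<nu> = unit_multidegree r i" by (metis list_update_id list_update_overwrite)
  then show ?thesis using i by blast
qed

lemma unit_multidegree: "i < r \<Longrightarrow> unit_multidegree r i \<in> multidegrees r"
  "i < r \<Longrightarrow> sum_list (unit_multidegree r i) = 1"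
  by (simp_all add: unit_multidegree_def multidegrees_def sum_list_update sum_list_replicate)

lemma unit_multidegree_nth: "i < r \<Longrightarrow> j < r \<Longrightarrow> unit_multidegree r i ! j = (if i = j then 1 else 0)"
  by (simp add: unit_multidegree_def nth_list_update)

section \<open>Linear combinations of the basic distributions, and a single degree-one
  generator\<close>

context state_space
begin

text \<open>\<open>E cs\<close> is nonzero on \<open>sym_prod cs\<close> and vanishes on the
  symmetrised product of any other multiset.\<close>

lemma chain_distribution_inj:
  assumes "n \<ge> 1" "cs \<in> words n" "ds \<in> words n"
    "\<And>x. x \<in> B n \<Longrightarrow> chain_distribution B \<Delta> cs x = chain_distribution B \<Delta> ds x"
  shows "mset cs = mset ds"
proof -
  have "dist_vec n (chain_distribution B \<Delta> cs) = dist_vec n (chain_distribution B \<Delta> ds)"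
    unfolding dist_vec_def using assms(4) by simp
  then have "sym_prod cs = sym_prod ds"
    using dist_vec_chain_distribution assms by simp
  then have "E cs (sym_prod ds) \<noteq> 0"
    using E_sym_prod[of cs cs] mfact_pos[of "mset cs"] assms(2) by (simp add: words_def)
  then show ?thesis using E_sym_prod[of cs ds] assms by (auto simp: words_def split: if_splits)
qed

text \<open>The same choice as in \<open>mset_distribution\<close>, so that one rewrites into the
  other.\<close>

definition rep :: "'h multiset \<Rightarrow> 'h list" where
  "rep M = (SOME cs. mset cs = M)"

lemma mset_rep: "mset (rep M) = M"
  unfolding rep_def by (rule someI_ex) (rule ex_mset)

lemma rep_words: "M \<in> multisets_of_size (B 1) n \<Longrightarrow> rep M \<in> words n"
  using mset_rep[of M] unfolding words_def multisets_of_size_def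
  by (metis (mono_tags, lifting) mem_Collect_eq set_mset_mset size_mset)

lemma mset_words: "ys \<in> words n \<Longrightarrow> mset ys \<in> multisets_of_size (B 1) n"
  by (simp add: words_def multisets_of_size_def)

abbreviation combination :: "nat \<Rightarrow> ('h multiset \<Rightarrow> real) \<Rightarrow> 'h \<Rightarrow> real" where
  "combination n \<alpha> x \<equiv> \<Sum>M\<in>multisets_of_size (B 1) n. \<alpha> M * mset_distribution B \<Delta> M x"

lemma dist_vec_combination:
  assumes "n \<ge> 1"
  shows "dist_vec n (combination n \<alpha>) =
    (\<Sum>M\<in>multisets_of_size (B 1) n. (\<alpha> M / (fact n)\<^sup>2) *\<^sub>R sym_prod (rep M))"
proof -
  let ?S = "multisets_of_size (B 1) n"
  have "dist_vec n (combination n \<alpha>) = (\<Sum>M\<in>?S. \<alpha> M *\<^sub>R dist_vec n (mset_distribution B \<Delta> M))"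
    unfolding dist_vec_def sum_divide_distrib scaleR_sum_left scaleR_sum_right
    by (subst sum.swap) simp
  also have "\<dots> = (\<Sum>M\<in>?S. (\<alpha> M / (fact n)\<^sup>2) *\<^sub>R sym_prod (rep M))"
    by (intro sum.cong refl)
      (simp add: mset_distribution_def dist_vec_chain_distribution[OF assms rep_words] flip: rep_def)
  finally show ?thesis .
qed

text \<open>On symmetrised products the word functionals are diagonal: a word sees only the
  coefficient of its own multiset. Both existence and uniqueness of the coefficients rest on
  this.\<close>

lemma E_combination:
  assumes "n \<ge> 1" "ys \<in> words n"
  shows "E ys (dist_vec n (combination n \<alpha>)) = \<alpha> (mset ys) * mfact (mset ys) / fact n"
proof -
  let ?S = "multisets_of_size (B 1) n"
  have fin: "finite ?S" by (intro finite_multisets_of_size finite_B)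
  have "E ys (dist_vec n (combination n \<alpha>)) = (\<Sum>M\<in>?S. \<alpha> M / (fact n)\<^sup>2 * E ys (sym_prod (rep M)))"
    unfolding dist_vec_combination[OF assms(1)] by (simp add: linear_sum[OF linear_E] linear_scale[OF linear_E])
  also have "\<dots> = (\<Sum>M\<in>?S. if M = mset ys then \<alpha> M / (fact n)\<^sup>2 * (fact n * mfact M) else 0)"
  proof (intro sum.cong refl)
    fix M assume "M \<in> ?S"
    then have "rep M \<in> words n" by (rule rep_words)
    then show "\<alpha> M / (fact n)\<^sup>2 * E ys (sym_prod (rep M)) = (if M = mset ys then \<alpha> M / (fact n)\<^sup>2 * (fact n * mfact M) else 0)"
      using assms(2) E_sym_prod[of ys "rep M"] by (auto simp: words_def mset_rep)
  qed
  also have "\<dots> = \<alpha> (mset ys) * mfact (mset ys) / fact n"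
    using fin mset_words[OF assms(2)] by (simp add: power2_eq_square)
  finally show ?thesis .
qed

lemma balanced_combination:
  assumes n: "n \<ge> 1" and a: "a \<ge> 1"
  shows "balanced a n (combination n \<alpha>)"
proof -
  obtain a' where a': "a = Suc a'" using a by (cases a) auto
  have "hopf_power \<Delta> a (sym_prod (rep M)) = real a ^ n *\<^sub>R sym_prod (rep M)" if "M \<in> multisets_of_size (B 1) n" for M
    using hopf_power_sym_prod[OF words_H[OF rep_words[OF that]], of a'] rep_words[OF that]
    by (simp only: a' words_def mem_Collect_eq)
  then show ?thesis
    unfolding balanced_iff[OF n a] dist_vec_combination[OF n]
    by (simp add: linear_sum[OF linear_hopf_power] linear_scale[OF linear_hopf_power] scaleR_sum_right mult.commute)
qed

lemma stationary_combination_unique: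
  assumes n: "n \<ge> 1" and a: "a \<ge> 2" and p: "stationary_distribution (B n) (hopf_power_chain B \<Delta> a n) p"
  shows "\<exists>!\<alpha>. (\<forall>M. M \<notin> multisets_of_size (B 1) n \<longrightarrow> \<alpha> M = 0) \<and> (\<forall>x\<in>B n. p x = combination n \<alpha> x)"
proof (rule ex1I)
  let ?S = "multisets_of_size (B 1) n"
  \<comment> \<open>The coefficient obtained by solving \<open>E_combination\<close> for a word with
    multiset \<open>M\<close>; by symmetry any such word gives the same value.\<close>
  let ?\<alpha> = "\<lambda>M. if M \<in> ?S then E (rep M) (dist_vec n p) * fact n / mfact M else 0"
  have bal: "balanced a n p" using p by (simp add: stationary_iff)
  have a1: "a \<ge> 1" using a by simp
  have "p x = combination n ?\<alpha> x" if "x \<in> B n" for x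
  proof (rule balanced_determined[OF n a bal balanced_combination[OF n a1] _ that])
    fix ys assume ys: "ys \<in> words n"
    have "E (rep (mset ys)) (dist_vec n p) = E ys (dist_vec n p)"
      by (rule balanced_symmetric[OF n a bal ys mset_rep])
    then show "E ys (dist_vec n p) = E ys (dist_vec n (combination n ?\<alpha>))"
      unfolding E_combination[OF n ys] using mset_words[OF ys] mfact_pos[of "mset ys"] by simp
  qed
  then show "(\<forall>M. M \<notin> ?S \<longrightarrow> ?\<alpha> M = 0) \<and> (\<forall>x\<in>B n. p x = combination n ?\<alpha> x)" by auto
  fix \<alpha> assume \<alpha>: "(\<forall>M. M \<notin> ?S \<longrightarrow> \<alpha> M = 0) \<and> (\<forall>x\<in>B n. p x = combination n \<alpha> x)"
  then have v: "dist_vec n p = dist_vec n (combination n \<alpha>)"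
    unfolding dist_vec_def by (intro sum.cong) auto
  show "\<alpha> = ?\<alpha>"
  proof
    fix M
    show "\<alpha> M = ?\<alpha> M"
    proof (cases "M \<in> ?S")
      case True
      then show ?thesis using E_combination[OF n rep_words[OF True], of \<alpha>] mfact_pos[of M]
        by (simp add: v mset_rep)
    qed (use \<alpha> in simp)
  qed
qed

text \<open>Every permutation fixes a constant word, so the sum has \<open>n!\<close> equal terms
  and one factorial cancels.\<close>

lemma chain_distribution_replicate:
  assumes "n \<ge> 1" "b \<in> B 1"
  shows "chain_distribution B \<Delta> (replicate n b) x = rescaling B \<Delta> n x / fact n * product_coeff B (replicate n b) x"
proof -
  have "permute_list \<sigma> (replicate n b) = replicate n b" if "\<sigma> permutes {..<n}" for \<sigma>
    using permutes_in_image[OF that] by (intro nth_equalityI) (auto simp: permute_list_def)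
  then have "(\<Sum>\<sigma> | \<sigma> permutes {..<n}. product_coeff B (permute_list \<sigma> (replicate n b)) x)
    = (\<Sum>\<sigma> | \<sigma> permutes {..<n}. product_coeff B (replicate n b) x)"
    by (intro sum.cong) auto
  also have "\<dots> = fact n * product_coeff B (replicate n b) x"
    using card_permutations[of "{..<n}" n] by simp
  finally show ?thesis by (simp add: chain_distribution_def power2_eq_square)
qed

lemma unique_stationary_single:
  assumes n: "n \<ge> 1" and a: "a \<ge> 2" and b: "B 1 = {b}"
  shows "unique_stationary_distribution (B n) (hopf_power_chain B \<Delta> a n)
    (\<lambda>x. rescaling B \<Delta> n x / fact n * product_coeff B (replicate n b) x)"
proof -
  \<comment> \<open>With a single word, the vanishing conditions of
    \<open>stationary_unique_if_mset\<close> on other multisets are vacuous.\<close>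
  have w: "words n = {replicate n b}"
  proof -
    have "cs = replicate n b" if "cs \<in> words n" for cs
      using that b by (intro replicate_eqI) (auto simp: words_def)
    then show ?thesis using b by (auto simp: words_def)
  qed
  then have rw: "replicate n b \<in> words n" by simp
  have eq: "(\<lambda>x. rescaling B \<Delta> n x / fact n * product_coeff B (replicate n b) x) = chain_distribution B \<Delta> (replicate n b)"
    using chain_distribution_replicate[OF n] b by auto
  have st: "stationary_distribution (B n) (hopf_power_chain B \<Delta> a n) (chain_distribution B \<Delta> (replicate n b))"
    using chain_distribution_stationary[OF n _ rw] a by simp
  show ?thesis
    unfolding unique_stationary_distribution_def eq
  proof (intro conjI st allI impI ballI)
    fix q x assume q: "stationary_distribution (B n) (hopf_power_chain B \<Delta> a n) q" and x: "x \<in> B n"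
    show "q x = chain_distribution B \<Delta> (replicate n b) x"
      by (rule stationary_unique_if_mset[OF n a rw _ _ _ _ _ _ x])
        (use q st w in \<open>auto simp: stationary_iff\<close>)
  qed
qed

text \<open>Mass one makes \<open>B n\<close> nonempty, and \<open>word_exists\<close> then yields a
  letter in \<open>B 1\<close>. Two different letters would give constant words with different
  multisets, hence two different stationary distributions.\<close>

lemma unique_imp_single:
  assumes n: "n \<ge> 1" and a: "a \<ge> 2" and p: "unique_stationary_distribution (B n) (hopf_power_chain B \<Delta> a n) p"
  shows "\<exists>b. B 1 = {b}"
proof -
  have "(\<Sum>x\<in>B n. p x) = 1" using p by (simp add: unique_stationary_distribution_def stationary_iff)
  then obtain x where "x \<in> B n" by fastforce
  then obtain cs where cs: "cs \<in> words n" using word_exists[OF _ n] by blast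
  then obtain c where c: "c \<in> B 1" using n by (cases cs) (auto simp: words_def)
  have "d = c" if d: "d \<in> B 1" for d
  proof -
    have w: "replicate n c \<in> words n" "replicate n d \<in> words n" using c d by (auto simp: words_def)
    have "mset (replicate n d) = mset (replicate n c)"
    proof (rule chain_distribution_inj[OF n w(2,1)])
      fix x assume "x \<in> B n"
      then show "chain_distribution B \<Delta> (replicate n d) x = chain_distribution B \<Delta> (replicate n c) x"
        using p chain_distribution_stationary[OF n _ w(1), of a] chain_distribution_stationary[OF n _ w(2), of a] a
        unfolding unique_stationary_distribution_def by (metis One_nat_def Suc_1 Suc_leD)
    qed
    then have "set (replicate n d) = set (replicate n c)" by (rule mset_eq_setD)
    then show ?thesis using n by simp
  qed
  then show ?thesis using c by blast
qed

end

section \<open>Multigraded chains\<close>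

locale multigraded_state_space = state_space H \<Delta> B
  for H :: "nat \<Rightarrow> 'h::real_algebra_1 set" and \<Delta> and B +
  fixes r :: nat and HH BB :: "nat list \<Rightarrow> 'h set"
  assumes multigrading: "multigrading H \<Delta> B r HH BB"
begin

lemma multigraded_H: "internal_direct_sum HH {\<nu> \<in> multidegrees r. sum_list \<nu> = n} (H n)"
  and multigraded_mult: "\<mu> \<in> multidegrees r \<Longrightarrow> \<rho> \<in> multidegrees r \<Longrightarrow> w \<in> HH \<mu> \<Longrightarrow> z \<in> HH \<rho> \<Longrightarrow> w * z \<in> HH (map2 (+) \<mu> \<rho>)"
  and BB_basis: "\<nu> \<in> multidegrees r \<Longrightarrow> independent (BB \<nu>) \<and> span (BB \<nu>) = HH \<nu>"
  and B_multigraded: "B n = (\<Union>\<nu>\<in>{\<nu> \<in> multidegrees r. sum_list \<nu> = n}. BB \<nu>)"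
proof -
  note m = multigrading[unfolded multigrading_def]
  show "internal_direct_sum HH {\<nu> \<in> multidegrees r. sum_list \<nu> = n} (H n)"
    using m[THEN conjunct1] by blast
  show "w * z \<in> HH (map2 (+) \<mu> \<rho>)" if "\<mu> \<in> multidegrees r" "\<rho> \<in> multidegrees r" "w \<in> HH \<mu>" "z \<in> HH \<rho>"
    using m[THEN conjunct2, THEN conjunct1] that by blast
  show "independent (BB \<nu>) \<and> span (BB \<nu>) = HH \<nu>" if "\<nu> \<in> multidegrees r"
    using m[THEN conjunct2, THEN conjunct2, THEN conjunct2, THEN conjunct1] that by blast
  show "B n = (\<Union>\<nu>\<in>{\<nu> \<in> multidegrees r. sum_list \<nu> = n}. BB \<nu>)"
    using m[THEN conjunct2, THEN conjunct2, THEN conjunct2, THEN conjunct2] by blast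
qed

lemma multigraded_comult:
  assumes "\<nu> \<in> multidegrees r" "x \<in> HH \<nu>"
  shows "\<Delta> x \<in> span {pure_tensor [u, w] | u w. \<exists>(\<mu>, \<rho>)\<in>{(\<mu>, \<rho>) \<in> multidegrees r \<times> multidegrees r. map2 (+) \<mu> \<rho> = \<nu>}.
    u \<in> HH \<mu> \<and> w \<in> HH \<rho>}"
  using multigrading[unfolded multigrading_def, THEN conjunct2, THEN conjunct2, THEN conjunct1] assms
  by (intro span_tensor_subspaces) blast

lemma BB_subset: "\<nu> \<in> multidegrees r \<Longrightarrow> BB \<nu> \<subseteq> B (sum_list \<nu>)"
  by (subst B_multigraded) blast

lemma BB_subset_basis: "\<nu> \<in> multidegrees r \<Longrightarrow> BB \<nu> \<subseteq> basis"
  using BB_subset B_subset by blast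

lemma BB_in_HH: "\<nu> \<in> multidegrees r \<Longrightarrow> x \<in> BB \<nu> \<Longrightarrow> x \<in> HH \<nu>"
  using BB_basis span_base by blast

lemma subspace_HH: "\<nu> \<in> multidegrees r \<Longrightarrow> subspace (HH \<nu>)"
  using BB_basis subspace_span by metis

lemma e_HH: "\<nu> \<in> multidegrees r \<Longrightarrow> v \<in> HH \<nu> \<Longrightarrow> e y v \<noteq> 0 \<Longrightarrow> y \<in> BB \<nu>"
  using e_subset_zero[OF BB_subset_basis] BB_basis by blast

lemma BB_disjoint:
  assumes "\<mu> \<in> multidegrees r" "\<nu> \<in> multidegrees r" "x \<in> BB \<mu>" "x \<in> BB \<nu>"
  shows "\<mu> = \<nu>"
proof (rule ccontr)
  assume ne: "\<mu> \<noteq> \<nu>"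
  have "x \<in> B (sum_list \<mu>)" "x \<in> B (sum_list \<nu>)" using assms BB_subset by blast+
  then have "sum_list \<mu> = sum_list \<nu>" using B_disjoint by blast
  then have "x = 0"
    using direct_sum_disjoint[OF multigraded_H[of "sum_list \<nu>"], of \<mu> \<nu> x] assms ne BB_in_HH by blast
  moreover have "x \<noteq> 0" using assms(1,3) BB_basis dependent_zero by blast
  ultimately show False by blast
qed

lemma hopf_power_HH:
  "\<nu> \<in> multidegrees r \<Longrightarrow> v \<in> HH \<nu> \<Longrightarrow> hopf_power \<Delta> (Suc a) v \<in> HH \<nu>"
proof (induction a arbitrary: v \<nu>)
  case (Suc a)
  show ?case unfolding hopf_power_Suc
  proof (rule sw_in_subspace[OF bilinear_mult_hopf_power multigraded_comult[OF Suc.prems] subspace_HH[OF Suc.prems(1)]])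
    fix u w assume "\<exists>(\<mu>, \<rho>)\<in>{(\<mu>, \<rho>) \<in> multidegrees r \<times> multidegrees r. map2 (+) \<mu> \<rho> = \<nu>}. u \<in> HH \<mu> \<and> w \<in> HH \<rho>"
    then obtain \<mu> \<rho> where "\<mu> \<in> multidegrees r" "\<rho> \<in> multidegrees r" "map2 (+) \<mu> \<rho> = \<nu>" "u \<in> HH \<mu>" "w \<in> HH \<rho>"
      by blast
    then show "u * hopf_power \<Delta> (Suc a) w \<in> HH \<nu>"
      using multigraded_mult[of \<mu> \<rho> u "hopf_power \<Delta> (Suc a) w"] Suc.IH[of \<rho> w] by blast
  qed
qed (simp add: hopf_power_1)

lemma chain_BB_zero:
  assumes "\<nu> \<in> multidegrees r" "a \<ge> 1" "sum_list \<nu> \<ge> 1" "x \<in> BB \<nu>" "y \<notin> BB \<nu>"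
  shows "hopf_power_chain B \<Delta> a (sum_list \<nu>) x y = 0"
proof -
  obtain a' where "a = Suc a'" using assms(2) by (cases a) auto
  then have "e y (hopf_power \<Delta> a x) = 0"
    using e_HH[OF assms(1) hopf_power_HH[OF assms(1) BB_in_HH[OF assms(1,4)]]] assms(5) by blast
  then show ?thesis by (simp add: chain_eq[OF assms(3)])
qed

lemma one_in_BB: "1 \<in> BB (replicate r 0)"
proof -
  have "1 \<in> (\<Union>\<nu>\<in>{\<nu> \<in> multidegrees r. sum_list \<nu> = 0}. BB \<nu>)" using one_in_B B_multigraded by blast
  then show ?thesis using multidegree_zero by fastforce
qed

text \<open>In degree one, the distribution of the word \<open>[c]\<close> is the point mass at
  \<open>c\<close>. Uniqueness makes \<open>p\<close> the point mass at every \<open>c\<close> of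
  the set, so there is only one.\<close>

lemma unique_imp_single_unit:
  assumes i: "i < r" and a: "a \<ge> 2"
    and p: "unique_stationary_distribution (BB (unit_multidegree r i)) (hopf_power_chain B \<Delta> a 1) p"
  shows "\<exists>b. BB (unit_multidegree r i) = {b}"
proof -
  let ?C = "BB (unit_multidegree r i)"
  have C: "?C \<subseteq> B 1" using BB_subset[OF unit_multidegree(1)[OF i]] unit_multidegree(2)[OF i] by simp
  have sum: "(\<Sum>x\<in>?C. p x) = 1"
    using p by (simp add: unique_stationary_distribution_def stationary_distribution_def)
  have p_eq: "p x = (if x = c then 1 else 0)" if c: "c \<in> ?C" and x: "x \<in> ?C" for c x
  proof -
    let ?q = "chain_distribution B \<Delta> [c]"
    have w: "[c] \<in> words 1" using c C by (auto simp: words_def)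
    \<comment> \<open>Coordinates in degree one are values on one-letter words, and those are known
      from \<open>E_sym_prod\<close>.\<close>
    have q0: "?q y = 0" if "y \<in> B 1" "y \<noteq> c" for y
    proof -
      have "E [y] (sym_prod [c]) = 0" using E_sym_prod[of "[y]" "[c]"] that c C by auto
      then show ?thesis using chain_distribution_eq[OF _ w] by (simp add: E_single del: E.simps)
    qed
    have st: "stationary_distribution (B 1) (hopf_power_chain B \<Delta> a 1) ?q"
      using chain_distribution_stationary[OF _ _ w, of a] a by simp
    have "stationary_distribution ?C (hopf_power_chain B \<Delta> a 1) ?q"
      by (rule stationary_restrict[OF finite_B C st]) (use q0 c in auto)
    then have pq: "p y = ?q y" if "y \<in> ?C" for y
      using p that by (simp add: unique_stationary_distribution_def)
    have "(\<Sum>y\<in>?C. p y) = (\<Sum>y\<in>{c}. p y)"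
      by (rule sum.mono_neutral_right) (use finite_subset[OF C finite_B] c pq q0 C in auto)
    then have "p c = 1" using sum by simp
    then show ?thesis using pq[OF x] q0[of x] x C by auto
  qed
  from sum obtain c where c: "c \<in> ?C" by fastforce
  moreover have "d = c" if "d \<in> ?C" for d
    using p_eq[OF c c] p_eq[OF that c] by (auto split: if_splits)
  ultimately show ?thesis by blast
qed

context
  fixes b :: "nat \<Rightarrow> 'h"
  assumes b: "\<And>i. i < r \<Longrightarrow> BB (unit_multidegree r i) = {b i}"
begin

lemma b_in_BB: "i < r \<Longrightarrow> b i \<in> BB (unit_multidegree r i)"
  using b by blast

lemma b_inj: "i < r \<Longrightarrow> j < r \<Longrightarrow> b i = b j \<longleftrightarrow> i = j"
proof
  assume i: "i < r" and j: "j < r" and eq: "b i = b j"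
  have "unit_multidegree r i = unit_multidegree r j"
  proof (rule BB_disjoint[OF unit_multidegree(1)[OF i] unit_multidegree(1)[OF j] b_in_BB[OF i]])
    show "b i \<in> BB (unit_multidegree r j)" unfolding eq by (rule b_in_BB[OF j])
  qed
  then have "unit_multidegree r j ! i = unit_multidegree r i ! i" by (rule arg_cong[OF sym])
  then show "i = j" unfolding unit_multidegree_nth[OF j i] unit_multidegree_nth[OF i i] by (cases "j = i") simp_all
qed simp

lemma B_1_eq: "B 1 = b ` {..<r}"
proof
  show "B 1 \<subseteq> b ` {..<r}"
  proof
    fix x assume "x \<in> B 1"
    then obtain \<nu> where "\<nu> \<in> multidegrees r" "sum_list \<nu> = 1" "x \<in> BB \<nu>" using B_multigraded by blast
    then show "x \<in> b ` {..<r}" using multidegree_unit[of \<nu> r] b by auto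
  qed
  show "b ` {..<r} \<subseteq> B 1"
    using BB_subset[OF unit_multidegree(1)] b_in_BB unit_multidegree(2) by fastforce
qed

definition word_degree :: "'h list \<Rightarrow> nat list" where
  "word_degree ys = map (\<lambda>i. count (mset ys) (b i)) [0..<r]"

lemma word_degree_multidegrees: "word_degree ys \<in> multidegrees r"
  by (simp add: word_degree_def multidegrees_def)

lemma word_degree_Nil: "word_degree [] = replicate r 0"
  by (simp add: word_degree_def map_replicate_const)

lemma word_degree_Cons:
  "i < r \<Longrightarrow> word_degree (b i # ys) = map2 (+) (unit_multidegree r i) (word_degree ys)"
  by (rule nth_equalityI)
    (auto simp: word_degree_def unit_multidegree_nth b_inj, simp_all add: unit_multidegree_def)

lemma prod_list_HH: "set ys \<subseteq> b ` {..<r} \<Longrightarrow> prod_list ys \<in> HH (word_degree ys)"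
proof (induction ys)
  case Nil
  show ?case using BB_in_HH[OF _ one_in_BB] word_degree_multidegrees[of "[]"] by (simp add: word_degree_Nil)
next
  case (Cons y ys)
  then obtain i where i: "i < r" "y = b i" by auto
  then show ?case
    using multigraded_mult[OF unit_multidegree(1)[OF i(1)] word_degree_multidegrees
        BB_in_HH[OF unit_multidegree(1) b_in_BB, OF i(1) i(1)] Cons.IH] Cons.prems
    by (simp add: word_degree_Cons)
qed

text \<open>The coproduct splits the multidegree, and the letter \<open>b i\<close> takes exactly
  the unit multidegree \<open>i\<close>; this refines \<open>E_degree\<close> for words in the
  \<open>b i\<close>.\<close>

lemma E_support:
  "\<nu> \<in> multidegrees r \<Longrightarrow> x \<in> HH \<nu> \<Longrightarrow> set ys \<subseteq> b ` {..<r} \<Longrightarrow> E ys x \<noteq> 0 \<Longrightarrow> \<nu> = word_degree ys"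
proof (induction ys arbitrary: x \<nu>)
  case Nil
  then have "1 \<in> BB \<nu>" using e_HH by (simp add: counit_def)
  then show ?case using BB_disjoint[OF Nil(1) _ _ one_in_BB] word_degree_multidegrees[of "[]"]
    by (simp add: word_degree_Nil)
next
  case (Cons y ys)
  obtain i where i: "i < r" "y = b i" using Cons.prems by auto
  have "\<exists>u w \<mu> \<rho>. \<mu> \<in> multidegrees r \<and> \<rho> \<in> multidegrees r \<and> map2 (+) \<mu> \<rho> = \<nu> \<and> u \<in> HH \<mu> \<and> w \<in> HH \<rho>
    \<and> e y u * E ys w \<noteq> 0"
  proof (rule ccontr)
    assume "\<not> ?thesis"
    then have "sw (\<lambda>u w. e y u * E ys w) x \<in> {0}"
      by (intro sw_in_subspace[OF bilinear_times[OF linear_e linear_E] multigraded_comult[OF Cons.prems(1,2)] subspace_single_0])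
        blast
    then show False using Cons.prems(4) by (simp add: conv_def)
  qed
  then obtain u w \<mu> \<rho> where *: "\<mu> \<in> multidegrees r" "\<rho> \<in> multidegrees r" "map2 (+) \<mu> \<rho> = \<nu>" "u \<in> HH \<mu>" "w \<in> HH \<rho>"
    "e y u \<noteq> 0" "E ys w \<noteq> 0" by auto
  have "b i \<in> BB \<mu>" using e_HH[OF *(1,4,6)] i by simp
  then have "\<mu> = unit_multidegree r i" using BB_disjoint[OF *(1) unit_multidegree(1)] b_in_BB i(1) by blast
  moreover have "\<rho> = word_degree ys" using Cons.IH[OF *(2,5) _ *(7)] Cons.prems(3) by simp
  ultimately show ?case using *(3) i by (simp add: word_degree_Cons)
qed

lemma count_multidegree_word:
  assumes "\<nu> \<in> multidegrees r" "i < r"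
  shows "count (mset (multidegree_word b \<nu>)) (b i) = \<nu> ! i"
proof -
  have "count (mset (multidegree_word b \<nu>)) (b i) = (\<Sum>j\<leftarrow>[0..<r]. if b j = b i then \<nu> ! j else 0)"
    using assms(1) by (simp only: multidegree_word_def count_concat_replicate) (simp add: multidegrees_def)
  also have "\<dots> = (\<Sum>j\<in>{..<r}. if b j = b i then \<nu> ! j else 0)"
    by (simp add: interv_sum_list_conv_sum_set_nat lessThan_atLeast0)
  also have "\<dots> = (\<Sum>j\<in>{..<r}. if j = i then \<nu> ! j else 0)"
    using assms(2) by (intro sum.cong) (auto simp: b_inj)
  finally show ?thesis using assms(2) by simp
qed

lemma word_degree_multidegree_word: "\<nu> \<in> multidegrees r \<Longrightarrow> word_degree (multidegree_word b \<nu>) = \<nu>"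
  by (rule nth_equalityI) (auto simp: word_degree_def count_multidegree_word multidegrees_def)

lemma multidegree_word_words: 
  assumes "\<nu> \<in> multidegrees r"
  shows "multidegree_word b \<nu> \<in> words (sum_list \<nu>)"
proof -
  have "length (multidegree_word b \<nu>) = sum_list (map (\<lambda>i. \<nu> ! i) [0..<length \<nu>])"
    by (simp add: multidegree_word_def length_concat o_def)
  then have "length (multidegree_word b \<nu>) = sum_list \<nu>" by (simp only: map_nth)
  moreover have "set (multidegree_word b \<nu>) \<subseteq> B 1"
    unfolding B_1_eq using assms by (auto simp: multidegree_word_def multidegrees_def)
  ultimately show ?thesis by (simp add: words_def)
qed

lemma mset_eq_multidegree_word:
  assumes "\<nu> \<in> multidegrees r" "ys \<in> words n" "word_degree ys = \<nu>"
  shows "mset ys = mset (multidegree_word b \<nu>)"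
proof (rule multiset_eqI)
  fix y
  have s: "set ys \<subseteq> b ` {..<r}" "set (multidegree_word b \<nu>) \<subseteq> b ` {..<r}"
    using assms(2) multidegree_word_words[OF assms(1)] by (auto simp: words_def B_1_eq[unfolded One_nat_def])
  show "count (mset ys) y = count (mset (multidegree_word b \<nu>)) y"
  proof (cases "y \<in> b ` {..<r}")
    case True
    then obtain i where "i < r" "y = b i" by auto
    then show ?thesis using count_multidegree_word[OF assms(1)] assms(3) by (auto simp: word_degree_def)
  next
    case False
    then have "y \<notin> set ys" "y \<notin> set (multidegree_word b \<nu>)" using s by blast+
    then show ?thesis by (metis count_mset_0_iff)
  qed
qed

text \<open>Reduction to the chain on the whole of \<open>B (sum_list \<nu>)\<close>: distributions
  on \<open>BB \<nu>\<close> are extended by zero. Their word values live on words of multidegree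
  \<open>\<nu>\<close>, which are all rearrangements of one word, so
  \<open>stationary_unique_if_mset\<close> applies.\<close>

lemma unique_stationary_multigraded:
  assumes \<nu>: "\<nu> \<in> multidegrees r" and n: "sum_list \<nu> \<ge> 1" and a: "a \<ge> 2"
  shows "unique_stationary_distribution (BB \<nu>) (hopf_power_chain B \<Delta> a (sum_list \<nu>))
    (chain_distribution B \<Delta> (multidegree_word b \<nu>))"
proof -
  let ?n = "sum_list \<nu>" and ?W = "multidegree_word b \<nu>"
  let ?K = "hopf_power_chain B \<Delta> a ?n"
  have a1: "a \<ge> 1" using a by simp
  have W: "?W \<in> words ?n" by (rule multidegree_word_words[OF \<nu>])
  have sub: "BB \<nu> \<subseteq> B ?n" by (rule BB_subset[OF \<nu>])
  have support: "E ys (dist_vec ?n p) = 0"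
    if ys: "ys \<in> words ?n" "mset ys \<noteq> mset ?W" and p: "\<And>x. x \<in> B ?n - BB \<nu> \<Longrightarrow> p x = 0" for p ys
  proof -
    have "E ys x = 0" if "x \<in> BB \<nu>" for x
      using E_support[OF \<nu> BB_in_HH[OF \<nu> that], of ys] mset_eq_multidegree_word[OF \<nu> ys(1)] ys
      by (auto simp: words_def B_1_eq[unfolded One_nat_def])
    then show ?thesis unfolding linear_dist_vec[OF linear_E] using p by (intro sum.neutral) auto
  qed
  \<comment> \<open>The candidate distribution therefore vanishes off \<open>BB \<nu>\<close>, so it
    restricts to a stationary distribution there.\<close>
  have "sym_prod ?W \<in> HH \<nu>"
    unfolding sym_prod_def
  proof (intro subspace_sum subspace_HH[OF \<nu>])
    fix \<sigma> assume "\<sigma> \<in> {\<sigma>. \<sigma> permutes {..<length ?W}}"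
    then have m: "mset (permute_list \<sigma> ?W) = mset ?W" by simp
    then have "word_degree (permute_list \<sigma> ?W) = \<nu>"
      using word_degree_multidegree_word[OF \<nu>] unfolding word_degree_def by simp
    moreover have "set (permute_list \<sigma> ?W) \<subseteq> b ` {..<r}"
      using mset_eq_setD[OF m] W B_1_eq by (simp add: words_def)
    ultimately show "prod_list (permute_list \<sigma> ?W) \<in> HH \<nu>" using prod_list_HH by metis
  qed
  then have off: "chain_distribution B \<Delta> ?W x = 0" if "x \<in> B ?n - BB \<nu>" for x
    using e_HH[OF \<nu>, of "sym_prod ?W" x] that by (auto simp: chain_distribution_eq[OF n W])
  have st: "stationary_distribution (B ?n) ?K (chain_distribution B \<Delta> ?W)"
    by (rule chain_distribution_stationary[OF n a1 W])
  show ?thesis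
    unfolding unique_stationary_distribution_def
  proof (intro conjI allI impI ballI)
    show "stationary_distribution (BB \<nu>) ?K (chain_distribution B \<Delta> ?W)"
      by (rule stationary_restrict[OF finite_B sub st off])
    fix q x assume q: "stationary_distribution (BB \<nu>) ?K q" and x: "x \<in> BB \<nu>"
    let ?q = "\<lambda>x. if x \<in> BB \<nu> then q x else 0"
    \<comment> \<open>The Hopf power preserves \<open>HH \<nu>\<close>, so the chain never leaves
      \<open>BB \<nu>\<close>.\<close>
    have stq: "stationary_distribution (B ?n) ?K ?q"
      by (rule stationary_extend[OF finite_B sub q chain_BB_zero[OF \<nu> a1 n]]) auto
    have xB: "x \<in> B ?n" using x sub by blast
    have "?q x = chain_distribution B \<Delta> ?W x"
    proof (rule stationary_unique_if_mset[OF n a W _ _ _ _ _ _ xB])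
      show "E ys (dist_vec ?n ?q) = 0" if "ys \<in> words ?n" "mset ys \<noteq> mset ?W" for ys
        by (rule support[OF that]) simp
      show "E ys (dist_vec ?n (chain_distribution B \<Delta> ?W)) = 0" if "ys \<in> words ?n" "mset ys \<noteq> mset ?W" for ys
        by (rule support[OF that off])
    qed (use st stq in \<open>simp_all add: stationary_iff\<close>)
    then show "q x = chain_distribution B \<Delta> ?W x" using x by simp
  qed
qed

end

end

theorem theorem4p5p1:
  fixes H :: "nat \<Rightarrow> 'h::real_algebra_1 set"
    and \<Delta> :: "'h \<Rightarrow> 'h tensor"
    and B :: "nat \<Rightarrow> 'h set"
    and a n :: nat
  assumes hopf: "graded_connected_hopf_algebra H \<Delta>"
    and fin_dim: "\<And>k. \<exists>S. finite S \<and> span S = H k"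
    and basis: "state_space_basis H \<Delta> B"
    and a: "a \<ge> 2"
    and n: "n \<ge> 1"
  shows
    "(\<forall>cs. set cs \<subseteq> B 1 \<and> length cs = n \<longrightarrow>
        stationary_distribution (B n) (hopf_power_chain B \<Delta> a n) (chain_distribution B \<Delta> cs)) \<and>
     (\<forall>p. stationary_distribution (B n) (hopf_power_chain B \<Delta> a n) p \<longrightarrow>
        (\<exists>!\<alpha>. (\<forall>M. M \<notin> multisets_of_size (B 1) n \<longrightarrow> \<alpha> M = 0) \<and>
              (\<forall>x\<in>B n. p x =
                 (\<Sum>M\<in>multisets_of_size (B 1) n. \<alpha> M * mset_distribution B \<Delta> M x)))) \<and>
     (\<forall>b. B 1 = {b} \<longrightarrow>
        unique_stationary_distribution (B n) (hopf_power_chain B \<Delta> a n)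
          (\<lambda>x. rescaling B \<Delta> n x / fact n * product_coeff B (replicate n b) x)) \<and>
     (\<forall>r HH BB b. multigrading H \<Delta> B r HH BB \<and> (\<forall>i<r. BB (unit_multidegree r i) = {b i}) \<longrightarrow>
        (\<forall>\<nu>\<in>multidegrees r. sum_list \<nu> = n \<longrightarrow>
           unique_stationary_distribution (BB \<nu>) (hopf_power_chain B \<Delta> a n)
             (chain_distribution B \<Delta> (multidegree_word b \<nu>)))) \<and>
     ((\<exists>p. unique_stationary_distribution (B n) (hopf_power_chain B \<Delta> a n) p) \<longrightarrow>
        (\<exists>b. B 1 = {b})) \<and>
     (\<forall>r HH BB. multigrading H \<Delta> B r HH BB \<and>
        (\<forall>\<nu>\<in>multidegrees r. \<nu> \<noteq> replicate r 0 \<longrightarrow>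
           (\<exists>p. unique_stationary_distribution (BB \<nu>)
                  (hopf_power_chain B \<Delta> a (sum_list \<nu>)) p)) \<longrightarrow>
        (\<forall>i<r. \<exists>b. BB (unit_multidegree r i) = {b}))"
proof -
  interpret state_space H \<Delta> B
  proof -
    interpret graded_connected_hopf_algebra H \<Delta> by (rule hopf)
    show "state_space H \<Delta> B"
      by unfold_locales (use fin_dim basis in \<open>auto simp: state_space_basis_def\<close>)
  qed
  have multi: "multigraded_state_space H \<Delta> B r HH BB" if "multigrading H \<Delta> B r HH BB" for r HH BB
    by unfold_locales (rule that)
  show ?thesis
  proof (intro conjI allI impI)
    fix cs assume "set cs \<subseteq> B 1 \<and> length cs = n"
    then show "stationary_distribution (B n) (hopf_power_chain B \<Delta> a n) (chain_distribution B \<Delta> cs)"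
      using a by (intro chain_distribution_stationary[OF n]) (auto simp: words_def)
  next
    fix p assume "stationary_distribution (B n) (hopf_power_chain B \<Delta> a n) p"
    then show "\<exists>!\<alpha>. (\<forall>M. M \<notin> multisets_of_size (B 1) n \<longrightarrow> \<alpha> M = 0) \<and>
        (\<forall>x\<in>B n. p x = (\<Sum>M\<in>multisets_of_size (B 1) n. \<alpha> M * mset_distribution B \<Delta> M x))"
      by (rule stationary_combination_unique[OF n a])
  next
    fix b assume "B 1 = {b}"
    then show "unique_stationary_distribution (B n) (hopf_power_chain B \<Delta> a n)
          (\<lambda>x. rescaling B \<Delta> n x / fact n * product_coeff B (replicate n b) x)"
      by (rule unique_stationary_single[OF n a])
  next
    fix r HH BB b
    assume *: "multigrading H \<Delta> B r HH BB \<and> (\<forall>i<r. BB (unit_multidegree r i) = {b i})"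
    show "\<forall>\<nu>\<in>multidegrees r. sum_list \<nu> = n \<longrightarrow> unique_stationary_distribution (BB \<nu>)
      (hopf_power_chain B \<Delta> a n) (chain_distribution B \<Delta> (multidegree_word b \<nu>))"
      using multigraded_state_space.unique_stationary_multigraded[OF multi, of r HH BB b] * a n by blast
  next
    assume "\<exists>p. unique_stationary_distribution (B n) (hopf_power_chain B \<Delta> a n) p"
    then show "\<exists>b. B 1 = {b}" using unique_imp_single[OF n a] by blast
  next
    fix r HH BB i
    assume *: "multigrading H \<Delta> B r HH BB \<and> (\<forall>\<nu>\<in>multidegrees r. \<nu> \<noteq> replicate r 0 \<longrightarrow>
       (\<exists>p. unique_stationary_distribution (BB \<nu>) (hopf_power_chain B \<Delta> a (sum_list \<nu>)) p))" and i: "i < r"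
    \<comment> \<open>Each multidegree carries the chain of its own total degree; for unit
      multidegrees this is the chain in degree \<open>1\<close>, not \<open>n\<close>.\<close>
    have u: "unit_multidegree r i \<in> multidegrees r" "sum_list (unit_multidegree r i) = 1"
      using unit_multidegree i by auto
    then have "unit_multidegree r i \<noteq> replicate r 0" by (auto simp: sum_list_replicate)
    then obtain p where "unique_stationary_distribution (BB (unit_multidegree r i)) (hopf_power_chain B \<Delta> a 1) p"
      using * u by metis
    then show "\<exists>b. BB (unit_multidegree r i) = {b}"
      using multigraded_state_space.unique_imp_single_unit[OF multi i a] * by blast
  qed
qed

end
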